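(* Let $X$ be a compact $1$-dimensional geodesic space, and assume $X$ is not contractible (so that $Conv(X)\neq\emptyset$). Assume we have a subset $X_\circ\subseteq X$ satisfying the following two properties: (i) $X$ deformation retracts to $X_\circ$, and (ii) if $X$ deformation retracts to some subset $Y\subseteq X$, then $X_\circ\subseteq Y$. Then $X_\circ$ coincides with the $\pi_1$-hull $Conv(X)$.
   Context: A path in a metric space $(X,d)$ is a continuous map $\gamma:[a,b]\to X$; a loop is a path with $\gamma(a)=\gamma(b)$. The length of a path is $l(\gamma)=\sup\sum_{i=1}^n d(\gamma(x_{i-1}),\gamma(x_i))$ over all finite $a=x_0<\dots<x_n=b$; $\gamma$ is rectifiable if $l(\gamma)<\infty$. A geodesic space is a metric space $(X,d)$ in which $d(p,q)$ is the infimum of the lengths of paths from $p$ to $q$ and this infimum is attained, for all $p,q$. Dimension means Lebesgue covering dimension. A geodesic loop is a rectifiable loop of minimal length in its free homotopy class. The $\pi_1$-hull $Conv(X)\subseteq X$ is the union of the images of all non-constant geodesic loops in $X$. *)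

theory Defs
  imports "HOL-Analysis.Analysis"
begin

text \<open>A metric space is rendered as a subset \<open>X\<close> of a type of class \<open>metric_space\<close>, with the induced
  metric and topology.  Paths are parametrised over \<open>{0..1}\<close>, as everywhere in the library; lengths,
  images and homotopy classes do not change under affine reparametrisation of \<open>[a,b]\<close>.\<close>

definition path_length :: "(real \<Rightarrow> 'a::metric_space) \<Rightarrow> ennreal" where
  "path_length g =
     (SUP (n, x) \<in> {(n::nat, x::nat \<Rightarrow> real). x 0 = 0 \<and> x n = 1 \<and> (\<forall>i<n. x i < x (Suc i))}.
        \<Sum>i=1..n. ennreal (dist (g (x (i - 1))) (g (x i))))"

definition paths_between :: "'a::metric_space set \<Rightarrow> 'a \<Rightarrow> 'a \<Rightarrow> (real \<Rightarrow> 'a) set" where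
  "paths_between X p q =
     {g. path g \<and> path_image g \<subseteq> X \<and> pathstart g = p \<and> pathfinish g = q}"

definition geodesic_space :: "'a::metric_space set \<Rightarrow> bool" where
  "geodesic_space X \<longleftrightarrow>
     (\<forall>p\<in>X. \<forall>q\<in>X.
        ennreal (dist p q) = (INF g \<in> paths_between X p q. path_length g) \<and>
        (\<exists>g \<in> paths_between X p q. path_length g = ennreal (dist p q)))"

text \<open>Lebesgue covering dimension: every open cover has an open refinement of order at most
  \<open>n + 1\<close>.  As the dimension is a natural number here, the empty space gets dimension \<open>0\<close> rather
  than the conventional \<open>-1\<close>.\<close>

definition covering_dim_le :: "'a topology \<Rightarrow> nat \<Rightarrow> bool" where
  "covering_dim_le T n \<longleftrightarrow>
     (\<forall>\<U>. (\<forall>U\<in>\<U>. openin T U) \<and> \<Union>\<U> = topspace T \<longrightarrow>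
        (\<exists>\<V>. (\<forall>V\<in>\<V>. openin T V) \<and> \<Union>\<V> = topspace T \<and>
             (\<forall>V\<in>\<V>. \<exists>U\<in>\<U>. V \<subseteq> U) \<and>
             (\<forall>x\<in>topspace T. finite {V\<in>\<V>. x \<in> V} \<and> card {V\<in>\<V>. x \<in> V} \<le> n + 1)))"

definition has_covering_dim :: "'a topology \<Rightarrow> nat \<Rightarrow> bool" where
  "has_covering_dim T n \<longleftrightarrow> covering_dim_le T n \<and> (\<forall>m<n. \<not> covering_dim_le T m)"

definition geodesic_loop :: "'a::metric_space set \<Rightarrow> (real \<Rightarrow> 'a) \<Rightarrow> bool" where
  "geodesic_loop X g \<longleftrightarrow>
     path g \<and> path_image g \<subseteq> X \<and> pathfinish g = pathstart g \<and> path_length g < \<infinity> \<and>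
     (\<forall>h. homotopic_loops X g h \<longrightarrow> path_length g \<le> path_length h)"

definition pi1_hull :: "'a::metric_space set \<Rightarrow> 'a set" where
  "pi1_hull X = (\<Union>g \<in> {g. geodesic_loop X g \<and> \<not> g constant_on {0..1}}. path_image g)"

text \<open>A deformation retraction keeps the points of \<open>Y\<close> fixed throughout the homotopy.\<close>

definition deformation_retracts_to :: "'a::topological_space set \<Rightarrow> 'a set \<Rightarrow> bool" where
  "deformation_retracts_to X Y \<longleftrightarrow>
     (\<exists>r. retraction X Y r \<and> homotopic_with_canon (\<lambda>h. \<forall>y\<in>Y. h y = y) X X id r)"

end

theory Submission
  imports Defs "HOL-Complex_Analysis.Winding_Numbers"
begin

text \<open>Loops are compared through the winding numbers of their images under continuous maps
  \<open>f : X \<rightarrow> \<complex> - {0}\<close>.  As \<open>X\<close> is one-dimensional, every map \<open>X \<rightarrow> \<complex>\<close> can be perturbed off 0, so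
  such maps may be prescribed approximately; in particular a map supported near a point \<open>z\<close> of a
  geodesic detects a loop formed by that geodesic and a path avoiding \<open>z\<close>.  Winding numbers survive
  uniform limits, so a loop of least length among those with prescribed winding numbers exists, and
  it is a geodesic loop.  Hence points detected by maps with arbitrarily small support lie in the hull,
  and they also lie in every deformation retract.

  If \<open>X\<close> deformation retracts to \<open>Y\<close>, there are no such points outside \<open>Y\<close>, which makes shortest paths
  to \<open>Y\<close> unique; moving along them shortens any loop that leaves \<open>Y\<close>, so geodesic loops stay in \<open>Y\<close>.
  Conversely, if \<open>q\<close> is outside the hull, then small balls around \<open>q\<close> contain no detectable loops and
  exactly one component of \<open>X - {q}\<close> does; some nearby point \<open>p\<close> of that component then cuts off a treelike
  branch containing \<open>q\<close>, which can be retracted to \<open>p\<close>.\<close>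

subsection \<open>Degrees of loops under maps to the punctured plane\<close>


text \<open>\<open>X\<close> may be as wild as the Hawaiian earring: there need be no universal
  cover and arbitrarily small loops may be essential, so a limit of loops cannot be compared with
  its terms by local homotopies. Degrees see at most the abelianised loop, but they suffice: a loop
  that is shortest among all loops with its degrees is in particular shortest in its free homotopy
  class. Detection near a point does not give the whole hull. A loop crosses the bridge of a barbell
  equally often in both directions, so maps supported near a bridge point have degree 0 on all
  loops; such points come from two essential loops on different sides of the point, see
  \<open>separated_essential_loops_in_hull\<close>. Accordingly, the inclusion of the hull in a
  retract \<open>Y\<close> rests on the absence of essential points outside \<open>Y\<close>, not on
  essential points of the hull. Maps into the punctured plane are localised by a linear cutoff in
  the plane; this may create zeros, which a small perturbation removes. That is why supported near a
  point means only: within 1/2 of 1 elsewhere.\<close>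

definition nonvanishing_on :: "'a::topological_space set \<Rightarrow> ('a \<Rightarrow> complex) \<Rightarrow> bool" where
  "nonvanishing_on X f \<longleftrightarrow> continuous_on X f \<and> (\<forall>x\<in>X. f x \<noteq> 0)"

text \<open>Used for open paths as well, with complex values: only for loops is it a homotopy
  invariant integer, but additivity under concatenation holds throughout and lets loops be cut into
  arcs.\<close>

abbreviation deg :: "('a \<Rightarrow> complex) \<Rightarrow> (real \<Rightarrow> 'a) \<Rightarrow> complex" where
  "deg f c \<equiv> winding_number (f \<circ> c) 0"

lemma nonvanishing_path:
  assumes "nonvanishing_on X f" "path p" "path_image p \<subseteq> X"
  shows "path (f \<circ> p)" "0 \<notin> path_image (f \<circ> p)"
proof -
  show "path (f \<circ> p)"
    using assms by (auto simp: nonvanishing_on_def intro!: path_continuous_image elim: continuous_on_subset)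
  show "0 \<notin> path_image (f \<circ> p)"
    using assms by (auto simp: nonvanishing_on_def path_image_compose)
qed

lemma deg_join:
  assumes "nonvanishing_on X f" "path p" "path_image p \<subseteq> X" "path q" "path_image q \<subseteq> X"
    and "pathfinish p = pathstart q"
  shows "deg f (p +++ q) = deg f p + deg f q"
proof -
  have "pathfinish (f \<circ> p) = pathstart (f \<circ> q)"
    using assms(6) by (simp add: pathfinish_def pathstart_def)
  then show ?thesis
    unfolding path_compose_join
    by (intro winding_number_join nonvanishing_path[OF assms(1)] assms)
qed

lemma deg_reversepath:
  assumes "nonvanishing_on X f" "path p" "path_image p \<subseteq> X"
  shows "deg f (reversepath p) = - deg f p"
  unfolding path_compose_reversepath
  by (intro winding_number_reversepath nonvanishing_path[OF assms(1)] assms)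

lemma deg_homotopic_loops:
  assumes "nonvanishing_on X f" "homotopic_loops X p q"
  shows "deg f p = deg f q"
proof (rule winding_number_homotopic_loops)
  show "homotopic_loops (- {0}) (f \<circ> p) (f \<circ> q)"
    using assms by (intro homotopic_loops_continuous_image) (auto simp: nonvanishing_on_def)
qed

text \<open>The values of \<open>f\<close> along the loop stay in a disc around \<open>w\<close>
  that misses 0, where they can be compared with the constant loop at \<open>w\<close>.\<close>

lemma deg_loop_small:
  assumes "path p" "path_image p \<subseteq> X" "pathfinish p = pathstart p" "nonvanishing_on X f"
    and small: "\<And>x. x \<in> path_image p \<Longrightarrow> norm (f x - w) < norm w"
  shows "deg f p = 0"
proof -
  have "w \<noteq> 0" using small[of "p 0"] by (auto simp: path_image_def)
  have "deg f p = winding_number (\<lambda>t. w) 0"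
  proof (rule winding_number_nearby_loops_eq)
    show "path (f \<circ> p)" by (rule nonvanishing_path) fact+
    show "pathfinish (f \<circ> p) = pathstart (f \<circ> p)"
      using assms(3) by (simp add: pathfinish_def pathstart_def)
    show "norm ((f \<circ> p) t - w) < norm (w - 0)" if "t \<in> {0..1}" for t
      using small[of "p t"] that by (auto simp: path_image_def)
  qed (auto simp: path_def pathfinish_def pathstart_def)
  then show ?thesis using \<open>w \<noteq> 0\<close> by (simp add: winding_number_zero_const)
qed

definition loop_in :: "'a::topological_space set \<Rightarrow> (real \<Rightarrow> 'a) \<Rightarrow> bool" where
  "loop_in X c \<longleftrightarrow> path c \<and> path_image c \<subseteq> X \<and> pathfinish c = pathstart c"

text \<open>Compactness bounds \<open>norm (f x)\<close> below by some \<open>m > 0\<close> and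
  makes \<open>f\<close> uniformly continuous, so \<open>e\<close> depends on \<open>f\<close> and
  not on the loops. This is what carries degrees to uniform limits.\<close>

lemma deg_near:
  fixes X :: "'a::metric_space set"
  assumes "compact X" "nonvanishing_on X f"
  shows "\<exists>e>0. \<forall>p q. loop_in X p \<longrightarrow> loop_in X q \<longrightarrow> (\<forall>t\<in>{0..1}. dist (p t) (q t) < e) \<longrightarrow> deg f p = deg f q"
proof (cases "X = {}")
  case True
  then show ?thesis by (intro exI[of _ 1]) (auto simp: loop_in_def path_image_def)
next
  case False
  have cf: "continuous_on X (\<lambda>x. norm (f x))"
    using assms by (auto simp: nonvanishing_on_def intro: continuous_intros)
  obtain x0 where x0: "x0 \<in> X" "\<And>x. x \<in> X \<Longrightarrow> norm (f x0) \<le> norm (f x)"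
    using continuous_attains_inf[OF assms(1) False cf] by auto
  define m where "m = norm (f x0)"
  have "m > 0" using x0 assms by (auto simp: m_def nonvanishing_on_def)
  have "uniformly_continuous_on X f"
    using assms by (auto simp: nonvanishing_on_def intro: compact_uniformly_continuous)
  then obtain e where e: "e > 0" "\<And>x y. \<lbrakk>x \<in> X; y \<in> X; dist x y < e\<rbrakk> \<Longrightarrow> dist (f x) (f y) < m"
    unfolding uniformly_continuous_on_def using \<open>m > 0\<close> by (metis dist_commute)
  show ?thesis
  proof (intro exI[of _ e] conjI allI impI e(1))
    fix p q assume "loop_in X p" "loop_in X q" and pq: "\<forall>t\<in>{0..1}. dist (p t) (q t) < e"
    then have p: "path p" "path_image p \<subseteq> X" "pathfinish p = pathstart p"
      and q: "path q" "path_image q \<subseteq> X" "pathfinish q = pathstart q" by (auto simp: loop_in_def)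
    show "deg f p = deg f q"
    proof (rule winding_number_nearby_loops_eq)
      show "norm ((f \<circ> p) t - (f \<circ> q) t) < norm ((f \<circ> q) t - 0)" if t: "t \<in> {0..1}" for t
      proof -
        have "p t \<in> X" "q t \<in> X" using t p q by (auto simp: path_image_def)
        then show ?thesis using e(2)[of "p t" "q t"] pq t x0(2)[of "q t"]
          by (force simp: dist_norm m_def)
      qed
    qed (use p q nonvanishing_path[OF assms(2)] in \<open>auto simp: pathfinish_def pathstart_def\<close>)
  qed
qed

text \<open>The library's \<open>subpath\<close> is restricted to normed vector spaces.\<close>

definition subarc :: "real \<Rightarrow> real \<Rightarrow> (real \<Rightarrow> 'a) \<Rightarrow> real \<Rightarrow> 'a" where
  "subarc u v c = (\<lambda>t. c ((v - u) * t + u))"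

lemma subarc_ends [simp]: "pathstart (subarc u v c) = c u" "pathfinish (subarc u v c) = c v"
  by (auto simp: subarc_def pathstart_def pathfinish_def)

lemma subarc_0_1 [simp]: "subarc 0 1 c = c"
  by (simp add: subarc_def)

lemma subarc_1_0: "subarc 1 0 c = reversepath c"
  by (simp add: subarc_def reversepath_def)

lemma deg_subarc_combine:
  assumes "nonvanishing_on X f" "path p" "path_image p \<subseteq> X" "u \<in> {0..1}" "v \<in> {0..1}" "w \<in> {0..1}"
  shows "deg f (subarc u v p) + deg f (subarc v w p) = deg f (subarc u w p)"
proof -
  have "f \<circ> subarc s t p = subpath s t (f \<circ> p)" for s t by (auto simp: subpath_def subarc_def)
  then show ?thesis
    using winding_number_subpath_combine[OF nonvanishing_path[OF assms(1-3)] assms(4-6)] by simp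
qed

lemma negligible_segment:
  fixes a b :: complex
  shows "negligible (closed_segment a b)"
  by (simp add: negligible_convex_interior interior_closed_segment_ge2)

text \<open>A partition of unity subordinate to a cover of order two maps \<open>X\<close> into finitely many
  segments of the plane, so that a small translation avoids the origin.\<close>

lemma one_dim_avoids_zero:
  fixes X :: "'a::metric_space set" and F :: "'a \<Rightarrow> complex"
  assumes "compact X" and dim: "covering_dim_le (top_of_set X) 1"
    and F: "continuous_on X F" and "e > 0"
  obtains G where "nonvanishing_on X G" "\<And>x. x \<in> X \<Longrightarrow> norm (G x - F x) < e"
proof -
  \<comment> \<open>Sets on which \<open>F\<close> stays within \<open>e/4\<close> of one value; the
    weighted means \<open>H\<close> of such values then stay within \<open>e/4\<close> of
    \<open>F\<close>, which leaves room for a translation by \<open>z\<close>.\<close>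
  define \<U> where "\<U> = (\<lambda>w. X \<inter> F -` ball w (e/4)) ` UNIV"
  have "\<forall>U\<in>\<U>. openin (top_of_set X) U"
    using F by (auto simp: \<U>_def intro!: continuous_openin_preimage_gen)
  moreover have "\<Union>\<U> = topspace (top_of_set X)"
  proof -
    have "x \<in> \<Union>\<U>" if "x \<in> X" for x
      using that \<open>e > 0\<close> by (auto simp: \<U>_def intro!: exI[of _ "F x"])
    then show ?thesis by (auto simp: \<U>_def)
  qed
  ultimately obtain \<V> where \<V>: "\<forall>V\<in>\<V>. openin (top_of_set X) V" "\<Union>\<V> = X"
      "\<forall>V\<in>\<V>. \<exists>U\<in>\<U>. V \<subseteq> U"
      "\<forall>x\<in>X. finite {V\<in>\<V>. x \<in> V} \<and> card {V\<in>\<V>. x \<in> V} \<le> 2"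
    using dim unfolding covering_dim_le_def by (auto simp: numeral_2_eq_2 elim!: allE[of _ \<U>])
  have "\<forall>V\<in>\<V>. \<exists>w. \<forall>x\<in>V. norm (w - F x) < e/4"
    using \<V>(3) by (fastforce simp: \<U>_def dist_norm)
  then obtain w where w: "\<And>V x. \<lbrakk>V \<in> \<V>; x \<in> V\<rbrakk> \<Longrightarrow> norm (w V - F x) < e/4" by metis
  obtain \<W> where \<W>: "\<W> \<subseteq> \<V>" "finite \<W>" "X \<subseteq> \<Union>\<W>"
  proof -
    have "\<forall>\<C>. Ball \<C> (openin (top_of_set X)) \<and> X \<subseteq> \<Union>\<C> \<longrightarrow> (\<exists>\<D>\<subseteq>\<C>. finite \<D> \<and> X \<subseteq> \<Union>\<D>)"
      using assms(1) by (simp add: compact_eq_openin_cover)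
    then show thesis using \<V>(1,2) that by (metis order_refl)
  qed
  \<comment> \<open>\<open>subordinate_partition_of_unity\<close> takes open sets of the whole type,
    so each member of the finite subcover is written as a trace on \<open>X\<close>.\<close>
  have "\<forall>V\<in>\<W>. \<exists>T. open T \<and> V = X \<inter> T" using \<V>(1) \<W>(1) by (auto simp: openin_open)
  then obtain T where T: "\<And>V. V \<in> \<W> \<Longrightarrow> open (T V) \<and> V = X \<inter> T V" by metis
  have injT: "inj_on T \<W>" using T by (metis inj_onI)
  have cov: "X \<subseteq> \<Union>(T ` \<W>)" using \<W>(3) T by blast
  have opn: "open U" if "U \<in> T ` \<W>" for U using T that by auto
  have fin: "\<exists>V. open V \<and> x \<in> V \<and> finite {U \<in> T ` \<W>. U \<inter> V \<noteq> {}}" if "x \<in> X" for x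
    using \<W>(2) by (intro exI[of _ UNIV]) auto
  have "\<exists>\<phi>. (\<forall>U\<in>T ` \<W>. continuous_on X (\<phi> U) \<and> (\<forall>x\<in>X. 0 \<le> \<phi> U x)) \<and>
      (\<forall>U\<in>T ` \<W>. \<forall>x\<in>X. x \<notin> U \<longrightarrow> \<phi> U x = (0::real)) \<and> (\<forall>x\<in>X. supp_sum (\<lambda>W. \<phi> W x) (T ` \<W>) = 1)"
  proof (rule subordinate_partition_of_unity[OF cov opn fin])
    fix F
    assume a: "\<And>U. U \<in> T ` \<W> \<Longrightarrow> continuous_on X (F U) \<and> (\<forall>x\<in>X. (0::real) \<le> F U x)"
      and b: "\<And>x U. \<lbrakk>U \<in> T ` \<W>; x \<in> X; x \<notin> U\<rbrakk> \<Longrightarrow> F U x = 0"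
      and c: "\<And>x. x \<in> X \<Longrightarrow> supp_sum (\<lambda>W. F W x) (T ` \<W>) = 1"
    show ?thesis by (intro exI[of _ F] conjI ballI impI) (use a b c in blast)+
  qed
  then obtain \<phi> where \<phi>: "\<forall>U\<in>T ` \<W>. continuous_on X (\<phi> U) \<and> (\<forall>x\<in>X. 0 \<le> \<phi> U x)"
      "\<forall>U\<in>T ` \<W>. \<forall>x\<in>X. x \<notin> U \<longrightarrow> \<phi> U x = (0::real)" "\<forall>x\<in>X. supp_sum (\<lambda>W. \<phi> W x) (T ` \<W>) = 1"
    by blast
  define \<psi> where "\<psi> V = \<phi> (T V)" for V
  have \<psi>: "continuous_on X (\<psi> V)" "\<And>x. x \<in> X \<Longrightarrow> 0 \<le> \<psi> V x" "\<And>x. \<lbrakk>x \<in> X; x \<notin> V\<rbrakk> \<Longrightarrow> \<psi> V x = 0"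
    if V: "V \<in> \<W>" for V
  proof -
    show "continuous_on X (\<psi> V)" using \<phi>(1) V by (simp add: \<psi>_def)
    show "0 \<le> \<psi> V x" if "x \<in> X" for x using \<phi>(1) V that by (simp add: \<psi>_def)
    show "\<psi> V x = 0" if "x \<in> X" "x \<notin> V" for x
    proof -
      have "x \<notin> T V" using that T[OF V] by blast
      then show ?thesis using \<phi>(2) V that(1) by (simp add: \<psi>_def)
    qed
  qed
  have sum1: "(\<Sum>V\<in>\<W>. \<psi> V x) = 1" if "x \<in> X" for x
  proof -
    have "1 = (\<Sum>U | U \<in> T ` \<W> \<and> \<phi> U x \<noteq> 0. \<phi> U x)"
      using \<phi>(3) that by (simp add: supp_sum_def support_on_def)
    also have "\<dots> = (\<Sum>U\<in>T ` \<W>. \<phi> U x)"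
      by (intro sum.mono_neutral_left) (use \<W>(2) in auto)
    also have "\<dots> = (\<Sum>V\<in>\<W>. \<psi> V x)" by (simp add: sum.reindex[OF injT] \<psi>_def)
    finally show ?thesis by simp
  qed
  define H where "H x = (\<Sum>V\<in>\<W>. \<psi> V x *\<^sub>R w V)" for x
  have contH: "continuous_on X H"
    unfolding H_def by (intro continuous_intros \<psi>)
  have Hnear: "norm (H x - F x) \<le> e/4" if x: "x \<in> X" for x
  proof -
    have "H x - F x = (\<Sum>V\<in>\<W>. \<psi> V x *\<^sub>R (w V - F x))"
      using sum1[OF x] by (simp add: H_def scaleR_diff_right sum_subtractf flip: scaleR_sum_left)
    also have "norm \<dots> \<le> (\<Sum>V\<in>\<W>. \<psi> V x * (e/4))"
    proof (rule sum_norm_le)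
      fix V assume V: "V \<in> \<W>"
      show "norm (\<psi> V x *\<^sub>R (w V - F x)) \<le> \<psi> V x * (e/4)"
      proof (cases "x \<in> V")
        case True
        then have "norm (w V - F x) \<le> e/4" using w[of V x] V \<W>(1) by (intro less_imp_le) blast
        from mult_left_mono[OF this \<psi>(2)[OF V x]] show ?thesis using \<psi>(2)[OF V x] by simp
      next
        case False
        then show ?thesis using \<psi>(3)[OF V x] by simp
      qed
    qed
    also have "\<dots> = e/4" unfolding sum_distrib_right[symmetric] sum1[OF x] by simp
    finally show ?thesis .
  qed
  define N where "N = (\<Union>V\<in>\<W>. \<Union>V'\<in>\<W>. closed_segment (w V) (w V'))"
  have HN: "H x \<in> N" if x: "x \<in> X" for x
  proof -
    define S where "S = {V\<in>\<W>. x \<in> V}"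
    have "S \<subseteq> {V\<in>\<V>. x \<in> V}" using \<W>(1) by (auto simp: S_def)
    moreover have \<V>x: "finite {V\<in>\<V>. x \<in> V}" "card {V\<in>\<V>. x \<in> V} \<le> 2" using \<V>(4) x by auto
    ultimately have "finite S" "card S \<le> 2"
      using finite_subset[OF _ \<V>x(1), of S] card_mono[OF \<V>x(1), of S] by auto
    have "S \<noteq> {}" using \<W>(3) x by (auto simp: S_def)
    have HS: "H x = (\<Sum>V\<in>S. \<psi> V x *\<^sub>R w V)"
      unfolding H_def S_def by (rule sum.mono_neutral_right) (use \<W>(2) \<psi>(3) x in auto)
    have S1: "(\<Sum>V\<in>S. \<psi> V x) = 1"
      unfolding sum1[OF x, symmetric] S_def by (rule sum.mono_neutral_left) (use \<W>(2) \<psi>(3) x in auto)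
    have "card S = 1 \<or> card S = 2"
    proof -
      have "card S \<noteq> 0" using \<open>finite S\<close> \<open>S \<noteq> {}\<close> by simp
      then show ?thesis using \<open>card S \<le> 2\<close> by linarith
    qed
    then show ?thesis
    proof
      assume "card S = 1"
      then obtain V where "S = {V}" by (auto simp: card_1_singleton_iff)
      moreover have "V \<in> \<W>" using calculation by (auto simp: S_def)
      ultimately show ?thesis using HS S1 by (auto simp: N_def intro!: bexI[of _ V])
    next
      assume "card S = 2"
      then obtain V V' where S: "S = {V, V'}" "V \<noteq> V'" by (auto simp: card_2_iff)
      then have V: "V \<in> \<W>" "V' \<in> \<W>" by (auto simp: S_def)
      have "H x = \<psi> V x *\<^sub>R w V + \<psi> V' x *\<^sub>R w V'" "\<psi> V x + \<psi> V' x = 1"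
        using HS S1 S by auto
      moreover have "0 \<le> \<psi> V' x" "0 \<le> \<psi> V x" using \<psi>(2) V x by auto
      moreover have "\<psi> V x = 1 - \<psi> V' x" using calculation(2) by simp
      ultimately have "H x \<in> closed_segment (w V) (w V')"
        unfolding in_segment by (intro exI[of _ "\<psi> V' x"] conjI) simp_all
      then show ?thesis using V by (auto simp: N_def)
    qed
  qed
  have "negligible N" unfolding N_def
    by (intro negligible_Union) (auto intro!: negligible_Union negligible_segment simp: \<W>(2))
  moreover have "\<not> negligible (ball (0::complex) (e/4))"
    using \<open>e > 0\<close> by (intro open_not_negligible) auto
  ultimately obtain z where z: "z \<in> ball 0 (e/4)" "z \<notin> N"
    by (meson negligible_subset subsetI)
  show ?thesis
  proof (rule that[of "\<lambda>x. H x - z"])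
    show "nonvanishing_on X (\<lambda>x. H x - z)"
      using contH HN z by (auto simp: nonvanishing_on_def intro!: continuous_intros)
    fix x assume "x \<in> X"
    have "H x - z - F x = (H x - F x) - z" by simp
    then have "norm (H x - z - F x) \<le> norm (H x - F x) + norm z" by (metis norm_triangle_ineq4)
    then show "norm (H x - z - F x) < e" using Hnear[OF \<open>x \<in> X\<close>] z \<open>e > 0\<close> by simp
  qed
qed

subsection \<open>Lengths and Lipschitz paths\<close>


text \<open>Partition points form a list in which repetitions are allowed: refining is then
  insertion, and sums of several functions over the same points can be compared by list
  induction.\<close>

fun polygon_sum :: "(real \<Rightarrow> 'a::metric_space) \<Rightarrow> real list \<Rightarrow> real" where
  "polygon_sum g (x # y # zs) = dist (g x) (g y) + polygon_sum g (y # zs)"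
| "polygon_sum g _ = 0"

lemma polygon_sum_nonneg: "0 \<le> polygon_sum g xs"
  by (induction g xs rule: polygon_sum.induct) auto

lemma polygon_sum_Cons: "polygon_sum g xs \<le> polygon_sum g (x # xs)"
  by (cases xs) auto

lemma polygon_sum_insort: "polygon_sum g xs \<le> polygon_sum g (insort t xs)"
proof (induction g xs rule: polygon_sum.induct)
  case (1 g x y zs)
  have "dist (g x) (g y) \<le> dist (g x) (g t) + dist (g t) (g y)" by (rule dist_triangle)
  then show ?case using 1 by auto
qed auto

lemma polygon_sum_remdups_adj: "polygon_sum g (remdups_adj xs) = polygon_sum g xs"
proof (induction xs rule: remdups_adj.induct)
  case (3 x y xs)
  show ?case
  proof (cases "x = y")
    case False
    obtain zs where "remdups_adj (y # xs) = y # zs"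
      by (metis list.exhaust_sel remdups_adj_Nil_iff hd_remdups_adj list.distinct(1) list.sel(1))
    then show ?thesis using False 3 by simp
  qed (use 3 in auto)
qed auto

lemma polygon_sum_nth:
  "polygon_sum g xs = (\<Sum>i=1..length xs - 1. dist (g (xs ! (i - 1))) (g (xs ! i)))"
proof (induction g xs rule: polygon_sum.induct)
  case (1 g x y zs)
  have "(\<Sum>i=1..Suc (length zs). dist (g ((x # y # zs) ! (i - 1))) (g ((x # y # zs) ! i)))
      = dist (g x) (g y) + (\<Sum>i=Suc 1..Suc (length zs). dist (g ((x # y # zs) ! (i - 1))) (g ((x # y # zs) ! i)))"
    by (subst sum.atLeast_Suc_atMost) auto
  also have "(\<Sum>i=Suc 1..Suc (length zs). dist (g ((x # y # zs) ! (i - 1))) (g ((x # y # zs) ! i)))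
      = (\<Sum>i=1..length zs. dist (g ((y # zs) ! (i - 1))) (g ((y # zs) ! i)))"
    unfolding sum.shift_bounds_cl_Suc_ivl by (intro sum.cong) (auto simp: nth_Cons split: nat.splits)
  finally show ?case using 1 by simp
qed auto

lemma dist_le_polygon_sum:
  assumes "a \<in> set xs" "b \<in> set xs"
  shows "dist (g a) (g b) \<le> polygon_sum g xs"
  using assms
proof (induction g xs arbitrary: a b rule: polygon_sum.induct)
  case (1 g x y zs)
  have 2: "dist (g x) (g c) \<le> dist (g x) (g y) + polygon_sum g (y # zs)" if "c \<in> set (y # zs)" for c
  proof -
    have "dist (g y) (g c) \<le> polygon_sum g (y # zs)" using 1(1)[of y c] that by auto
    then show ?thesis using dist_triangle[of "g x" "g c" "g y"] by linarith
  qed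
  show ?case
  proof (cases "a = x \<or> b = x")
    case True
    then show ?thesis using 2[of a] 2[of b] 1(2,3) polygon_sum_nonneg[of g "y # zs"]
      by (auto simp: dist_commute)
  next
    case False
    then have "dist (g a) (g b) \<le> polygon_sum g (y # zs)" using 1 by auto
    then show ?thesis using polygon_sum_Cons[of g "y # zs" x] by linarith
  qed
qed auto

text \<open>Meant for a retraction that shortens: \<open>h\<close> is a loop, \<open>g\<close> its
  image under the retraction, \<open>k\<close> the distance to the retract. The variation of
  \<open>k\<close> bounds the loss of length from below.\<close>

lemma polygon_sum_mono:
  assumes "\<And>a b. \<lbrakk>a \<in> set xs; b \<in> set xs\<rbrakk> \<Longrightarrow> dist (g a) (g b) + dist (k a) (k b) \<le> dist (h a) (h b)"
  shows "polygon_sum g xs + polygon_sum k xs \<le> polygon_sum h xs"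
  using assms
proof (induction xs rule: induct_list012)
  case (3 x y zs)
  have "polygon_sum g (y # zs) + polygon_sum k (y # zs) \<le> polygon_sum h (y # zs)"
    by (rule 3(2)) (use 3(3) in auto)
  moreover have "dist (g x) (g y) + dist (k x) (k y) \<le> dist (h x) (h y)" by (rule 3(3)) auto
  ultimately show ?case by simp
qed auto

lemma polygon_sum_lipschitz:
  assumes "L-lipschitz_on {0..1} g" "sorted (x # xs)" "set (x # xs) \<subseteq> {0..1}"
  shows "polygon_sum g (x # xs) \<le> L * (last (x # xs) - x)"
  using assms(2,3)
proof (induction xs arbitrary: x)
  case (Cons y ys)
  have "dist (g x) (g y) \<le> L * (y - x)"
    using lipschitz_onD[OF assms(1), of x y] Cons(2,3) by (auto simp: dist_real_def)
  then show ?case using Cons(1)[of y] Cons(2,3) by (auto simp: algebra_simps)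
qed simp

lemma distinct_remdups_adj_sorted: "sorted xs \<Longrightarrow> distinct (remdups_adj xs)"
  by (induction xs rule: remdups_adj.induct) auto

text \<open>Inserting 0 and 1 and deleting repetitions gives a partition as in
  \<open>path_length\<close>; the insertion does not lower the sum and the deletion does not change
  it.\<close>

lemma polygon_sum_le_path_length:
  fixes g :: "real \<Rightarrow> 'a::metric_space"
  assumes "sorted xs" "set xs \<subseteq> {0..1}"
  shows "ennreal (polygon_sum g xs) \<le> path_length g"
proof -
  define ys where "ys = remdups_adj (insort 0 (insort 1 xs))"
  define x where "x i = ys ! i" for i
  define n where "n = length ys - 1"
  have so: "sorted ys" unfolding ys_def using assms(1)
    by (intro sorted_remdups_adj) (auto simp: sorted_insort)
  have di: "distinct ys" unfolding ys_def using assms(1)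
    by (intro distinct_remdups_adj_sorted) (auto simp: sorted_insort)
  have se: "set ys = {0, 1} \<union> set xs" by (auto simp: ys_def set_insort_key)
  then have "ys \<noteq> []" by auto
  have len: "length ys = Suc n" using \<open>ys \<noteq> []\<close> by (cases ys) (auto simp: n_def)
  have x01: "x i \<in> {0..1}" if "i \<le> n" for i
  proof -
    have "x i \<in> set ys" unfolding x_def using that len by (intro nth_mem) simp
    then show ?thesis using se assms(2) by auto
  qed
  have inc: "x i < x (Suc i)" if "i < n" for i
  proof -
    have "x i \<le> x (Suc i)" unfolding x_def using that len by (intro sorted_nth_mono[OF so]) auto
    moreover have "x i \<noteq> x (Suc i)" unfolding x_def using that len nth_eq_iff_index_eq[OF di] by auto
    ultimately show ?thesis by simp
  qed
  have ex: "\<exists>i\<le>n. x i = t" if "t \<in> set ys" for t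
    using that len by (auto simp: in_set_conv_nth x_def less_Suc_eq_le)
  have mono: "x i \<le> x j" if "i \<le> j" "j \<le> n" for i j
    unfolding x_def using that len by (intro sorted_nth_mono[OF so]) auto
  obtain i j where "i \<le> n" "x i = 0" "j \<le> n" "x j = 1"
    using ex[of 0] ex[of 1] se by auto
  then have "x 0 = 0" "x n = 1"
    using x01[of 0] x01[of n] mono[of 0 i] mono[of j n] by auto
  have "ennreal (polygon_sum g xs) \<le> ennreal (polygon_sum g ys)"
    unfolding ys_def polygon_sum_remdups_adj
    by (intro ennreal_leI order_trans[OF polygon_sum_insort polygon_sum_insort])
  also have "\<dots> = (\<Sum>i=1..n. ennreal (dist (g (x (i - 1))) (g (x i))))"
    unfolding polygon_sum_nth x_def n_def by (simp add: sum_ennreal)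
  also have "\<dots> \<le> path_length g"
    unfolding path_length_def
    by (rule SUP_upper2[of "(n, x)"]) (use \<open>x 0 = 0\<close> \<open>x n = 1\<close> inc in auto)
  finally show ?thesis .
qed

lemma path_length_leI:
  fixes g :: "real \<Rightarrow> 'a::metric_space"
  assumes "\<And>xs. \<lbrakk>sorted xs; set xs \<subseteq> {0..1}\<rbrakk> \<Longrightarrow> ennreal (polygon_sum g xs) \<le> B"
  shows "path_length g \<le> B"
  unfolding path_length_def
proof (rule SUP_least, clarify)
  fix n :: nat and x :: "nat \<Rightarrow> real"
  assume x: "x 0 = 0" "x n = 1" "\<forall>i<n. x i < x (Suc i)"
  have mono: "x i \<le> x j" if "i \<le> j" "j \<le> n" for i j
    using that
  proof (induction j rule: dec_induct)
    case (step j)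
    then show ?case using x(3) by (meson Suc_leD Suc_le_lessD less_eq_real_def order_trans)
  qed simp
  define xs where "xs = map x [0..<Suc n]"
  have "sorted xs" by (auto simp: xs_def sorted_iff_nth_mono mono simp del: upt_Suc)
  moreover have "set xs \<subseteq> {0..1}" using mono[of 0] mono[of _ n] x by (auto simp: xs_def simp del: upt_Suc)
  ultimately have "ennreal (polygon_sum g xs) \<le> B" by (rule assms)
  moreover have "(\<Sum>i=1..n. dist (g (x (i - 1))) (g (x i))) = polygon_sum g xs"
    unfolding polygon_sum_nth by (intro sum.cong) (auto simp: xs_def simp del: upt_Suc)
  ultimately show "(\<Sum>i=1..n. ennreal (dist (g (x (i - 1))) (g (x i)))) \<le> B"
    by (simp add: sum_ennreal)
qed

lemma path_length_lipschitz:
  assumes "L-lipschitz_on {0..1} g"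
  shows "path_length g \<le> ennreal L"
proof (rule path_length_leI)
  fix xs :: "real list" assume xs: "sorted xs" "set xs \<subseteq> {0..1}"
  have "0 \<le> L" using assms by (rule lipschitz_on_nonneg)
  show "ennreal (polygon_sum g xs) \<le> ennreal L"
  proof (cases xs)
    case (Cons y ys)
    have "polygon_sum g xs \<le> L * (last xs - y)"
      using polygon_sum_lipschitz[OF assms] xs Cons by metis
    also have "last xs - y \<le> 1" using xs Cons last_in_set[of xs] by force
    then have "L * (last xs - y) \<le> L" using \<open>0 \<le> L\<close> by (simp add: mult_left_le)
    finally show ?thesis by (rule ennreal_leI)
  qed simp
qed

lemma path_length_pos:
  fixes g :: "real \<Rightarrow> 'a::metric_space"
  assumes "s \<in> {0..1}" "t \<in> {0..1}" "g s \<noteq> g t"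
  shows "0 < path_length g"
proof -
  have "ennreal (polygon_sum g [min s t, max s t]) \<le> path_length g"
    using assms by (intro polygon_sum_le_path_length) auto
  moreover have "0 < polygon_sum g [min s t, max s t]"
    using assms by (auto simp: min_def max_def)
  ultimately show ?thesis by (metis ennreal_less_zero_iff less_le_trans)
qed

text \<open>Lipschitz paths are rectifiable, stable under cutting, reversing and joining, and
  compact once the constant is bounded. The constant is hidden here; where it matters,
  \<open>lipschitz_on\<close> is used directly.\<close>

definition lip_path :: "'a::metric_space set \<Rightarrow> (real \<Rightarrow> 'a) \<Rightarrow> bool" where
  "lip_path X c \<longleftrightarrow> path_image c \<subseteq> X \<and> (\<exists>L. L-lipschitz_on {0..1} c)"

lemma lip_path_imp_path: "lip_path X c \<Longrightarrow> path c"
  by (auto simp: lip_path_def path_def intro: lipschitz_on_continuous_on)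

lemma lip_path_image: "lip_path X c \<Longrightarrow> path_image c \<subseteq> X"
  by (simp add: lip_path_def)

lemma lip_path_mono: "\<lbrakk>lip_path X c; path_image c \<subseteq> Y\<rbrakk> \<Longrightarrow> lip_path Y c"
  by (simp add: lip_path_def)

lemma segment_param_unit:
  fixes u v r :: real
  assumes "u \<in> {0..1}" "v \<in> {0..1}" "r \<in> {0..1}"
  shows "(v - u) * r + u \<in> {0..1}"
proof -
  have "(v - u) * r + u = (1 - r) *\<^sub>R u + r *\<^sub>R v" by (simp add: algebra_simps)
  then show ?thesis using convexD_alt[OF convex_real_interval(5)[of 0 1] assms(1,2)] assms(3) by auto
qed

lemma path_image_subarc_subset:
  "\<lbrakk>u \<in> {0..1}; v \<in> {0..1}\<rbrakk> \<Longrightarrow> path_image (subarc u v c) \<subseteq> path_image c"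
  using segment_param_unit[of u v] by (force simp: path_image_def subarc_def)

lemma lipschitz_on_subarc:
  assumes "L-lipschitz_on {0..1} c" "u \<in> {0..1}" "v \<in> {0..1}"
  shows "(L * \<bar>v - u\<bar>)-lipschitz_on {0..1} (subarc u v c)"
proof (rule lipschitz_onI)
  have L: "0 \<le> L" using assms(1) by (rule lipschitz_on_nonneg)
  then show "0 \<le> L * \<bar>v - u\<bar>" by simp
  fix s t :: real assume st: "s \<in> {0..1}" "t \<in> {0..1}"
  have *: "(v - u) * r + u \<in> {0..1}" if "r \<in> {0..1}" for r
    using assms(2,3) that by (rule segment_param_unit)
  have "dist (subarc u v c s) (subarc u v c t) \<le> L * dist ((v - u) * s + u) ((v - u) * t + u)"
    unfolding subarc_def by (rule lipschitz_onD[OF assms(1) * *]) (use st in auto)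
  also have "dist ((v - u) * s + u) ((v - u) * t + u) = \<bar>v - u\<bar> * dist s t"
    by (simp add: dist_real_def abs_mult[symmetric] algebra_simps)
  finally show "dist (subarc u v c s) (subarc u v c t) \<le> L * \<bar>v - u\<bar> * dist s t" by simp
qed

lemma lip_path_subarc:
  "\<lbrakk>lip_path X c; u \<in> {0..1}; v \<in> {0..1}\<rbrakk> \<Longrightarrow> lip_path X (subarc u v c)"
  unfolding lip_path_def using path_image_subarc_subset[of u v c]
  by (meson lipschitz_on_subarc subset_trans)

lemma lip_path_reversepath: "lip_path X c \<Longrightarrow> lip_path X (reversepath c)"
  using lip_path_subarc[of X c 1 0] by (simp add: subarc_1_0)

lemma lipschitz_on_joinpaths:
  assumes p: "A-lipschitz_on {0..1} p" and q: "B-lipschitz_on {0..1} q"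
    and "pathfinish p = pathstart q"
  shows "(2 * max A B)-lipschitz_on {0..1} (p +++ q)"
proof -
  have "(2 * A)-lipschitz_on {0..1/2} (\<lambda>t. p (2 * t))"
  proof (rule lipschitz_onI)
    fix s t :: real assume "s \<in> {0..1/2}" "t \<in> {0..1/2}"
    then have "dist (p (2 * s)) (p (2 * t)) \<le> A * dist (2 * s) (2 * t)"
      by (intro lipschitz_onD[OF p]) auto
    then show "dist (p (2 * s)) (p (2 * t)) \<le> 2 * A * dist s t" by (simp add: dist_real_def abs_if algebra_simps split: if_splits)
  qed (use lipschitz_on_nonneg[OF p] in simp)
  moreover have "(2 * B)-lipschitz_on {1/2..1} (\<lambda>t. q (2 * t - 1))"
  proof (rule lipschitz_onI)
    fix s t :: real assume "s \<in> {1/2..1}" "t \<in> {1/2..1}"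
    then have "dist (q (2 * s - 1)) (q (2 * t - 1)) \<le> B * dist (2 * s - 1) (2 * t - 1)"
      by (intro lipschitz_onD[OF q]) auto
    then show "dist (q (2 * s - 1)) (q (2 * t - 1)) \<le> 2 * B * dist s t" by (simp add: dist_real_def abs_if algebra_simps split: if_splits)
  qed (use lipschitz_on_nonneg[OF q] in simp)
  ultimately have "(max (2 * A) (2 * B))-lipschitz_on {0..1} (\<lambda>t. if t \<le> 1/2 then p (2 * t) else q (2 * t - 1))"
    using assms(3) by (intro lipschitz_on_concat_max) (auto simp: pathfinish_def pathstart_def)
  then show ?thesis unfolding joinpaths_def by (simp add: max_mult_distrib_left)
qed

lemma lip_path_join:
  "\<lbrakk>lip_path X p; lip_path X q; pathfinish p = pathstart q\<rbrakk> \<Longrightarrow> lip_path X (p +++ q)"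
  unfolding lip_path_def by (meson lipschitz_on_joinpaths subset_path_image_join)

subsection \<open>Geodesics\<close>


text \<open>The upper bound already forces constant speed, by \<open>geodesic_arc_dist\<close>.
  Equal endpoints are allowed and make the arc constant.\<close>

definition geodesic_arc :: "'a::metric_space set \<Rightarrow> (real \<Rightarrow> 'a) \<Rightarrow> bool" where
  "geodesic_arc X c \<longleftrightarrow> path_image c \<subseteq> X \<and> (dist (c 0) (c 1))-lipschitz_on {0..1} c"

lemma geodesic_arc_lip_path: "geodesic_arc X c \<Longrightarrow> lip_path X c"
  by (auto simp: geodesic_arc_def lip_path_def)

lemma geodesic_arc_path: "geodesic_arc X c \<Longrightarrow> path c"
  by (meson geodesic_arc_lip_path lip_path_imp_path)

lemma geodesic_arc_image:
  assumes "geodesic_arc X c"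
  shows "path_image c \<subseteq> X" "connected (path_image c)" "compact (path_image c)" "closed (path_image c)"
    "c 0 \<in> path_image c" "c 1 \<in> path_image c" "c 0 \<in> X" "c 1 \<in> X"
  using assms geodesic_arc_path[OF assms]
  by (auto simp: geodesic_arc_def connected_path_image compact_path_image closed_path_image)
    (auto simp: path_image_def)

text \<open>The Lipschitz bounds for the three pieces cut off by \<open>s\<close> and
  \<open>t\<close> add up to the distance of the endpoints, so by the triangle inequality none of
  them is strict.\<close>

lemma geodesic_arc_dist:
  assumes c: "geodesic_arc X c" and st: "s \<in> {0..1}" "t \<in> {0..1}"
  shows "dist (c s) (c t) = \<bar>s - t\<bar> * dist (c 0) (c 1)"
proof -
  have "dist (c s) (c t) = (t - s) * dist (c 0) (c 1)" if st: "s \<in> {0..1}" "t \<in> {0..1}" "s \<le> t" for s t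
  proof -
    have L: "(dist (c 0) (c 1))-lipschitz_on {0..1} c" using c by (simp add: geodesic_arc_def)
    have "dist (c 0) (c 1) \<le> dist (c 0) (c s) + dist (c s) (c t) + dist (c t) (c 1)"
      by (smt (verit) dist_triangle)
    moreover have "dist (c 0) (c s) \<le> dist (c 0) (c 1) * s" "dist (c t) (c 1) \<le> dist (c 0) (c 1) * (1 - t)"
      "dist (c s) (c t) \<le> dist (c 0) (c 1) * (t - s)"
      using lipschitz_onD[OF L, of 0 s] lipschitz_onD[OF L, of t 1] lipschitz_onD[OF L, of s t] st
      by (auto simp: dist_real_def)
    ultimately show ?thesis by (simp add: algebra_simps)
  qed
  from this[of s t] this[of t s] st show ?thesis by (cases "s \<le> t") (auto simp: dist_commute)
qed

lemma geodesic_arc_subarc: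
  assumes c: "geodesic_arc X c" and "u \<in> {0..1}" "v \<in> {0..1}"
  shows "geodesic_arc X (subarc u v c)"
proof -
  have "(dist (c 0) (c 1) * \<bar>v - u\<bar>)-lipschitz_on {0..1} (subarc u v c)"
    using assms by (intro lipschitz_on_subarc) (auto simp: geodesic_arc_def)
  moreover have "dist (subarc u v c 0) (subarc u v c 1) = dist (c 0) (c 1) * \<bar>v - u\<bar>"
    using geodesic_arc_dist[OF assms] by (simp add: subarc_def abs_minus_commute)
  ultimately show ?thesis
    using path_image_subarc_subset[OF assms(2,3), of c] c by (auto simp: geodesic_arc_def)
qed

lemma geodesic_arc_reversepath: "geodesic_arc X c \<Longrightarrow> geodesic_arc X (reversepath c)"
  using geodesic_arc_subarc[of X c 1 0] by (simp add: subarc_1_0)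

text \<open>On a path of length \<open>dist p q\<close> the triangle inequality is sharp, so two of
  its points are as far apart as their distances \<phi> from \<open>p\<close> differ. Hence \<phi>
  can serve as parameter; the choice of \<tau> is harmless because parameters with equal \<phi> have
  the same image point.\<close>

lemma geodesic_arc_exists:
  assumes "geodesic_space X" "p \<in> X" "q \<in> X"
  obtains c where "geodesic_arc X c" "c 0 = p" "c 1 = q"
proof -
  obtain g where g: "path g" "path_image g \<subseteq> X" "g 0 = p" "g 1 = q" "path_length g = ennreal (dist p q)"
  proof -
    have "\<exists>g\<in>paths_between X p q. path_length g = ennreal (dist p q)"
      using assms unfolding geodesic_space_def by blast
    then show thesis using that by (auto simp: paths_between_def pathstart_def pathfinish_def)
  qed
  define \<phi> where "\<phi> t = dist p (g t)" for t
  have tri: "\<phi> s + dist (g s) (g t) + dist (g t) q \<le> dist p q" if "0 \<le> s" "s \<le> t" "t \<le> 1" for s t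
  proof -
    have "ennreal (polygon_sum g [0, s, t, 1]) \<le> path_length g"
      using that by (intro polygon_sum_le_path_length) auto
    then have "polygon_sum g [0, s, t, 1] \<le> dist p q"
      unfolding g(5) by (simp add: ennreal_le_iff del: polygon_sum.simps)
    then show ?thesis using g by (simp add: \<phi>_def)
  qed
  have eq: "dist (g s) (g t) = \<bar>\<phi> s - \<phi> t\<bar>" if "s \<in> {0..1}" "t \<in> {0..1}" for s t
    using tri[of s t] tri[of t s] that dist_triangle[of p q "g t"] dist_triangle[of p q "g s"]
      dist_triangle[of p "g t" "g s"] dist_triangle[of p "g s" "g t"] dist_commute[of "g s" "g t"]
    unfolding \<phi>_def atLeastAtMost_iff by linarith
  have "continuous_on {0..1} \<phi>"
    unfolding \<phi>_def using g(1) by (auto simp: path_def intro: continuous_intros)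
  then have "\<exists>t\<in>{0..1}. \<phi> t = u * dist p q" if "u \<in> {0..1}" for u
    using IVT'[of \<phi> 0 "u * dist p q" 1] that g by (auto simp: \<phi>_def mult_left_le_one_le)
  then obtain \<tau> where \<tau>: "\<And>u. u \<in> {0..1} \<Longrightarrow> \<tau> u \<in> {0..1} \<and> \<phi> (\<tau> u) = u * dist p q" by metis
  define c where "c u = g (\<tau> u)" for u
  have d: "dist (c u) (c v) = \<bar>u - v\<bar> * dist p q" if "u \<in> {0..1}" "v \<in> {0..1}" for u v
    using eq[of "\<tau> u" "\<tau> v"] \<tau> that by (auto simp: c_def abs_mult simp flip: left_diff_distrib)
  have "c 0 = p" using \<tau>[of 0] by (simp add: c_def \<phi>_def)
  have "c 1 = q" using \<tau>[of 1] tri[of 0 "\<tau> 1"] g(3) by (simp add: c_def \<phi>_def)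
  show ?thesis
  proof (rule that[OF _ \<open>c 0 = p\<close> \<open>c 1 = q\<close>])
    have "path_image c \<subseteq> X" using \<tau> g(2) by (auto simp: path_image_def c_def)
    then show "geodesic_arc X c" unfolding geodesic_arc_def \<open>c 0 = p\<close> \<open>c 1 = q\<close>
      using d by (auto simp: dist_real_def mult.commute intro!: lipschitz_onI)
  qed
qed

lemma geodesic_arc_concat:
  assumes p: "geodesic_arc X p" and q: "geodesic_arc X q" and pq: "p 1 = q 0"
    and d: "dist (p 0) (p 1) + dist (q 0) (q 1) = dist (p 0) (q 1)"
  obtains c where "geodesic_arc X c" "c 0 = p 0" "c 1 = q 1" "path_image c = path_image p \<union> path_image q"
proof -
  define A where "A = dist (p 0) (p 1)"
  define B where "B = dist (q 0) (q 1)"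
  have const: "path_image r = {r 0, r 1}" if "geodesic_arc X r" "dist (r 0) (r 1) = 0" for r
  proof -
    have "r t = r 0" if "t \<in> {0..1}" for t
      using geodesic_arc_dist[OF \<open>geodesic_arc X r\<close> that, of 0] \<open>dist (r 0) (r 1) = 0\<close> by simp
    then have "path_image r \<subseteq> {r 0}" by (auto simp: path_image_def simp del: atLeastAtMost_iff)
    moreover have "r 0 \<in> path_image r" by (auto simp: path_image_def)
    ultimately show ?thesis using \<open>dist (r 0) (r 1) = 0\<close> by auto
  qed
  have ends: "r 0 \<in> path_image r" "r 1 \<in> path_image r" for r :: "real \<Rightarrow> 'a"
    by (auto simp: path_image_def)
  consider "A = 0" | "B = 0" | "A > 0" "B > 0"
    using zero_le_dist[of "p 0" "p 1"] zero_le_dist[of "q 0" "q 1"] unfolding A_def B_def by linarith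
  then show ?thesis
  proof cases
    case 1
    then have "path_image p = {q 0}" "p 0 = q 0" using const[OF p] pq by (auto simp: A_def)
    then show ?thesis using ends[of q] by (intro that[OF q]) auto
  next
    case 2
    then have "path_image q = {p 1}" "q 1 = p 1" using const[OF q] pq by (auto simp: B_def)
    then show ?thesis using ends[of p] by (intro that[OF p]) auto
  next
    case 3
    \<comment> \<open>Breaking the parameter interval in the ratio of the lengths gives both halves
      the speed \<open>A + B\<close>; the degenerate lengths were split off to avoid division by
      0.\<close>
    define s where "s = A / (A + B)"
    have s: "0 < s" "s < 1" using 3 by (auto simp: s_def)
    have AB: "A / s = A + B" "B / (1 - s) = A + B" using 3 by (auto simp: s_def field_simps)
    define c where "c t = (if t \<le> s then p (t / s) else q ((t - s) / (1 - s)))" for t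
    have "(A + B)-lipschitz_on {0..s} (\<lambda>t. p (t / s))"
    proof (rule lipschitz_onI)
      fix u v assume uv: "u \<in> {0..s}" "v \<in> {0..s}"
      have "dist (p (u / s)) (p (v / s)) \<le> A * dist (u / s) (v / s)"
        using p uv s unfolding geodesic_arc_def A_def by (intro lipschitz_onD) auto
      also have "dist (u / s) (v / s) = dist u v / s" using s by (simp add: dist_real_def flip: diff_divide_distrib)
      finally show "dist (p (u / s)) (p (v / s)) \<le> (A + B) * dist u v" by (simp flip: AB(1))
    qed (use 3 in auto)
    moreover have "(A + B)-lipschitz_on {s..1} (\<lambda>t. q ((t - s) / (1 - s)))"
    proof (rule lipschitz_onI)
      fix u v assume uv: "u \<in> {s..1}" "v \<in> {s..1}"
      have "dist (q ((u - s) / (1 - s))) (q ((v - s) / (1 - s))) \<le> B * dist ((u - s) / (1 - s)) ((v - s) / (1 - s))"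
        using q uv s unfolding geodesic_arc_def B_def by (intro lipschitz_onD) auto
      also have "dist ((u - s) / (1 - s)) ((v - s) / (1 - s)) = dist u v / (1 - s)"
        using s by (simp add: dist_real_def flip: diff_divide_distrib)
      finally show "dist (q ((u - s) / (1 - s))) (q ((v - s) / (1 - s))) \<le> (A + B) * dist u v"
        by (simp flip: AB(2))
    qed (use 3 in auto)
    ultimately have L: "(A + B)-lipschitz_on {0..1} c"
      unfolding c_def using s pq by (intro lipschitz_on_concat) auto
    have c01: "c 0 = p 0" "c 1 = q 1" using s by (auto simp: c_def)
    have "path_image c \<subseteq> path_image p \<union> path_image q"
      using s by (auto simp: path_image_def c_def)
    moreover have "path_image p \<subseteq> path_image c"
    proof (clarsimp simp: path_image_def)
      fix t :: real assume "0 \<le> t" "t \<le> 1"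
      then show "p t \<in> c ` {0..1}" using s by (intro image_eqI[of _ _ "t * s"]) (auto simp: c_def mult_le_one)
    qed
    moreover have "path_image q \<subseteq> path_image c"
    proof (clarsimp simp: path_image_def)
      fix t :: real assume t: "0 \<le> t" "t \<le> 1"
      have "t * (1 - s) \<le> 1 * (1 - s)" using t s by (intro mult_right_mono) auto
      then have "s + t * (1 - s) \<le> 1" by simp
      then show "q t \<in> c ` {0..1}" using s t pq
        by (intro image_eqI[of _ _ "s + t * (1 - s)"]) (auto simp: c_def mult_le_0_iff)
    qed
    ultimately have im: "path_image c = path_image p \<union> path_image q" by blast
    have "geodesic_arc X c"
      using L d p q im unfolding geodesic_arc_def c01 A_def B_def by auto
    then show ?thesis using that c01 im by blast
  qed
qed

lemma geodesic_arc_in_ball: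
  assumes "geodesic_space X" "x \<in> X" "y \<in> X" "dist x y < e"
  obtains c where "geodesic_arc X c" "c 0 = x" "c 1 = y" "path_image c \<subseteq> ball x e"
proof -
  obtain c where c: "geodesic_arc X c" "c 0 = x" "c 1 = y" by (rule geodesic_arc_exists[OF assms(1-3)])
  have "c t \<in> ball x e" if "t \<in> {0..1}" for t
  proof -
    have "dist x (c t) = t * dist x y" using geodesic_arc_dist[OF c(1), of 0 t] that c by auto
    also have "\<dots> \<le> dist x y" using that by (simp add: mult_left_le_one_le)
    finally show ?thesis using assms(4) by simp
  qed
  then have "path_image c \<subseteq> ball x e" by (auto simp: path_image_def)
  then show ?thesis using c that by blast
qed

lemma geodesic_space_connected:
  assumes "geodesic_space X"
  shows "connected X"
  unfolding connected_iff_connected_component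
proof (intro ballI)
  fix x y assume "x \<in> X" "y \<in> X"
  then obtain c where c: "geodesic_arc X c" "c 0 = x" "c 1 = y" by (rule geodesic_arc_exists[OF assms])
  then show "connected_component X x y"
    unfolding connected_component_def
    by (intro exI[of _ "path_image c"] conjI connected_path_image geodesic_arc_path[OF c(1)])
      (auto simp: path_image_def geodesic_arc_def)
qed

text \<open>Points of a small ball are joined to its centre by geodesics inside the ball, so
  \<open>X\<close> is locally connected.\<close>

lemma openin_connected_component_geodesic:
  assumes X: "geodesic_space X" and U: "openin (top_of_set X) U"
  shows "openin (top_of_set X) (connected_component_set U a)"
  unfolding openin_contains_ball
proof (intro conjI ballI)
  show "connected_component_set U a \<subseteq> X"
    using connected_component_subset[of U a] U openin_imp_subset by blast
  fix x assume x: "x \<in> connected_component_set U a"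
  then have "x \<in> U" using connected_component_subset by blast
  then obtain e where e: "e > 0" "ball x e \<inter> X \<subseteq> U" using U by (auto simp: openin_contains_ball)
  have "y \<in> connected_component_set U a" if y: "y \<in> ball x e \<inter> X" for y
  proof -
    have "x \<in> X" using \<open>x \<in> U\<close> U openin_imp_subset by blast
    then obtain c where c: "geodesic_arc X c" "c 0 = x" "c 1 = y" "path_image c \<subseteq> ball x e"
      using y by (auto intro: geodesic_arc_in_ball[OF X, of x y e])
    have "connected_component U x y"
      unfolding connected_component_def
      by (intro exI[of _ "path_image c"] conjI connected_path_image geodesic_arc_path[OF c(1)])
        (use c e in \<open>auto simp: path_image_def geodesic_arc_def\<close>)
    then show ?thesis using x by (auto intro: connected_component_trans)
  qed
  then show "\<exists>e>0. ball x e \<inter> X \<subseteq> connected_component_set U a" using e(1) by blast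
qed

text \<open>Being joined by a Lipschitz path in \<open>U\<close> is an equivalence relation, and
  small geodesics make its classes open; a connected component therefore lies in one class.\<close>

lemma lip_path_in_component:
  assumes X: "geodesic_space X" and U: "openin (top_of_set X) U" and ab: "connected_component U a b"
  obtains p where "lip_path U p" "p 0 = a" "p 1 = b"
proof -
  define R where "R x y \<longleftrightarrow> (\<exists>p. lip_path U p \<and> p 0 = x \<and> p 1 = y)" for x y
  define S where "S = connected_component_set U a"
  have "R a b"
  proof (rule connected_equivalence_relation[of S])
    show "connected S" by (simp add: S_def)
    show "a \<in> S" "b \<in> S" using ab connected_component_in[OF ab] by (auto simp: S_def connected_component_refl)
    show "R y x" if R: "R x y" for x y
    proof -
      obtain p where "lip_path U p" "p 0 = x" "p 1 = y" using R by (auto simp: R_def)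
      then show ?thesis unfolding R_def
        using lip_path_reversepath[of U p] by (intro exI[of _ "reversepath p"]) (auto simp: reversepath_def)
    qed
    show "R x z" if R: "R x y" "R y z" for x y z
    proof -
      obtain p q where "lip_path U p" "p 0 = x" "p 1 = y" "lip_path U q" "q 0 = y" "q 1 = z"
        using R by (auto simp: R_def)
      then show ?thesis unfolding R_def using lip_path_join[of U p q]
        by (intro exI[of _ "p +++ q"]) (auto simp: joinpaths_def pathfinish_def pathstart_def)
    qed
    fix x assume "x \<in> S"
    then have "x \<in> U" using connected_component_subset[of U a] by (auto simp: S_def)
    then have "x \<in> X" using U openin_imp_subset by blast
    obtain e where e: "e > 0" "ball x e \<inter> X \<subseteq> U" using U \<open>x \<in> U\<close> by (auto simp: openin_contains_ball)
    show "\<exists>T. openin (top_of_set S) T \<and> x \<in> T \<and> (\<forall>y\<in>T. R x y)"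
    proof (intro exI[of _ "S \<inter> ball x e"] conjI ballI)
      fix y assume y: "y \<in> S \<inter> ball x e"
      then have "y \<in> X" using connected_component_subset[of U a] U openin_imp_subset by (fastforce simp: S_def)
      then obtain c where c: "geodesic_arc X c" "c 0 = x" "c 1 = y" "path_image c \<subseteq> ball x e"
        using y \<open>x \<in> X\<close> by (auto intro: geodesic_arc_in_ball[OF X, of x y e])
      then have "lip_path U c" using e by (auto simp: geodesic_arc_def intro!: lip_path_mono[OF geodesic_arc_lip_path[OF c(1)]])
      then show "R x y" using c by (auto simp: R_def)
    qed (use \<open>x \<in> S\<close> e in auto)
  qed
  then show ?thesis using that by (auto simp: R_def)
qed

section \<open>Compactness of families of Lipschitz paths\<close>

lemma compact_funcset_nat:
  fixes X :: "'a::metric_space set"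
  assumes "compact X"
  shows "compact {f :: 'i::countable \<Rightarrow> 'a. \<forall>i. f i \<in> X}"
proof -
  have "compactin (product_topology (\<lambda>i. euclidean) UNIV) (PiE (UNIV :: 'i set) (\<lambda>_. X))"
    using assms by (simp add: compactin_PiE compactin_euclidean_iff)
  moreover have "PiE (UNIV :: 'i set) (\<lambda>_. X) = {f. \<forall>i. f i \<in> X}" by (auto simp: PiE_def)
  ultimately show ?thesis by (simp add: euclidean_product_topology compactin_euclidean_iff)
qed

text \<open>Arzela-Ascoli: convergence is arranged at the rational parameters and spread by the
  common bound \<open>B\<close> on the constants. The constants may vary, so that minimising
  sequences are covered and the limit inherits the limit of the constants.\<close>

lemma lipschitz_paths_compact:
  fixes X :: "'a::metric_space set" and c :: "nat \<Rightarrow> real \<Rightarrow> 'a"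
  assumes X: "compact X" and c: "\<And>k. (L k)-lipschitz_on {0..1} (c k)" "\<And>k. path_image (c k) \<subseteq> X"
    and L: "L \<longlonglongrightarrow> \<Lambda>"
  obtains r c' where "strict_mono r" "\<Lambda>-lipschitz_on {0..1} c'" "path_image c' \<subseteq> X"
    "uniform_limit {0..1} (\<lambda>k. c (r k)) c' sequentially"
proof -
  \<comment> \<open>Clamping to the unit interval makes every rational an index; countably many
    coordinates keep the function space metrizable, so compactness yields a convergent
    subsequence.\<close>
  define f where "f k q = c k (max 0 (min 1 (of_rat q)))" for k and q :: rat
  have inX: "c k t \<in> X" if "t \<in> {0..1}" for k t using c(2)[of k] that by (auto simp: path_image_def)
  have "seq_compact {f :: rat \<Rightarrow> 'a. \<forall>i. f i \<in> X}"
    using compact_funcset_nat[OF X] by (simp add: compact_eq_seq_compact_metric)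
  moreover have "f k \<in> {f. \<forall>i. f i \<in> X}" for k by (auto simp: f_def intro!: inX)
  ultimately obtain l r where r: "strict_mono r" and l: "(f \<circ> r) \<longlonglongrightarrow> l"
    using seq_compactE by metis
  have lq: "(\<lambda>k. f (r k) q) \<longlonglongrightarrow> l q" for q
  proof -
    have "continuous_on UNIV (\<lambda>g :: rat \<Rightarrow> 'a. g q)" by (rule continuous_on_product_coordinates)
    then show ?thesis using continuous_on_tendsto_compose[OF _ l, of UNIV "\<lambda>g. g q"] by (simp add: o_def)
  qed
  have "Bseq L" using L by (intro convergent_imp_Bseq) (auto simp: convergent_def)
  then obtain B where B: "B > 0" "\<And>k. \<bar>L k\<bar> \<le> B" by (auto simp: Bseq_def)
  have unifC: "\<exists>M. \<forall>m\<ge>M. \<forall>n\<ge>M. \<forall>t\<in>{0..1}. dist (c (r m) t) (c (r n) t) < e" if "e > 0" for e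
  proof -
    obtain N :: nat where N: "N > 0" "B / real N < e / 3"
    proof -
      obtain N :: nat where "3 * B / e < real N" using reals_Archimedean2 by blast
      moreover have "0 < 3 * B / e" using B \<open>e > 0\<close> by simp
      ultimately have "0 < real N" by linarith
      then have "N > 0" "3 * B < real N * e"
        using \<open>e > 0\<close> \<open>3 * B / e < real N\<close> by (auto simp: divide_less_eq)
      then show thesis by (intro that[of N]) (auto simp: divide_less_eq mult.commute)
    qed
    have "\<exists>M. \<forall>m\<ge>M. \<forall>n\<ge>M. dist (f (r m) q) (f (r n) q) < e / 3" for q
      using metric_CauchyD[OF LIMSEQ_imp_Cauchy[OF lq[of q]], of "e / 3"] \<open>e > 0\<close> by auto
    then obtain M where M: "\<And>q m n. \<lbrakk>m \<ge> M q; n \<ge> M q\<rbrakk> \<Longrightarrow> dist (f (r m) q) (f (r n) q) < e / 3" by metis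
    \<comment> \<open>Only the grid points \<open>j / N\<close> matter: each parameter lies within
      \<open>1 / N\<close> of one of them, over which a path moves by less than
      \<open>e / 3\<close>.\<close>
    define M' where "M' = Max ((\<lambda>j. M (of_nat j / of_nat N)) ` {..N})"
    show ?thesis
    proof (intro exI[of _ M'] allI ballI impI)
      fix m n t assume mn: "m \<ge> M'" "n \<ge> M'" and t: "t \<in> {0..1::real}"
      define j where "j = nat \<lfloor>t * real N\<rfloor>"
      have j: "real j \<le> t * real N" "t * real N < real j + 1"
        using t N by (auto simp: j_def)
      moreover have "t * real N \<le> 1 * real N" using t by (intro mult_right_mono) auto
      ultimately have "real j \<le> real N" by linarith
      then have "j \<le> N" by simp
      define q :: rat where "q = of_nat j / of_nat N"
      have q: "of_rat q = real j / real N" by (simp add: q_def of_rat_divide)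
      have "M q \<le> M'" unfolding M'_def q_def using \<open>j \<le> N\<close> by (intro Max_ge) auto
      have fq: "f k q = c k (real j / real N)" for k
        using \<open>j \<le> N\<close> N by (simp add: f_def q)
      have jN: "real j / real N \<in> {0..1}" using \<open>j \<le> N\<close> N by simp
      have "t - real j / real N = (t * real N - real j) / real N" using N by (simp add: field_simps)
      then have tj: "\<bar>t - real j / real N\<bar> \<le> 1 / real N"
        using j N by (simp add: divide_right_mono)
      have near: "dist (c k t) (c k (real j / real N)) < e / 3" for k
      proof -
        have "dist (c k t) (c k (real j / real N)) \<le> L k * \<bar>t - real j / real N\<bar>"
          using lipschitz_onD[OF c(1) t jN] by (simp add: dist_real_def)
        also have "\<dots> \<le> B * (1 / real N)"
          using B tj by (intro mult_mono) (auto intro: abs_le_D1)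
        also have "\<dots> < e / 3" using N(2) by simp
        finally show ?thesis .
      qed
      have "dist (c (r m) t) (c (r n) t) \<le> dist (c (r m) t) (f (r m) q) + dist (f (r m) q) (f (r n) q)
          + dist (f (r n) q) (c (r n) t)"
        by (smt (verit) dist_triangle)
      also have "\<dots> < e / 3 + e / 3 + e / 3"
        using near[of "r m"] near[of "r n"] M[of q m n] mn \<open>M q \<le> M'\<close>
        by (intro add_strict_mono) (auto simp: fq dist_commute)
      finally show "dist (c (r m) t) (c (r n) t) < e" by simp
    qed
  qed
  have "\<exists>x\<in>X. (\<lambda>k. c (r k) t) \<longlonglongrightarrow> x" if t: "t \<in> {0..1}" for t
  proof -
    have "Cauchy (\<lambda>k. c (r k) t)"
      unfolding Cauchy_def using unifC t by meson
    then show ?thesis using compact_imp_complete[OF X] inX[OF t] by (simp add: complete_def)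
  qed
  then obtain c' where c': "\<And>t. t \<in> {0..1} \<Longrightarrow> c' t \<in> X \<and> (\<lambda>k. c (r k) t) \<longlonglongrightarrow> c' t" by metis
  show ?thesis
  proof (rule that[OF r])
    show "path_image c' \<subseteq> X" using c' by (auto simp: path_image_def)
    show "\<Lambda>-lipschitz_on {0..1} c'"
    proof (rule lipschitz_onI)
      fix s t :: real assume st: "s \<in> {0..1}" "t \<in> {0..1}"
      show "dist (c' s) (c' t) \<le> \<Lambda> * dist s t"
      proof (rule LIMSEQ_le)
        show "(\<lambda>k. dist (c (r k) s) (c (r k) t)) \<longlonglongrightarrow> dist (c' s) (c' t)"
          using c' st by (intro tendsto_dist) auto
        show "(\<lambda>k. L (r k) * dist s t) \<longlonglongrightarrow> \<Lambda> * dist s t"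
          using LIMSEQ_subseq_LIMSEQ[OF L r] by (intro tendsto_intros) (simp add: o_def)
        show "\<exists>N. \<forall>n\<ge>N. dist (c (r n) s) (c (r n) t) \<le> L (r n) * dist s t"
          using lipschitz_onD[OF c(1) st] by blast
      qed
    next
      show "0 \<le> \<Lambda>" using L lipschitz_on_nonneg[OF c(1)] by (intro LIMSEQ_le_const) auto
    qed
    show "uniform_limit {0..1} (\<lambda>k. c (r k)) c' sequentially"
      unfolding uniform_limit_sequentially_iff
    proof (intro allI impI)
      fix e :: real assume "e > 0"
      then obtain M where M: "\<forall>m\<ge>M. \<forall>n\<ge>M. \<forall>t\<in>{0..1}. dist (c (r m) t) (c (r n) t) < e / 2"
        using unifC[of "e / 2"] by (metis half_gt_zero)
      have "dist (c (r m) t) (c' t) \<le> e / 2" if "m \<ge> M" "t \<in> {0..1}" for m t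
      proof (rule LIMSEQ_le_const2)
        show "(\<lambda>n. dist (c (r m) t) (c (r n) t)) \<longlonglongrightarrow> dist (c (r m) t) (c' t)"
          using c' that by (intro tendsto_intros) auto
        show "\<exists>N. \<forall>n\<ge>N. dist (c (r m) t) (c (r n) t) \<le> e / 2"
          using M that by (meson less_imp_le)
      qed
      then show "\<exists>N. \<forall>n\<ge>N. \<forall>x\<in>{0..1}. dist (c (r n) x) (c' x) < e"
        using \<open>e > 0\<close> by (intro exI[of _ M]) (smt (verit) field_sum_of_halves)
    qed
  qed
qed

subsection \<open>Existence of geodesic loops\<close>


text \<open>\<open>c\<close> is a geodesic polygon inscribed in \<open>h\<close>, run through at
  constant speed, so that its Lipschitz constant is at most the length bound \<open>L\<close>. At
  that speed it need not be near \<open>h\<close> at the same time, hence the time change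
  \<theta>.\<close>

lemma lipschitz_polygon:
  fixes X :: "'a::metric_space set" and h :: "real \<Rightarrow> 'a"
  assumes X: "geodesic_space X" and h: "path h" "path_image h \<subseteq> X"
    and L: "path_length h \<le> ennreal L" "0 \<le> L" and "e > 0"
  obtains c \<theta> where "L-lipschitz_on {0..1} c" "path_image c \<subseteq> X" "c 0 = h 0" "c 1 = h 1"
    "continuous_on {0..1} \<theta>" "\<theta> \<in> {0..1} \<rightarrow> {0..1}" "\<theta> 0 = (0::real)" "\<theta> 1 = 1"
    "\<And>t. t \<in> {0..1} \<Longrightarrow> dist (c (\<theta> t)) (h t) < e"
proof -
  have "uniformly_continuous_on {0..1} h"
    using h(1) by (auto simp: path_def intro: compact_uniformly_continuous)
  then obtain d where d: "d > 0" "\<And>s t. \<lbrakk>s \<in> {0..1}; t \<in> {0..1}; dist s t < d\<rbrakk> \<Longrightarrow> dist (h s) (h t) < e / 2"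
    unfolding uniformly_continuous_on_def using \<open>e > 0\<close> by (metis half_gt_zero dist_commute)
  obtain N :: nat where "N > 0" "inverse (real N) < d"
    using ex_inverse_of_nat_less[OF d(1)] by auto
  then have N: "N > 0" "1 / real N < d" by (auto simp: inverse_eq_divide)
  define \<tau> where "\<tau> i = real i / real N" for i
  have \<tau>Suc: "\<tau> (Suc i) = \<tau> i + 1 / real N" for i by (simp add: \<tau>_def add_divide_distrib)
  have \<tau>01: "\<tau> i \<in> {0..1}" if "i \<le> N" for i using that N by (simp add: \<tau>_def)
  have near: "dist (h (\<tau> i)) (h t) < e / 2" if "i < N" "t \<in> {\<tau> i..\<tau> (Suc i)}" for i t
  proof (rule d(2))
    show "\<tau> i \<in> {0..1}" using \<tau>01 that by simp
    have "\<tau> (Suc i) \<in> {0..1}" using \<tau>01 that by simp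
    then show "t \<in> {0..1}" using that \<open>\<tau> i \<in> {0..1}\<close> by auto
    show "dist (\<tau> i) t < d" using that N \<tau>Suc[of i] by (auto simp: dist_real_def)
  qed
  define S where "S i = (\<Sum>j<i. dist (h (\<tau> j)) (h (\<tau> (Suc j))))" for i
  have S0: "0 \<le> S i" for i by (simp add: S_def sum_nonneg)
  \<comment> \<open>Up to vertex \<open>i\<close> the polygon is parametrised by arc length on
    \<open>{0..S i}\<close>; rescaling to \<open>{0..1}\<close> waits until the total length is
    known.\<close>
  have "\<exists>c \<theta>. 1-lipschitz_on {0..S i} c \<and> c ` {0..S i} \<subseteq> X \<and> c 0 = h 0 \<and> c (S i) = h (\<tau> i) \<and>
      continuous_on {0..\<tau> i} \<theta> \<and> \<theta> ` {0..\<tau> i} \<subseteq> {0..S i} \<and> \<theta> 0 = 0 \<and> \<theta> (\<tau> i) = S i \<and>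
      (\<forall>t\<in>{0..\<tau> i}. dist (c (\<theta> t)) (h t) < e)" if "i \<le> N" for i
    using that
  proof (induction i)
    case 0
    have "h 0 \<in> X" using h(2) by (auto simp: path_image_def)
    then show ?case
      by (intro exI[of _ "\<lambda>_. h 0"] exI[of _ "\<lambda>_. 0"]) (use \<open>e > 0\<close> in \<open>auto simp: S_def \<tau>_def intro!: lipschitz_onI\<close>)
  next
    case (Suc i)
    then obtain c \<theta> where c: "1-lipschitz_on {0..S i} c" "c ` {0..S i} \<subseteq> X" "c 0 = h 0" "c (S i) = h (\<tau> i)"
      and \<theta>: "continuous_on {0..\<tau> i} \<theta>" "\<theta> ` {0..\<tau> i} \<subseteq> {0..S i}" "\<theta> 0 = 0" "\<theta> (\<tau> i) = S i"
      and close: "\<And>t. t\<in>{0..\<tau> i} \<Longrightarrow> dist (c (\<theta> t)) (h t) < e"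
      by (metis Suc_leD)
    have "h (\<tau> i) \<in> X" "h (\<tau> (Suc i)) \<in> X" using \<tau>01[of i] \<tau>01[of "Suc i"] Suc.prems h(2) by (auto simp: path_image_def)
    then obtain \<gamma> where \<gamma>: "geodesic_arc X \<gamma>" "\<gamma> 0 = h (\<tau> i)" "\<gamma> 1 = h (\<tau> (Suc i))"
      by (rule geodesic_arc_exists[OF X])
    define D where "D = dist (h (\<tau> i)) (h (\<tau> (Suc i)))"
    have "0 \<le> D" by (simp add: D_def)
    have D2: "D < e / 2" unfolding D_def using Suc.prems N by (intro near) (auto simp: \<tau>Suc)
    have SS: "S (Suc i) = S i + D" by (simp add: S_def D_def)
    have \<tau>i: "0 \<le> \<tau> i" "\<tau> i \<le> \<tau> (Suc i)" by (auto simp: \<tau>_def divide_right_mono)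
    define c' where "c' s = (if s \<le> S i then c s else \<gamma> ((s - S i) / D))" for s
    define \<theta>' where "\<theta>' t = (if t \<le> \<tau> i then \<theta> t else S i + D * (t - \<tau> i) * real N)" for t
    \<comment> \<open>For \<open>D = 0\<close> the quotient is 0 by convention, and the added piece
      is constant.\<close>
    have quo: "(s - S i) / D \<in> {0..1}" if "s \<in> {S i..S (Suc i)}" for s
      using that \<open>0 \<le> D\<close> by (cases "D = 0") (auto simp: SS)
    have "1-lipschitz_on {S i..S (Suc i)} (\<lambda>s. \<gamma> ((s - S i) / D))"
    proof (rule lipschitz_onI)
      fix u v assume uv: "u \<in> {S i..S (Suc i)}" "v \<in> {S i..S (Suc i)}"
      have "dist (\<gamma> ((u - S i) / D)) (\<gamma> ((v - S i) / D)) = \<bar>(u - S i) / D - (v - S i) / D\<bar> * D"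
        using geodesic_arc_dist[OF \<gamma>(1) quo quo, OF uv] \<gamma> by (simp add: D_def)
      also have "\<dots> = \<bar>(u - v) / D\<bar> * D" by (simp flip: diff_divide_distrib)
      also have "\<dots> \<le> 1 * dist u v" using \<open>0 \<le> D\<close> by (cases "D = 0") (auto simp: dist_real_def)
      finally show "dist (\<gamma> ((u - S i) / D)) (\<gamma> ((v - S i) / D)) \<le> 1 * dist u v" .
    qed simp
    then have 1: "1-lipschitz_on {0..S (Suc i)} c'"
      unfolding c'_def using c \<gamma> by (intro lipschitz_on_concat) auto
    have 2: "c' ` {0..S (Suc i)} \<subseteq> X"
      using c(2) quo \<gamma>(1) by (force simp: c'_def geodesic_arc_def path_image_def)
    have 3: "c' 0 = h 0" using c S0 by (simp add: c'_def)
    have 4: "c' (S (Suc i)) = h (\<tau> (Suc i))"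
      using \<gamma> c \<open>0 \<le> D\<close> by (cases "D = 0") (auto simp: c'_def SS D_def)
    have "continuous_on ({0..\<tau> i} \<union> {\<tau> i..\<tau> (Suc i)}) \<theta>'"
      unfolding \<theta>'_def
    proof (rule continuous_on_If)
      show "continuous_on {\<tau> i..\<tau> (Suc i)} (\<lambda>t. S i + D * (t - \<tau> i) * real N)"
        by (intro continuous_intros)
    qed (use \<theta> in auto)
    moreover have "{0..\<tau> i} \<union> {\<tau> i..\<tau> (Suc i)} = {0..\<tau> (Suc i)}" using \<tau>i by auto
    ultimately have 5: "continuous_on {0..\<tau> (Suc i)} \<theta>'" by simp
    have lin: "(t - \<tau> i) * real N \<in> {0..1}" if "t \<in> {\<tau> i..\<tau> (Suc i)}" for t
      using that N \<tau>Suc[of i] by (auto simp: field_simps)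
    have 6: "\<theta>' t \<in> {S i..S (Suc i)}" if "t \<in> {\<tau> i<..\<tau> (Suc i)}" for t
      using lin[of t] that \<open>0 \<le> D\<close> mult_left_mono[of "(t - \<tau> i) * real N" 1 D]
      by (auto simp: \<theta>'_def SS mult.assoc)
    have 7: "\<theta>' ` {0..\<tau> (Suc i)} \<subseteq> {0..S (Suc i)}"
    proof (clarify)
      fix t assume "t \<in> {0..\<tau> (Suc i)}"
      then consider "t \<in> {0..\<tau> i}" | "t \<in> {\<tau> i<..\<tau> (Suc i)}" by fastforce
      then show "\<theta>' t \<in> {0..S (Suc i)}"
        using \<theta>(2) 6[of t] S0[of i] \<open>0 \<le> D\<close> by cases (auto simp: \<theta>'_def SS image_subset_iff intro: add_increasing2)
    qed
    have 8: "\<theta>' 0 = 0" "\<theta>' (\<tau> (Suc i)) = S (Suc i)"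
      using \<theta> \<tau>i N by (auto simp: \<theta>'_def SS \<tau>Suc)
    have 9: "dist (c' (\<theta>' t)) (h t) < e" if "t \<in> {0..\<tau> (Suc i)}" for t
    proof (cases "t \<le> \<tau> i")
      case True
      then have "\<theta>' t = \<theta> t" "\<theta> t \<le> S i" using \<theta>(2) that by (auto simp: \<theta>'_def image_subset_iff)
      then show ?thesis using close[of t] True that by (simp add: c'_def)
    next
      case False
      then have t: "t \<in> {\<tau> i<..\<tau> (Suc i)}" using that by auto
      have "dist (c' (\<theta>' t)) (h (\<tau> i)) \<le> D"
      proof -
        have "c' (\<theta>' t) = \<gamma> ((\<theta>' t - S i) / D)"
          using 6[OF t] c \<gamma> by (auto simp: c'_def)
        moreover have "dist (\<gamma> 0) (\<gamma> ((\<theta>' t - S i) / D)) \<le> D"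
          using geodesic_arc_dist[OF \<gamma>(1), of 0 "(\<theta>' t - S i) / D"] quo[OF 6[OF t]] 6[OF t] \<gamma> \<open>0 \<le> D\<close>
          by (auto simp: D_def intro!: mult_left_le_one_le)
        ultimately show ?thesis using \<gamma> by (simp add: dist_commute)
      qed
      moreover have "dist (h (\<tau> i)) (h t) < e / 2" using near[of i t] Suc.prems t by auto
      ultimately show ?thesis using D2 dist_triangle[of "c' (\<theta>' t)" "h t" "h (\<tau> i)"] by linarith
    qed
    show ?case using 1 2 3 4 5 7 8 9 by blast
  qed
  from this[of N] obtain c \<theta> where c: "1-lipschitz_on {0..S N} c" "c ` {0..S N} \<subseteq> X" "c 0 = h 0" "c (S N) = h (\<tau> N)"
      and \<theta>: "continuous_on {0..\<tau> N} \<theta>" "\<theta> ` {0..\<tau> N} \<subseteq> {0..S N}" "\<theta> 0 = 0" "\<theta> (\<tau> N) = S N"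
      and close: "\<And>t. t\<in>{0..\<tau> N} \<Longrightarrow> dist (c (\<theta> t)) (h t) < e" by blast
  have \<tau>N: "\<tau> N = 1" using N by (simp add: \<tau>_def)
  have "S N \<le> L"
  proof -
    have "S N = polygon_sum h (map \<tau> [0..<Suc N])"
      unfolding polygon_sum_nth S_def
      by (rule sum.reindex_bij_witness[of _ "\<lambda>i. i - 1" Suc]) (auto simp del: upt_Suc)
    moreover have "ennreal (polygon_sum h (map \<tau> [0..<Suc N])) \<le> path_length h"
      using \<tau>01 by (intro polygon_sum_le_path_length)
        (auto simp: sorted_iff_nth_mono \<tau>_def divide_right_mono simp del: upt_Suc)
    ultimately have "ennreal (S N) \<le> ennreal L" using L by (metis order_trans)
    then show ?thesis using L by (simp add: ennreal_le_iff)
  qed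
  define c1 where "c1 u = c (u * S N)" for u
  define \<theta>1 where "\<theta>1 t = (if S N = 0 then t else \<theta> t / S N)" for t
  have uS: "u * S N \<in> {0..S N}" if "u \<in> {0..1}" for u
    using that S0[of N] by (auto simp: mult_left_le_one_le)
  have \<theta>1: "\<theta>1 t * S N = \<theta> t" if "t \<in> {0..1}" for t
    using \<theta>(2) that by (auto simp: \<theta>1_def \<tau>N image_subset_iff intro: antisym)
  show ?thesis
  proof (rule that[of c1 \<theta>1])
    show "L-lipschitz_on {0..1} c1"
    proof (rule lipschitz_onI)
      fix u v :: real assume uv: "u \<in> {0..1}" "v \<in> {0..1}"
      have "dist (c1 u) (c1 v) \<le> dist (u * S N) (v * S N)"
        using lipschitz_onD[OF c(1) uS uS, OF uv] by (simp add: c1_def)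
      also have "\<dots> = S N * dist u v" using S0[of N] by (simp add: dist_real_def abs_mult flip: left_diff_distrib)
      also have "\<dots> \<le> L * dist u v" using \<open>S N \<le> L\<close> by (intro mult_right_mono) auto
      finally show "dist (c1 u) (c1 v) \<le> L * dist u v" .
    qed (rule L)
    show "path_image c1 \<subseteq> X" using c(2) uS by (auto simp: path_image_def c1_def)
    show "c1 0 = h 0" "c1 1 = h 1" using c by (auto simp: c1_def \<tau>N)
    show "continuous_on {0..1} \<theta>1" using \<theta>(1) unfolding \<theta>1_def \<tau>N
      by (cases "S N = 0") (auto intro!: continuous_intros)
    show "\<theta>1 \<in> {0..1} \<rightarrow> {0..1}" using \<theta>(2) S0[of N] unfolding \<tau>N
      by (auto simp: \<theta>1_def image_subset_iff divide_le_eq_1)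
    show "\<theta>1 0 = 0" "\<theta>1 1 = 1" using \<theta>(3,4) by (auto simp: \<theta>1_def \<tau>N)
    show "dist (c1 (\<theta>1 t)) (h t) < e" if "t \<in> {0..1}" for t
      using close[of t] \<theta>1[OF that] that by (simp add: c1_def \<tau>N)
  qed
qed

lemma deg_reparametrize:
  assumes "nonvanishing_on X f" "path c" "path_image c \<subseteq> X" "pathfinish c = pathstart c"
    and \<theta>: "continuous_on {0..1} \<theta>" "\<theta> \<in> {0..1} \<rightarrow> {0..1}" "\<theta> 0 = (0::real)" "\<theta> 1 = 1"
  shows "deg f (c \<circ> \<theta>) = deg f c"
proof -
  have "homotopic_paths X c (c \<circ> \<theta>)"
    by (rule homotopic_paths_reparametrize[OF assms(2,3) \<theta>]) auto
  then have "homotopic_loops X c (c \<circ> \<theta>)"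
    using assms(4) \<theta> by (intro homotopic_paths_imp_homotopic_loops) (auto simp: pathfinish_def pathstart_def)
  then show ?thesis using deg_homotopic_loops[OF assms(1)] by metis
qed

text \<open>The subsequence is chosen once; only the index from which the degrees agree depends on
  \<open>f\<close>. One limit loop thus serves all maps simultaneously.\<close>

lemma limit_loop:
  fixes X :: "'a::metric_space set" and c :: "nat \<Rightarrow> real \<Rightarrow> 'a"
  assumes X: "compact X" and c: "\<And>k. (L k)-lipschitz_on {0..1} (c k)" "\<And>k. path_image (c k) \<subseteq> X"
      "\<And>k. pathfinish (c k) = pathstart (c k)"
    and L: "L \<longlonglongrightarrow> \<Lambda>"
  obtains r c' where "strict_mono r" "\<Lambda>-lipschitz_on {0..1} c'" "path_image c' \<subseteq> X" "pathfinish c' = pathstart c'"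
    "\<And>f. nonvanishing_on X f \<Longrightarrow> \<forall>\<^sub>F k in sequentially. deg f (c (r k)) = deg f c'"
proof -
  obtain r c' where r: "strict_mono r" and c': "\<Lambda>-lipschitz_on {0..1} c'" "path_image c' \<subseteq> X"
    and lim: "uniform_limit {0..1} (\<lambda>k. c (r k)) c' sequentially"
    by (rule lipschitz_paths_compact[OF X c(1,2) L])
  have "(\<lambda>k. c (r k) 0) \<longlonglongrightarrow> c' 0" "(\<lambda>k. c (r k) 1) \<longlonglongrightarrow> c' 1"
    using tendsto_uniform_limitI[OF lim] by auto
  then have loop: "pathfinish c' = pathstart c'"
    using c(3) unfolding pathfinish_def pathstart_def by (auto intro: LIMSEQ_unique)
  have p: "path (c k)" "path c'" for k
    using c(1)[of k] c'(1) by (auto simp: path_def intro: lipschitz_on_continuous_on)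
  show ?thesis
  proof (rule that[OF r c' loop])
    fix f assume f: "nonvanishing_on X f"
    obtain e where e: "e > 0" "\<And>p q. \<lbrakk>loop_in X p; loop_in X q; \<forall>t\<in>{0..1}. dist (p t) (q t) < e\<rbrakk> \<Longrightarrow> deg f p = deg f q"
      using deg_near[OF X f] by metis
    have "\<forall>\<^sub>F k in sequentially. \<forall>t\<in>{0..1}. dist (c (r k) t) (c' t) < e"
      using lim e(1) by (auto simp: uniform_limit_iff)
    then show "\<forall>\<^sub>F k in sequentially. deg f (c (r k)) = deg f c'"
      by eventually_elim (use e(2) p c c' loop in \<open>auto simp: loop_in_def\<close>)
  qed
qed

text \<open>Minimising the Lipschitz constant among all loops with prescribed degrees yields a
  geodesic loop because homotopic loops have equal degrees.\<close>

lemma geodesic_loop_exists: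
  fixes X :: "'a::metric_space set"
  assumes X: "compact X" "geodesic_space X" and l: "lip_path X l" "pathfinish l = pathstart l"
  obtains g where "geodesic_loop X g" "\<And>f. nonvanishing_on X f \<Longrightarrow> deg f g = deg f l"
proof -
  define S where "S = {L. \<exists>c. L-lipschitz_on {0..1} c \<and> path_image c \<subseteq> X \<and> pathfinish c = pathstart c \<and>
    (\<forall>f. nonvanishing_on X f \<longrightarrow> deg f c = deg f l)}"
  \<comment> \<open>Closedness of \<open>S\<close> turns its infimum into a minimum.\<close>
  have limS: "\<Lambda> \<in> S" if L: "\<And>k. L k \<in> S" "L \<longlonglongrightarrow> \<Lambda>" for L \<Lambda>
  proof -
    obtain c where c: "\<And>k. (L k)-lipschitz_on {0..1} (c k)" "\<And>k. path_image (c k) \<subseteq> X"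
      "\<And>k. pathfinish (c k) = pathstart (c k)" "\<And>k f. nonvanishing_on X f \<Longrightarrow> deg f (c k) = deg f l"
      using L(1) unfolding S_def mem_Collect_eq by metis
    obtain r c' where "\<Lambda>-lipschitz_on {0..1} c'" "path_image c' \<subseteq> X" "pathfinish c' = pathstart c'"
      and ev: "\<And>f. nonvanishing_on X f \<Longrightarrow> \<forall>\<^sub>F k in sequentially. deg f (c (r k)) = deg f c'"
      by (rule limit_loop[OF X(1) c(1-3) L(2)]) blast
    moreover have "deg f c' = deg f l" if "nonvanishing_on X f" for f
      using ev[OF that] c(4)[OF that] by simp
    ultimately show ?thesis by (auto simp: S_def)
  qed
  have "S \<noteq> {}" using l by (auto simp: S_def lip_path_def)
  have bdd: "bdd_below S" by (auto simp: S_def bdd_below_def intro: lipschitz_on_nonneg)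
  define \<Lambda> where "\<Lambda> = Inf S"
  have "\<exists>L\<in>S. L < \<Lambda> + 1 / Suc k" for k
    using cInf_lessD[OF \<open>S \<noteq> {}\<close>, of "\<Lambda> + 1 / Suc k"] by (auto simp: \<Lambda>_def)
  then obtain L where L: "\<And>k. L k \<in> S" "\<And>k. L k < \<Lambda> + 1 / Suc k" by metis
  have "(\<lambda>k. \<Lambda> + 1 / real (Suc k)) \<longlonglongrightarrow> \<Lambda> + 0"
    by (intro tendsto_intros LIMSEQ_Suc[OF lim_1_over_n])
  then have "L \<longlonglongrightarrow> \<Lambda>"
    using L cInf_lower[OF _ bdd] by (intro tendsto_sandwich[of "\<lambda>_. \<Lambda>" L])
      (auto simp: \<Lambda>_def intro!: always_eventually less_imp_le)
  then have "\<Lambda> \<in> S" using limS L by blast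
  then obtain g where g: "\<Lambda>-lipschitz_on {0..1} g" "path_image g \<subseteq> X" "pathfinish g = pathstart g"
    "\<And>f. nonvanishing_on X f \<Longrightarrow> deg f g = deg f l" by (auto simp: S_def)
  show ?thesis
  proof (rule that[OF _ g(4)])
    have len: "path_length g \<le> ennreal \<Lambda>" using g(1) by (rule path_length_lipschitz)
    have "path_length g \<le> path_length h" if hom: "homotopic_loops X g h" for h
    proof (cases "path_length h = top")
      case False
      then obtain B where B: "path_length h = ennreal B" "0 \<le> B" by (cases "path_length h") auto
      have h: "path h" "path_image h \<subseteq> X" "pathfinish h = pathstart h"
        using hom homotopic_loops_imp_path homotopic_loops_imp_subset homotopic_loops_imp_loop by blast+
      \<comment> \<open>The competitor \<open>h\<close> need not be Lipschitz, so it is replaced by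
        polygons that approach it and whose constant is its length \<open>B\<close>.\<close>
      have "\<exists>c. B-lipschitz_on {0..1} c \<and> path_image c \<subseteq> X \<and> pathfinish c = pathstart c \<and>
        (\<exists>\<theta>. continuous_on {0..1} \<theta> \<and> \<theta> \<in> {0..1} \<rightarrow> {0..1} \<and> \<theta> 0 = (0::real) \<and> \<theta> 1 = 1 \<and>
        (\<forall>t\<in>{0..1}. dist (c (\<theta> t)) (h t) < 1 / Suc k))" for k
      proof -
        obtain c \<theta> where "B-lipschitz_on {0..1} c" "path_image c \<subseteq> X" "c 0 = h 0" "c 1 = h 1"
          "continuous_on {0..1} \<theta>" "\<theta> \<in> {0..1} \<rightarrow> {0..1}" "\<theta> 0 = (0::real)" "\<theta> 1 = 1"
          "\<And>t. t \<in> {0..1} \<Longrightarrow> dist (c (\<theta> t)) (h t) < 1 / Suc k"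
          by (rule lipschitz_polygon[OF X(2) h(1,2) _ B(2), of "1 / Suc k"]) (simp_all add: B)
        then show ?thesis using h(3) unfolding pathfinish_def pathstart_def
          by (intro exI[of _ c] exI[of _ \<theta>] conjI ballI) simp_all
      qed
      then obtain c \<theta> where c: "\<And>k. B-lipschitz_on {0..1} (c k)" "\<And>k. path_image (c k) \<subseteq> X"
        "\<And>k. pathfinish (c k) = pathstart (c k)"
        and \<theta>: "\<And>k. continuous_on {0..1} (\<theta> k)" "\<And>k. \<theta> k \<in> {0..1} \<rightarrow> {0..1}" "\<And>k. \<theta> k 0 = (0::real)" "\<And>k. \<theta> k 1 = 1"
        and close: "\<And>k t. t \<in> {0..1} \<Longrightarrow> dist (c k (\<theta> k t)) (h t) < 1 / Suc k"
        by metis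
      have pc: "path (c k)" for k using c(1) by (auto simp: path_def intro: lipschitz_on_continuous_on)
      have ev: "\<forall>\<^sub>F k in sequentially. deg f (c k) = deg f l" if f: "nonvanishing_on X f" for f
      proof -
        obtain e where e: "e > 0" "\<And>p q. \<lbrakk>loop_in X p; loop_in X q; \<forall>t\<in>{0..1}. dist (p t) (q t) < e\<rbrakk> \<Longrightarrow> deg f p = deg f q"
          using deg_near[OF X(1) f] by metis
        have "\<forall>\<^sub>F k in sequentially. 1 / real (Suc k) < e"
          using LIMSEQ_Suc[OF lim_1_over_n[where 'a = real]] e(1) by (auto simp: order_tendsto_iff)
        then show ?thesis
        proof eventually_elim
          case (elim k)
          have im: "path_image (c k \<circ> \<theta> k) \<subseteq> X" using c(2)[of k] \<theta>(2)[of k] by (auto simp: path_image_def)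
          have "path (c k \<circ> \<theta> k)"
            using pc[of k] \<theta>(1,2)[of k] unfolding path_def
            by (intro continuous_on_compose) (auto elim: continuous_on_subset)
          moreover have "dist ((c k \<circ> \<theta> k) t) (h t) < e" if "t \<in> {0..1}" for t
            using close[OF that, of k] elim by simp
          ultimately have "deg f (c k \<circ> \<theta> k) = deg f h"
            using im h \<theta> c(3)[of k]
            by (intro e(2)) (auto simp: loop_in_def pathfinish_def pathstart_def)
          moreover have "deg f (c k \<circ> \<theta> k) = deg f (c k)"
            by (intro deg_reparametrize[OF f] pc c \<theta>)
          moreover have "deg f h = deg f g" using deg_homotopic_loops[OF f hom] by simp
          ultimately show ?case using g(4)[OF f] by simp
        qed
      qed
      \<comment> \<open>A single polygon is known to have the degree of \<open>l\<close> only for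
        those \<open>f\<close> that tolerate its distance to \<open>h\<close>; the limit has it for
        every \<open>f\<close>, which puts \<open>B\<close> into \<open>S\<close>.\<close>
      obtain r c' where r: "strict_mono r"
        and c': "B-lipschitz_on {0..1} c'" "path_image c' \<subseteq> X" "pathfinish c' = pathstart c'"
        and ev': "\<And>f. nonvanishing_on X f \<Longrightarrow> \<forall>\<^sub>F k in sequentially. deg f (c (r k)) = deg f c'"
        by (rule limit_loop[where c = c and L = "\<lambda>_. B" and \<Lambda> = B, OF X(1) c(1-3) tendsto_const]) blast
      have "deg f c' = deg f l" if "nonvanishing_on X f" for f
        using eventually_conj[OF eventually_subseq[OF r ev[OF that]] ev'[OF that]]
        by (auto dest: eventually_happens)
      then have "\<exists>c. B-lipschitz_on {0..1} c \<and> path_image c \<subseteq> X \<and> pathfinish c = pathstart c \<and>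
        (\<forall>f. nonvanishing_on X f \<longrightarrow> deg f c = deg f l)" using c' by blast
      then have "B \<in> S" by (auto simp: S_def)
      then have "\<Lambda> \<le> B" using cInf_lower[OF _ bdd] by (simp add: \<Lambda>_def)
      then show ?thesis using len B by (metis ennreal_leI order_trans)
    qed simp
    then show "geodesic_loop X g" unfolding geodesic_loop_def
      using g len by (auto simp: path_def intro: lipschitz_on_continuous_on le_less_trans)
  qed
qed

subsection \<open>Essential points\<close>


text \<open>One loop has to serve all radii, while the map may change with \<open>r\<close>. Off the
  ball the map is only near 1, not equal to 1, because \<open>one_dim_avoids_zero\<close> prescribes
  maps up to a small error.\<close>

definition essential_at :: "'a::metric_space set \<Rightarrow> 'a \<Rightarrow> bool" where
  "essential_at X q \<longleftrightarrow> (\<exists>l. lip_path X l \<and> pathfinish l = pathstart l \<and>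
     (\<forall>r>0. \<exists>f. nonvanishing_on X f \<and> (\<forall>x\<in>X - ball q r. norm (f x - 1) < 1/2) \<and> deg f l \<noteq> 0))"

lemma deg_loop_near_1:
  assumes "nonvanishing_on X f" "path p" "path_image p \<subseteq> X" "pathfinish p = pathstart p"
    and "\<And>x. x \<in> path_image p \<Longrightarrow> norm (f x - 1) < 1/2"
  shows "deg f p = 0"
  by (rule deg_loop_small[where w = 1, OF assms(2-4,1)]) (use assms(5) in fastforce)

lemma nonconstant_if_deg:
  assumes "nonvanishing_on X f" "path p" "path_image p \<subseteq> X" "deg f p \<noteq> 0"
  shows "\<not> p constant_on {0..1}"
proof
  assume "p constant_on {0..1}"
  then obtain a where a: "\<And>t. t \<in> {0..1} \<Longrightarrow> p t = a" by (auto simp: constant_on_def)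
  have "a \<in> X" using a[of 0] assms(3) by (auto simp: path_image_def)
  have "deg f p = 0"
    using a \<open>a \<in> X\<close> assms(1) by (intro winding_number_constI[of "f a"]) (auto simp: nonvanishing_on_def)
  then show False using assms(4) by simp
qed

text \<open>The geodesic loop \<open>g\<close> inherits all degrees of \<open>l\<close>. If it
  missed \<open>q\<close> it would miss a whole ball, and the map belonging to that radius would
  have degree 0 on it.\<close>

lemma essential_at_in_hull:
  fixes X :: "'a::metric_space set"
  assumes X: "compact X" "geodesic_space X" and q: "essential_at X q"
  shows "q \<in> pi1_hull X"
proof -
  obtain l where l: "lip_path X l" "pathfinish l = pathstart l"
    and f: "\<And>r. r > 0 \<Longrightarrow> \<exists>f. nonvanishing_on X f \<and> (\<forall>x\<in>X - ball q r. norm (f x - 1) < 1/2) \<and> deg f l \<noteq> 0"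
    using q by (auto simp: essential_at_def)
  obtain g where g: "geodesic_loop X g" "\<And>f. nonvanishing_on X f \<Longrightarrow> deg f g = deg f l"
    by (rule geodesic_loop_exists[OF X l]) blast
  then have pg: "path g" "path_image g \<subseteq> X" "pathfinish g = pathstart g" by (auto simp: geodesic_loop_def)
  obtain f1 where "nonvanishing_on X f1" "deg f1 l \<noteq> 0" using f[of 1] by auto
  then have "\<not> g constant_on {0..1}" using nonconstant_if_deg g pg by metis
  moreover have "q \<in> path_image g"
  proof (rule ccontr)
    assume "q \<notin> path_image g"
    moreover have "closed (path_image g)" using pg(1) by (simp add: closed_path_image)
    ultimately obtain r where r: "r > 0" "\<And>x. x \<in> path_image g \<Longrightarrow> x \<notin> ball q r"
      using open_Compl[of "path_image g"] unfolding open_contains_ball by blast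
    obtain f2 where "nonvanishing_on X f2" "\<forall>x\<in>X - ball q r. norm (f2 x - 1) < 1/2" "deg f2 l \<noteq> 0"
      using f[OF r(1)] by auto
    moreover have "path_image g \<subseteq> X - ball q r" using pg r by auto
    ultimately show False using deg_loop_near_1[of X f2 g] g(2)[of f2] pg by (metis subsetD)
  qed
  ultimately show ?thesis using g by (auto simp: pi1_hull_def)
qed

text \<open>The map is 1 away from a small ball around \<open>z\<close>, and inside that ball it sends a point to
  \<open>exp (2 * pi * \<i> * \<psi>)\<close>, where \<open>\<psi>\<close> depends on the distance to the start of \<open>\<alpha>\<close> only.\<close>

lemma bump_map:
  fixes X :: "'a::metric_space set"
  assumes X: "compact X" "covering_dim_le (top_of_set X) 1"
    and \<alpha>: "geodesic_arc X \<alpha>" and \<beta>: "path \<beta>" "path_image \<beta> \<subseteq> X" "\<beta> 0 = \<alpha> 0" "\<beta> 1 = \<alpha> 1"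
    and z: "z \<in> path_image \<alpha>" "z \<notin> path_image \<beta>" and "r > 0"
  obtains f where "nonvanishing_on X f" "\<And>x. x \<in> X - ball z r \<Longrightarrow> norm (f x - 1) < 1/2"
    "deg f (\<alpha> +++ reversepath \<beta>) \<noteq> 0"
proof -
  have "closed (path_image \<beta>)" using \<beta>(1) by (simp add: closed_path_image)
  then obtain \<rho> where \<rho>: "\<rho> > 0" "\<And>x. x \<in> path_image \<beta> \<Longrightarrow> \<rho> \<le> dist z x"
    using z(2) open_Compl[of "path_image \<beta>"] unfolding open_contains_ball by (metis ComplI ComplD mem_ball not_le subsetD)
  define \<eta> where "\<eta> = min \<rho> r / 2"
  have \<eta>: "\<eta> > 0" "2 * \<eta> \<le> \<rho>" "2 * \<eta> \<le> r" using \<rho> \<open>r > 0\<close> by (auto simp: \<eta>_def)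
  define D where "D = dist (\<alpha> 0) (\<alpha> 1)"
  define p0 where "p0 = dist (\<alpha> 0) z"
  obtain s0 where s0: "s0 \<in> {0..1}" "z = \<alpha> s0" using z(1) by (auto simp: path_image_def)
  have p0: "p0 = s0 * D" using geodesic_arc_dist[OF \<alpha>, of 0 s0] s0 by (simp add: p0_def D_def)
  have \<alpha>z: "dist z (\<alpha> t) = \<bar>t * D - p0\<bar>" if "t \<in> {0..1}" for t
    using geodesic_arc_dist[OF \<alpha> s0(1) that] by (simp add: s0(2) p0 D_def abs_mult abs_minus_commute flip: left_diff_distrib)
  have \<alpha>0: "dist (\<alpha> 0) (\<alpha> t) = t * D" if "t \<in> {0..1}" for t
    using geodesic_arc_dist[OF \<alpha>, of 0 t] that by (simp add: D_def)
  \<comment> \<open>The ends of \<alpha> lie on \<beta>, hence at distance at least \<rho> from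
    \<open>z\<close>: the interval of length \<open>2 * \<eta>\<close> about \<open>p0\<close> on
    which \<psi> rises is interior to \<alpha>.\<close>
  have "\<alpha> 0 \<in> path_image \<beta>" "\<alpha> 1 \<in> path_image \<beta>"
    using \<beta>(3,4) pathstart_in_path_image[of \<beta>] pathfinish_in_path_image[of \<beta>]
    by (auto simp: pathstart_def pathfinish_def)
  then have p0_ends: "2 * \<eta> \<le> p0" "p0 \<le> D - 2 * \<eta>"
    using \<rho>(2)[of "\<alpha> 0"] \<rho>(2)[of "\<alpha> 1"] \<alpha>z[of 0] \<alpha>z[of 1] \<eta> s0 p0
    by (auto simp: D_def mult_left_le_one_le)
  define h where "h y = max 0 (min 1 (2 - dist z y / \<eta>))" for y
  define \<psi> where "\<psi> s = max 0 (min 1 ((s - p0 + \<eta>) / (2 * \<eta>)))" for s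
  have \<psi>1: "\<psi> s = 1" if "p0 + \<eta> \<le> s" for s
  proof -
    have "1 \<le> (s - p0 + \<eta>) / (2 * \<eta>)" using that \<eta> by (simp add: le_divide_eq)
    then show ?thesis by (simp add: \<psi>_def)
  qed
  have \<psi>0: "\<psi> s = 0" if "s \<le> p0 - \<eta>" for s
  proof -
    have "(s - p0 + \<eta>) / (2 * \<eta>) \<le> 0" using that \<eta> by (simp add: divide_le_eq)
    then show ?thesis by (simp add: \<psi>_def)
  qed
  define F where "F y = 1 + of_real (h y) * (exp (of_real (2 * pi * \<psi> (dist (\<alpha> 0) y)) * \<i>) - 1)" for y
  have F1: "F y = 1" if "2 * \<eta> \<le> dist z y" for y
    using that \<eta> by (simp add: F_def h_def field_simps)
  have F\<beta>: "F y = 1" if "y \<in> path_image \<beta>" for y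
    using \<rho>(2)[OF that] \<eta> by (intro F1) auto
  \<comment> \<open>The cutoff \<open>h\<close> is invisible along \<alpha>: it differs from 1 only
    beyond distance \<eta> from \<open>z\<close>, where \<psi> is 0 or 1 and the exponential is
    1.\<close>
  have F\<alpha>: "F (\<alpha> t) = exp (of_real (2 * pi * \<psi> (t * D)) * \<i>)" if t: "t \<in> {0..1}" for t
  proof (cases "\<bar>t * D - p0\<bar> \<le> \<eta>")
    case True
    then have "h (\<alpha> t) = 1" using \<alpha>z[OF t] \<eta> by (simp add: h_def field_simps)
    then show ?thesis using \<alpha>0[OF t] by (simp add: F_def)
  next
    case False
    then have "\<psi> (t * D) = 0 \<or> \<psi> (t * D) = 1" using \<psi>0[of "t * D"] \<psi>1[of "t * D"] by linarith
    then have "exp (of_real (2 * pi * \<psi> (t * D)) * \<i>) = 1" by auto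
    then show ?thesis using \<alpha>0[OF t] by (simp add: F_def)
  qed
  have "continuous_on X F"
    unfolding F_def h_def \<psi>_def using \<eta> by (intro continuous_intros) auto
  \<comment> \<open>\<open>F\<close> may vanish at points off \<alpha> and \<beta> where
    \<open>h\<close> lies strictly between 0 and 1. On the loop itself it has modulus 1, so an error
    below \<open>1/2\<close> leaves the winding number alone.\<close>
  then obtain G where G: "nonvanishing_on X G" "\<And>x. x \<in> X \<Longrightarrow> norm (G x - F x) < 1/2"
    by (rule one_dim_avoids_zero[OF X, of F "1/2"]) auto
  define l where "l = \<alpha> +++ reversepath \<beta>"
  have \<alpha>': "path \<alpha>" "path_image \<alpha> \<subseteq> X" using \<alpha> geodesic_arc_path[OF \<alpha>] by (auto simp: geodesic_arc_def)
  have ends: "pathfinish \<alpha> = pathstart (reversepath \<beta>)" "pathfinish l = pathstart l"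
    using \<beta> by (auto simp: l_def) (auto simp: pathfinish_def pathstart_def)
  have l: "path l" "path_image l = path_image \<alpha> \<union> path_image \<beta>"
    using ends(1) \<alpha>' \<beta> by (auto simp: l_def path_image_join)
  have contF: "path (F \<circ> p)" if "path p" "path_image p \<subseteq> X" for p
    using that \<open>continuous_on X F\<close> by (auto intro!: path_continuous_image elim: continuous_on_subset)
  have norm1: "norm (F y) = 1" if "y \<in> path_image \<alpha> \<union> path_image \<beta>" for y
    using that F\<beta> F\<alpha> by (auto simp: path_image_def norm_exp_eq_Re)
  have "winding_number (F \<circ> \<alpha>) 0 = winding_number (exp \<circ> (\<lambda>t. of_real (2 * pi * \<psi> (t * D)) * \<i>)) 0"
    by (rule winding_number_cong) (simp add: F\<alpha>)
  also have "\<dots> = 1"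
  proof (subst winding_number_compose_exp)
    show "path (\<lambda>t. of_real (2 * pi * \<psi> (t * D)) * \<i>)"
      unfolding path_def \<psi>_def using \<eta> by (intro continuous_intros) auto
    have "\<psi> D = 1" "\<psi> 0 = 0" using p0_ends \<eta> by (auto intro!: \<psi>0 \<psi>1)
    then show "(pathfinish (\<lambda>t. of_real (2 * pi * \<psi> (t * D)) * \<i>) - pathstart (\<lambda>t. of_real (2 * pi * \<psi> (t * D)) * \<i>)) / (2 * of_real pi * \<i>) = 1"
      by (simp add: pathfinish_def pathstart_def)
  qed
  finally have w\<alpha>: "winding_number (F \<circ> \<alpha>) 0 = 1" .
  have w\<beta>: "winding_number (F \<circ> reversepath \<beta>) 0 = 0"
    by (rule winding_number_constI[of 1]) (auto simp: reversepath_def path_image_def intro!: F\<beta>)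
  have "deg G l = winding_number (F \<circ> l) 0"
  proof (rule winding_number_nearby_loops_eq)
    show "path (F \<circ> l)" "path (G \<circ> l)"
      using l \<alpha>' \<beta> nonvanishing_path(1)[OF G(1), of l] by (auto intro!: contF)
    show "pathfinish (F \<circ> l) = pathstart (F \<circ> l)" "pathfinish (G \<circ> l) = pathstart (G \<circ> l)"
      using ends(2) by (auto simp: pathfinish_def pathstart_def)
    fix t :: real assume "t \<in> {0..1}"
    then have "l t \<in> path_image l" by (auto simp: path_image_def)
    then show "norm ((G \<circ> l) t - (F \<circ> l) t) < norm ((F \<circ> l) t - 0)"
      using G(2)[of "l t"] norm1[of "l t"] l(2) \<alpha>' \<beta> by fastforce
  qed
  also have "F \<circ> l = (F \<circ> \<alpha>) +++ (F \<circ> reversepath \<beta>)" by (simp add: l_def path_compose_join)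
  also have "winding_number \<dots> 0 = winding_number (F \<circ> \<alpha>) 0 + winding_number (F \<circ> reversepath \<beta>) 0"
  proof (rule winding_number_join)
    show "path (F \<circ> \<alpha>)" "path (F \<circ> reversepath \<beta>)" using \<alpha>' \<beta> by (auto intro!: contF)
    show "0 \<notin> path_image (F \<circ> \<alpha>)" "0 \<notin> path_image (F \<circ> reversepath \<beta>)"
      using norm1 by (force simp: path_image_compose)+
    show "pathfinish (F \<circ> \<alpha>) = pathstart (F \<circ> reversepath \<beta>)"
      using ends(1) by (simp add: pathfinish_def pathstart_def)
  qed
  finally have "deg G l = 1" unfolding w\<alpha> w\<beta> by (simp only: add_0_right)
  then have "deg G l \<noteq> 0" by (simp only: one_neq_zero not_False_eq_True)
  moreover have "norm (G x - 1) < 1/2" if "x \<in> X - ball z r" for x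
    using G(2)[of x] F1[of x] that \<eta> by auto
  ultimately show ?thesis using G(1) that by (simp add: l_def)
qed

subsection \<open>Retractions along shortest paths\<close>


text \<open>Since \<open>S\<close> avoids \<open>z\<close>, the ends of \<alpha> are joined by a
  Lipschitz path \<beta> off \<open>z\<close>. The loop formed by \<alpha> and \<beta> is fixed;
  shrinking \<open>r\<close> changes only the map given by \<open>bump_map\<close>.\<close>

lemma essential_at_geodesic:
  fixes X :: "'a::metric_space set"
  assumes X: "compact X" "covering_dim_le (top_of_set X) 1" "geodesic_space X"
    and \<alpha>: "geodesic_arc X \<alpha>" "z \<in> path_image \<alpha>"
    and S: "connected S" "S \<subseteq> X - {z}" "\<alpha> 0 \<in> S" "\<alpha> 1 \<in> S"
  shows "essential_at X z"
proof -
  have "z \<in> X" using \<alpha> by (auto simp: geodesic_arc_def)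
  then have "openin (top_of_set X) (X - {z})" by (intro openin_diff) auto
  moreover have "connected_component (X - {z}) (\<alpha> 0) (\<alpha> 1)"
    using S by (auto simp: connected_component_def)
  ultimately obtain \<beta> where \<beta>: "lip_path (X - {z}) \<beta>" "\<beta> 0 = \<alpha> 0" "\<beta> 1 = \<alpha> 1"
    by (rule lip_path_in_component[OF X(3)])
  have \<beta>': "path \<beta>" "path_image \<beta> \<subseteq> X" "z \<notin> path_image \<beta>"
    using lip_path_imp_path[OF \<beta>(1)] lip_path_image[OF \<beta>(1)] by auto
  have "lip_path X \<beta>" by (rule lip_path_mono[OF \<beta>(1) \<beta>'(2)])
  then have "lip_path X (\<alpha> +++ reversepath \<beta>)"
    using \<beta>(3) by (intro lip_path_join lip_path_reversepath geodesic_arc_lip_path[OF \<alpha>(1)])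
      (auto, auto simp: pathfinish_def)
  moreover have "pathfinish (\<alpha> +++ reversepath \<beta>) = pathstart (\<alpha> +++ reversepath \<beta>)"
    using \<beta>(2) by (auto, auto simp: pathstart_def)
  moreover have "\<exists>f. nonvanishing_on X f \<and> (\<forall>x\<in>X - ball z r. norm (f x - 1) < 1/2) \<and>
      deg f (\<alpha> +++ reversepath \<beta>) \<noteq> 0" if "r > 0" for r
  proof -
    obtain f where "nonvanishing_on X f" "\<And>x. x \<in> X - ball z r \<Longrightarrow> norm (f x - 1) < 1/2"
      "deg f (\<alpha> +++ reversepath \<beta>) \<noteq> 0"
      by (rule bump_map[OF X(1,2) \<alpha>(1) \<beta>'(1,2) \<beta>(2,3) \<alpha>(2) \<beta>'(3) \<open>r > 0\<close>]) blast
    then show ?thesis by blast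
  qed
  ultimately show ?thesis unfolding essential_at_def by blast
qed

section \<open>Loops under a deformation retraction\<close>

lemma homotopic_loops_along:
  assumes H: "continuous_on ({0..1} \<times> X) H" "H ` ({0..1} \<times> X) \<subseteq> X" "\<And>x. x \<in> X \<Longrightarrow> H (0, x) = x"
    and l: "path l" "path_image l \<subseteq> X" "pathfinish l = pathstart l"
  shows "homotopic_loops X l (\<lambda>t. H (1::real, l t))"
  unfolding homotopic_loops
proof (intro exI[of _ "\<lambda>(s, t). H (s, l t)"] conjI)
  have lX: "l t \<in> X" if "t \<in> {0..1}" for t using l(2) that by (auto simp: path_image_def)
  have "continuous_on {0..1} l" using l(1) by (simp add: path_def)
  then have "continuous_on ({0..1::real} \<times> {0..1}) (\<lambda>p. l (snd p))"
    by (rule continuous_on_compose2[OF _ continuous_on_snd[OF continuous_on_id]]) auto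
  then have "continuous_on ({0..1::real} \<times> {0..1}) (\<lambda>p. (fst p, l (snd p)))"
    by (intro continuous_on_Pair continuous_on_fst continuous_on_id)
  then have "continuous_on ({0..1} \<times> {0..1}) (\<lambda>p. H (fst p, l (snd p)))"
    by (rule continuous_on_compose2[OF H(1)]) (auto intro: lX)
  then show "continuous_on ({0..1} \<times> {0..1}) (\<lambda>(s, t). H (s, l t))" by (simp add: case_prod_unfold)
  show "(\<lambda>(s, t). H (s, l t)) \<in> {0..1} \<times> {0..1} \<rightarrow> X" using H(2) lX by auto
qed (use H(3) l in \<open>auto simp: path_image_def pathfinish_def pathstart_def\<close>)

lemma deformation_retracts_toE:
  assumes "deformation_retracts_to X Y"
  obtains H where "continuous_on ({0..1} \<times> X) H" "H ` ({0..1} \<times> X) \<subseteq> X"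
    "\<And>x. x \<in> X \<Longrightarrow> H (0, x) = x" "\<And>x. x \<in> X \<Longrightarrow> H (1::real, x) \<in> Y" "retraction X Y (\<lambda>x. H (1, x))"
proof -
  obtain r where r: "retraction X Y r" "homotopic_with_canon (\<lambda>h. \<forall>y\<in>Y. h y = y) X X id r"
    using assms by (auto simp: deformation_retracts_to_def)
  then obtain H where "continuous_map (prod_topology (top_of_set {0..1}) (top_of_set X)) (top_of_set X) H"
    "\<And>x. H (0, x) = x" "\<And>x. H (1::real, x) = r x"
    unfolding homotopic_with_def by auto
  moreover have "prod_topology (top_of_set {0..1::real}) (top_of_set X) = top_of_set ({0..1} \<times> X)"
    by (metis prod_topology_euclidean subtopology_Times)
  ultimately have "continuous_on ({0..1} \<times> X) H" "H ` ({0..1} \<times> X) \<subseteq> X"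
    "\<And>x. H (0, x) = x" "\<And>x. H (1::real, x) = r x"
    by (auto simp: image_subset_iff)
  then show ?thesis using r(1) by (intro that) (auto simp: retraction_def)
qed

lemma deformation_retracts_toI:
  assumes "K \<subseteq> X" and H: "continuous_on ({0..1} \<times> X) H" "H ` ({0..1} \<times> X) \<subseteq> X"
    "\<And>x. x \<in> X \<Longrightarrow> H (0, x) = x" "\<And>x. x \<in> X \<Longrightarrow> H (1::real, x) \<in> K"
    "\<And>s x. \<lbrakk>s \<in> {0..1}; x \<in> K\<rbrakk> \<Longrightarrow> H (s, x) = x"
  shows "deformation_retracts_to X K"
  unfolding deformation_retracts_to_def
proof (intro exI[of _ "\<lambda>x. H (1, x)"] conjI)
  have "continuous_on X (\<lambda>x. H (1, x))"
    by (rule continuous_on_compose2[OF H(1)]) (auto intro!: continuous_intros)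
  then show "retraction X K (\<lambda>x. H (1, x))"
    using assms by (auto simp: retraction_def)
  have "prod_topology (top_of_set {0..1::real}) (top_of_set X) = top_of_set ({0..1} \<times> X)"
    by (metis prod_topology_euclidean subtopology_Times)
  then have "continuous_map (prod_topology (top_of_set {0..1}) (top_of_set X)) (top_of_set X) H"
    using H by (auto simp: image_subset_iff)
  then show "homotopic_with_canon (\<lambda>h. \<forall>y\<in>K. h y = y) X X id (\<lambda>x. H (1, x))"
  proof (subst homotopic_with)
    fix h k :: "'a \<Rightarrow> 'a" assume "\<And>x. x \<in> topspace (top_of_set X) \<Longrightarrow> h x = k x"
    then have "h y = k y" if "y \<in> K" for y using that assms(1) by auto
    then show "(\<forall>y\<in>K. h y = y) \<longleftrightarrow> (\<forall>y\<in>K. k y = y)" by auto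
  next
    show "\<exists>h. continuous_map (prod_topology (top_of_set {0..1::real}) (top_of_set X)) (top_of_set X) h \<and>
      (\<forall>x\<in>topspace (top_of_set X). h (0, x) = id x) \<and>
      (\<forall>x\<in>topspace (top_of_set X). h (1, x) = H (1, x)) \<and> (\<forall>t\<in>{0..1}. \<forall>y\<in>K. h (t, y) = y)"
      using \<open>continuous_map _ _ H\<close> H by (intro exI[of _ H]) auto
  qed
qed

text \<open>The deformation carries \<open>l\<close> into \<open>Y\<close> without changing degrees,
  but a map supported in a ball off the closed set \<open>Y\<close> is near 1 on \<open>Y\<close>
  and gives degree 0.\<close>

lemma essential_at_in_retract:
  fixes X :: "'a::metric_space set"
  assumes "deformation_retracts_to X Y" "closed Y" "essential_at X z"
  shows "z \<in> Y"
proof (rule ccontr)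
  assume "z \<notin> Y"
  then obtain r where r: "r > 0" "ball z r \<subseteq> - Y"
    using assms(2) open_Compl[of Y] by (meson ComplI open_contains_ball)
  obtain l where l: "lip_path X l" "pathfinish l = pathstart l"
    and f: "\<And>r. r > 0 \<Longrightarrow> \<exists>f. nonvanishing_on X f \<and> (\<forall>x\<in>X - ball z r. norm (f x - 1) < 1/2) \<and> deg f l \<noteq> 0"
    using assms(3) by (auto simp: essential_at_def)
  obtain f where f: "nonvanishing_on X f" "\<forall>x\<in>X - ball z r. norm (f x - 1) < 1/2" "deg f l \<noteq> 0"
    using f[OF r(1)] by auto
  obtain H where H: "continuous_on ({0..1} \<times> X) H" "H ` ({0..1} \<times> X) \<subseteq> X"
    "\<And>x. x \<in> X \<Longrightarrow> H (0, x) = x" "\<And>x. x \<in> X \<Longrightarrow> H (1::real, x) \<in> Y" "retraction X Y (\<lambda>x. H (1, x))"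
    by (rule deformation_retracts_toE[OF assms(1)]) blast
  have lX: "path_image l \<subseteq> X" using l by (simp add: lip_path_def)
  have hom: "homotopic_loops X l (\<lambda>t. H (1, l t))"
    by (rule homotopic_loops_along[OF H(1-3) lip_path_imp_path[OF l(1)] lX l(2)])
  have "deg f (\<lambda>t. H (1, l t)) = 0"
  proof (rule deg_loop_near_1[OF f(1)])
    show "path (\<lambda>t. H (1, l t))" "pathfinish (\<lambda>t. H (1, l t)) = pathstart (\<lambda>t. H (1, l t))"
      using homotopic_loops_imp_path[OF hom] homotopic_loops_imp_loop[OF hom] by auto
    show "path_image (\<lambda>t. H (1, l t)) \<subseteq> X" using homotopic_loops_imp_subset[OF hom] by auto
    fix x assume "x \<in> path_image (\<lambda>t. H (1, l t))"
    then have "x \<in> Y" "x \<in> X" using H(4) lX homotopic_loops_imp_subset[OF hom] by (auto simp: path_image_def)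
    then show "norm (f x - 1) < 1/2" using f(2) r(2) by blast
  qed
  then show False using deg_homotopic_loops[OF f(1) hom] f(3) by simp
qed

section \<open>Nearest points and shortest paths to a closed set\<close>

lemma nearest_point_exists:
  fixes K :: "'a::metric_space set"
  assumes "compact K" "K \<noteq> {}"
  obtains u where "u \<in> K" "dist x u = infdist x K"
proof -
  obtain u where u: "u \<in> K" "\<And>y. y \<in> K \<Longrightarrow> dist x u \<le> dist x y"
  proof -
    have "continuous_on K (dist x)" by (intro continuous_intros)
    then show thesis using continuous_attains_inf[OF assms, of "dist x"] that by blast
  qed
  have "infdist x K = dist x u"
    using u assms by (intro antisym infdist_le) (auto simp: infdist_notempty intro!: cINF_greatest)
  then show ?thesis using that u by auto
qed

text \<open>Sequential closed graph theorem: in a compact target the values along a convergent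
  sequence have a convergent subsequence, whose limit the graph condition identifies.\<close>

lemma continuous_on_closed_graph_compact:
  fixes f :: "'a::metric_space \<Rightarrow> 'b::metric_space"
  assumes T: "compact T" "f ` S \<subseteq> T"
    and graph: "\<And>\<xi> x y. \<lbrakk>\<And>n. \<xi> n \<in> S; \<xi> \<longlonglongrightarrow> x; x \<in> S; (\<lambda>n. f (\<xi> n)) \<longlonglongrightarrow> y; y \<in> T\<rbrakk> \<Longrightarrow> y = f x"
  shows "continuous_on S f"
proof -
  have fim: "f \<in> S \<rightarrow> T" using T by auto
  show ?thesis
    unfolding continuous_on_closed_gen[OF fim] closedin_limpt[of _ "S \<inter> _"] islimpt_sequential
  proof (intro allI impI conjI)
    fix U x assume U: "closedin (top_of_set T) U"
      and "(\<exists>\<xi>. (\<forall>n. \<xi> n \<in> S \<inter> f -` U - {x}) \<and> \<xi> \<longlonglongrightarrow> x) \<and> x \<in> S"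
    then obtain \<xi> where \<xi>: "\<And>n. \<xi> n \<in> S" "\<And>n. f (\<xi> n) \<in> U" "\<xi> \<longlonglongrightarrow> x" "x \<in> S" by auto
    have "compact U" using U T(1) closedin_compact by blast
    then obtain y r where y: "y \<in> U" "strict_mono r" "((\<lambda>n. f (\<xi> n)) \<circ> r) \<longlonglongrightarrow> y"
      using \<xi>(2) unfolding compact_eq_seq_compact_metric seq_compact_def by metis
    have "y = f x"
    proof (rule graph[of "\<xi> \<circ> r"])
      show "(\<xi> \<circ> r) \<longlonglongrightarrow> x" using LIMSEQ_subseq_LIMSEQ[OF \<xi>(3) y(2)] .
      show "(\<lambda>n. f ((\<xi> \<circ> r) n)) \<longlonglongrightarrow> y" using y(3) by (simp add: o_def)
      show "y \<in> T" using y(1) U closedin_imp_subset by blast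
    qed (use \<xi> in auto)
    then show "x \<in> S \<inter> f -` U" using y(1) \<xi>(4) by simp
  qed auto
qed

text \<open>The point at fraction \<open>s\<close> of a shortest path to \<open>K\<close>, if unique, depends continuously on
  \<open>s\<close> and on the starting point because its graph is closed.\<close>

lemma geodesic_retraction:
  fixes X :: "'a::metric_space set"
  assumes X: "compact X" "geodesic_space X" and K: "K \<subseteq> X" "closed K" "K \<noteq> {}"
    and uniq: "\<And>x s y y'. \<lbrakk>x \<in> X; y \<in> X; y' \<in> X; 0 \<le> s; s \<le> 1;
       dist x y = s * infdist x K; infdist y K = (1 - s) * infdist x K;
       dist x y' = s * infdist x K; infdist y' K = (1 - s) * infdist x K\<rbrakk> \<Longrightarrow> y = y'"
  shows "\<exists>F. continuous_on ({0..1} \<times> X) F \<and> F ` ({0..1} \<times> X) \<subseteq> X \<and> (\<forall>x\<in>X. F (0::real, x) = x) \<and>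
    (\<forall>x\<in>X. F (1, x) \<in> K \<and> dist x (F (1, x)) = infdist x K) \<and> (\<forall>s\<in>{0..1}. \<forall>x\<in>K. F (s, x) = x)"
proof -
  \<comment> \<open>\<open>P s x y\<close> says that \<open>y\<close> lies at fraction
    \<open>s\<close> of some shortest path from \<open>x\<close> to \<open>K\<close>, expressed by
    equations that survive limits.\<close>
  define P where "P s x y \<longleftrightarrow> y \<in> X \<and> dist x y = s * infdist x K \<and> infdist y K = (1 - s) * infdist x K" for s x y
  have cK: "compact K" using compact_Int_closed[OF X(1) K(2)] K(1) by (simp add: Int_absorb1)
  have "\<exists>y. P s x y" if "x \<in> X" "s \<in> {0..1}" for s x
  proof -
    obtain u where u: "u \<in> K" "dist x u = infdist x K" by (rule nearest_point_exists[OF cK K(3)])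
    then obtain c where c: "geodesic_arc X c" "c 0 = x" "c 1 = u"
      using geodesic_arc_exists[OF X(2) \<open>x \<in> X\<close>, of u] K(1) by auto
    have 1: "dist x (c s) = s * infdist x K"
      using geodesic_arc_dist[OF c(1), of 0 s] that c u by simp
    have "dist (c s) u = (1 - s) * infdist x K"
      using geodesic_arc_dist[OF c(1), of s 1] that c u by simp
    then have "infdist (c s) K \<le> (1 - s) * infdist x K" using infdist_le[OF u(1), of "c s"] by simp
    moreover have "infdist x K \<le> infdist (c s) K + dist x (c s)" by (rule infdist_triangle)
    ultimately have "infdist (c s) K = (1 - s) * infdist x K" using 1 by (simp add: algebra_simps)
    moreover have "c s \<in> X" using c(1) that by (auto simp: geodesic_arc_def path_image_def)
    ultimately show ?thesis using 1 by (auto simp: P_def)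
  qed
  then have "\<forall>p\<in>{0..1} \<times> X. \<exists>y. P (fst p) (snd p) y" by auto
  then obtain F where "\<forall>p\<in>{0..1} \<times> X. P (fst p) (snd p) (F p)" by metis
  then have F: "P s x (F (s, x))" if "s \<in> {0..1}" "x \<in> X" for s x using that by force
  have FI: "F (s, x) = y" if "s \<in> {0..1}" "x \<in> X" "P s x y" for s x y
    using uniq[of x "F (s, x)" y s] F[of s x] that by (auto simp: P_def)
  have K0: "infdist x K = 0" "x \<in> X" if "x \<in> K" for x using that K by auto
  show ?thesis
  proof (intro exI[of _ F] conjI ballI)
    show im: "F ` ({0..1} \<times> X) \<subseteq> X" using F by (auto simp: P_def)
    show "continuous_on ({0..1} \<times> X) F"
    proof (rule continuous_on_closed_graph_compact[OF X(1) im])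
      fix \<xi> p y
      assume \<xi>: "\<And>n. \<xi> n \<in> {0..1} \<times> X" "\<xi> \<longlonglongrightarrow> p" "p \<in> {0..1} \<times> X" "(\<lambda>n. F (\<xi> n)) \<longlonglongrightarrow> y" "y \<in> X"
      have lim: "(\<lambda>n. fst (\<xi> n)) \<longlonglongrightarrow> fst p" "(\<lambda>n. snd (\<xi> n)) \<longlonglongrightarrow> snd p"
        using \<xi>(2) by (auto intro: tendsto_fst tendsto_snd)
      have Pn: "P (fst (\<xi> n)) (snd (\<xi> n)) (F (\<xi> n))" for n
        using F[of "fst (\<xi> n)" "snd (\<xi> n)"] \<xi>(1)[of n] by (auto simp: mem_Times_iff)
      have "(\<lambda>n. dist (snd (\<xi> n)) (F (\<xi> n))) \<longlonglongrightarrow> dist (snd p) y"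
        "(\<lambda>n. fst (\<xi> n) * infdist (snd (\<xi> n)) K) \<longlonglongrightarrow> fst p * infdist (snd p) K"
        "(\<lambda>n. infdist (F (\<xi> n)) K) \<longlonglongrightarrow> infdist y K"
        "(\<lambda>n. (1 - fst (\<xi> n)) * infdist (snd (\<xi> n)) K) \<longlonglongrightarrow> (1 - fst p) * infdist (snd p) K"
        by (intro tendsto_intros lim \<xi>)+
      moreover have "dist (snd (\<xi> n)) (F (\<xi> n)) = fst (\<xi> n) * infdist (snd (\<xi> n)) K"
        "infdist (F (\<xi> n)) K = (1 - fst (\<xi> n)) * infdist (snd (\<xi> n)) K" for n
        using Pn[of n] by (auto simp: P_def)
      ultimately have "P (fst p) (snd p) y"
        using \<xi>(5) by (auto simp: P_def intro: LIMSEQ_unique)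
      then show "y = F p" using FI[of "fst p" "snd p" y] \<xi>(3) by (auto simp: mem_Times_iff)
    qed
    show "F (0, x) = x" if "x \<in> X" for x using that by (intro FI) (auto simp: P_def)
    show F1: "F (1, x) \<in> K" if "x \<in> X" for x
      using F[of 1 x] that in_closed_iff_infdist_zero[OF K(2,3)] by (auto simp: P_def)
    show "dist x (F (1, x)) = infdist x K" if "x \<in> X" for x
      using F[of 1 x] that by (auto simp: P_def)
    show "F (s, x) = x" if "s \<in> {0..1}" "x \<in> K" for s x
      using that K0[of x] by (intro FI) (auto simp: P_def)
  qed
qed

text \<open>Failure of the uniqueness demanded by \<open>geodesic_retraction\<close> is turned into
  two geodesics with common ends, one of which misses \<open>y\<close>. A shortest path from
  \<open>x\<close> has only one point at distance \<open>s * \<delta>\<close> from \<open>x\<close>,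
  so the one through \<open>y'\<close> cannot contain \<open>y\<close>.\<close>

lemma two_shortest_paths:
  fixes X :: "'a::metric_space set"
  assumes X: "compact X" "geodesic_space X" and K: "K \<subseteq> X" "closed K" "K \<noteq> {}"
    and x: "x \<in> X" and y: "y \<in> X" "y' \<in> X" "y \<noteq> y'" and s: "0 \<le> s" "s \<le> 1"
    and d: "dist x y = s * infdist x K" "infdist y K = (1 - s) * infdist x K"
       "dist x y' = s * infdist x K" "infdist y' K = (1 - s) * infdist x K"
    and nearest: "\<And>u u'. \<lbrakk>u \<in> K; u' \<in> K; dist x u = infdist x K; dist x u' = infdist x K\<rbrakk> \<Longrightarrow> u = u'"
  obtains \<alpha> \<beta> where "geodesic_arc X \<alpha>" "geodesic_arc X \<beta>" "\<alpha> 0 = x" "\<beta> 0 = x" "\<alpha> 1 = \<beta> 1" "\<alpha> 1 \<in> K"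
    "dist x (\<alpha> 1) = infdist x K" "y \<in> path_image \<alpha>" "y \<notin> path_image \<beta>" "y \<notin> K" "0 < infdist x K" "y \<noteq> x"
proof -
  have cK: "compact K" using compact_Int_closed[OF X(1) K(2)] K(1) by (simp add: Int_absorb1)
  define \<delta> where "\<delta> = infdist x K"
  have "\<delta> > 0"
  proof -
    have "\<delta> \<noteq> 0" using d y(3) by (auto simp: \<delta>_def)
    then show ?thesis using infdist_nonneg[of x K] by (simp add: \<delta>_def)
  qed
  have "s \<noteq> 0" using d y(3) by auto
  have "s \<noteq> 1"
  proof
    assume "s = 1"
    then have "y \<in> K" "y' \<in> K" "dist x y = infdist x K" "dist x y' = infdist x K"
      using d in_closed_iff_infdist_zero[OF K(2,3)] by auto
    then show False using nearest y(3) by blast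
  qed
  \<comment> \<open>A geodesic from \<open>x\<close> to \<open>v\<close>, prolonged to a point of
    \<open>K\<close> nearest to \<open>v\<close>, has total length \<delta> and is therefore itself
    a geodesic.\<close>
  have arc: "\<exists>c. geodesic_arc X c \<and> c 0 = x \<and> c 1 \<in> K \<and> dist x (c 1) = \<delta> \<and> c s = v"
    if v: "v \<in> X" "dist x v = s * \<delta>" "infdist v K = (1 - s) * \<delta>" for v
  proof -
    obtain u where u: "u \<in> K" "dist v u = infdist v K" by (rule nearest_point_exists[OF cK K(3)])
    have "dist x u \<le> s * \<delta> + (1 - s) * \<delta>" using dist_triangle[of x u v] v u by simp
    then have "dist x u \<le> \<delta>" by (simp add: algebra_simps)
    moreover have "\<delta> \<le> dist x u" unfolding \<delta>_def by (rule infdist_le[OF u(1)])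
    ultimately have xu: "dist x u = \<delta>" by simp
    obtain p where p: "geodesic_arc X p" "p 0 = x" "p 1 = v" by (rule geodesic_arc_exists[OF X(2) x v(1)])
    obtain q where q: "geodesic_arc X q" "q 0 = v" "q 1 = u"
      using geodesic_arc_exists[OF X(2) v(1), of u] u(1) K(1) by blast
    obtain c where c: "geodesic_arc X c" "c 0 = x" "c 1 = u" "path_image c = path_image p \<union> path_image q"
      using geodesic_arc_concat[OF p(1) q(1)] p q v u xu by (metis (no_types, lifting) add_diff_cancel_left' diff_add_cancel left_diff_distrib mult_1)
    have "v \<in> path_image c" using c(4) p(3) by (auto simp: path_image_def)
    then obtain t where t: "t \<in> {0..1}" "c t = v" by (auto simp: path_image_def)
    have "dist (c 0) (c t) = t * \<delta>" using geodesic_arc_dist[OF c(1), of 0 t] t c xu by simp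
    then have "t * \<delta> = s * \<delta>" using t(2) c(2) v(2) by metis
    then have "c s = v" using t \<open>\<delta> > 0\<close> by (metis mult_cancel_right less_irrefl)
    then show ?thesis using c u xu by auto
  qed
  obtain \<alpha> where \<alpha>: "geodesic_arc X \<alpha>" "\<alpha> 0 = x" "\<alpha> 1 \<in> K" "dist x (\<alpha> 1) = \<delta>" "\<alpha> s = y"
    using arc[of y] y d by (auto simp: \<delta>_def)
  obtain \<beta> where \<beta>: "geodesic_arc X \<beta>" "\<beta> 0 = x" "\<beta> 1 \<in> K" "dist x (\<beta> 1) = \<delta>" "\<beta> s = y'"
    using arc[of y'] y d by (auto simp: \<delta>_def)
  have "y \<notin> path_image \<beta>"
  proof
    assume "y \<in> path_image \<beta>"
    then obtain t where t: "t \<in> {0..1}" "\<beta> t = y" by (auto simp: path_image_def)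
    have "dist (\<beta> 0) (\<beta> t) = t * \<delta>" using geodesic_arc_dist[OF \<beta>(1), of 0 t] t \<beta> by simp
    then have "t * \<delta> = s * \<delta>" using t(2) \<beta>(2) d(1) unfolding \<delta>_def by metis
    then show False using t \<beta>(5) \<open>\<delta> > 0\<close> y(3) by (metis mult_cancel_right less_irrefl)
  qed
  moreover have "\<alpha> 1 = \<beta> 1" using nearest \<alpha> \<beta> by (simp add: \<delta>_def)
  moreover have "y \<in> path_image \<alpha>" using \<alpha>(5) s by (auto simp: path_image_def)
  moreover have "infdist y K \<noteq> 0" using d(2) \<open>\<delta> > 0\<close> \<open>s \<noteq> 1\<close> by (simp add: \<delta>_def)
  then have "y \<notin> K" by auto
  moreover have "y \<noteq> x" using d(1) \<open>s \<noteq> 0\<close> \<open>\<delta> > 0\<close> by (auto simp: \<delta>_def)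
  ultimately show ?thesis using \<alpha> \<beta> \<open>\<delta> > 0\<close> by (intro that[of \<alpha> \<beta>]) (auto simp: \<delta>_def)
qed

subsection \<open>The hull is contained in every deformation retract\<close>


locale one_dim_geodesic_space =
  fixes X :: "'a::metric_space set"
  assumes compact_X: "compact X" and dim_X: "covering_dim_le (top_of_set X) 1"
    and geodesic_X: "geodesic_space X"

text \<open>What the shortening argument uses of a deformation retract; \<open>inessential\<close>
  comes from \<open>essential_at_in_retract\<close>.\<close>

locale inessential_complement = one_dim_geodesic_space X for X :: "'a::metric_space set" +
  fixes Y :: "'a set"
  assumes Y_subset: "Y \<subseteq> X" and Y_closed: "closed Y" and Y_nonempty: "Y \<noteq> {}" and Y_connected: "connected Y"
    and inessential: "z \<in> X - Y \<Longrightarrow> \<not> essential_at X z"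
begin

text \<open>Otherwise points of \<open>\<sigma>\<close> outside \<open>S \<union> Y\<close> would be essential.\<close>

lemma shortest_path_end_in:
  assumes \<sigma>: "geodesic_arc X \<sigma>" "\<sigma> 1 \<in> Y" "\<And>s. s \<in> {0..<1} \<Longrightarrow> \<sigma> s \<notin> Y"
    and S: "connected S" "closed S" "S \<subseteq> X" "\<sigma> 0 \<in> S" "S \<inter> Y \<noteq> {}"
  shows "\<sigma> 1 \<in> S"
proof -
  have "\<sigma> s \<in> S" if s: "s \<in> {0..<1}" for s
  proof (rule ccontr)
    assume "\<sigma> s \<notin> S"
    have im: "\<sigma> s \<in> path_image \<sigma>" using s by (auto simp: path_image_def)
    have "connected (S \<union> Y)" using S Y_connected by (intro connected_Un) auto
    then have "essential_at X (\<sigma> s)"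
    proof (rule essential_at_geodesic[OF compact_X dim_X geodesic_X \<sigma>(1) im])
      show "S \<union> Y \<subseteq> X - {\<sigma> s}" using S(3) Y_subset \<sigma>(3)[OF s] \<open>\<sigma> s \<notin> S\<close> by auto
    qed (use S \<sigma> in auto)
    moreover have "\<sigma> s \<in> X - Y" using im \<sigma> s by (auto simp: geodesic_arc_def)
    ultimately show False using inessential by blast
  qed
  moreover have "closure {0..<1} = {0..1::real}" by simp
  moreover have "continuous_on {0..1} \<sigma>" using geodesic_arc_path[OF \<sigma>(1)] by (simp add: path_def)
  moreover have "\<sigma> ` {0..<1} \<subseteq> S" using calculation(1) by blast
  ultimately have "\<sigma> ` {0..1} \<subseteq> S"
    using image_closure_subset[of "{0..<1}" \<sigma> S] S(2) by metis
  then show ?thesis by auto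
qed

lemma geodesic_to_nearest:
  assumes "x \<in> X" "u \<in> Y" "dist x u = infdist x Y"
  obtains \<sigma> where "geodesic_arc X \<sigma>" "\<sigma> 0 = x" "\<sigma> 1 = u" "path_image \<sigma> \<inter> Y = {u}"
    "x \<notin> Y \<Longrightarrow> \<forall>s\<in>{0..<1}. \<sigma> s \<notin> Y"
proof -
  obtain \<sigma> where \<sigma>: "geodesic_arc X \<sigma>" "\<sigma> 0 = x" "\<sigma> 1 = u"
    using geodesic_arc_exists[OF geodesic_X assms(1), of u] assms(2) Y_subset by blast
  have key: "s = 1 \<or> x = u" if s: "s \<in> {0..1}" "\<sigma> s \<in> Y" for s
  proof -
    have "dist x u \<le> dist x (\<sigma> s)" unfolding assms(3) using s by (intro infdist_le)
    also have "\<dots> = s * dist x u" using geodesic_arc_dist[OF \<sigma>(1), of 0 s] s \<sigma> by simp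
    finally have "(1 - s) * dist x u \<le> 0" by (simp add: algebra_simps)
    then show ?thesis using s by (auto simp: mult_le_0_iff)
  qed
  have const: "\<sigma> s = u" if "s \<in> {0..1}" "x = u" for s
    using geodesic_arc_dist[OF \<sigma>(1), of 0 s] that \<sigma> by simp
  show ?thesis
  proof (rule that[OF \<sigma>])
    have "\<sigma> s = u" if "s \<in> {0..1}" "\<sigma> s \<in> Y" for s
      using key[OF that] const[OF that(1)] \<sigma>(3) by blast
    moreover have "u \<in> path_image \<sigma>" using geodesic_arc_image(6)[OF \<sigma>(1)] \<sigma>(3) by simp
    ultimately show "path_image \<sigma> \<inter> Y = {u}" using assms(2) by (auto simp only: path_image_def)
    show "\<forall>s\<in>{0..<1}. \<sigma> s \<notin> Y" if "x \<notin> Y" 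
    proof
      fix s :: real assume "s \<in> {0..<1}"
      then show "\<sigma> s \<notin> Y" using key[of s] that assms(2) by auto
    qed
  qed
qed

text \<open>Nearest points act as gates of \<open>Y\<close>: a shortest path from \<open>x\<close>
  outside \<open>Y\<close> to \<open>u\<close> meets \<open>Y\<close> only at its end, so
  \<open>shortest_path_end_in\<close> applies. Below, \<open>S\<close> is a geodesic, or a continuum
  prolonged by one.\<close>

lemma nearest_in_connected:
  assumes "x \<in> X" "u \<in> Y" "dist x u = infdist x Y"
    and S: "connected S" "closed S" "S \<subseteq> X" "x \<in> S" "S \<inter> Y \<noteq> {}"
  shows "u \<in> S"
proof (cases "x \<in> Y")
  case True
  then show ?thesis using assms by simp
next
  case False
  obtain \<sigma> where \<sigma>: "geodesic_arc X \<sigma>" "\<sigma> 0 = x" "\<sigma> 1 = u" "x \<notin> Y \<Longrightarrow> \<forall>s\<in>{0..<1}. \<sigma> s \<notin> Y"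
    by (rule geodesic_to_nearest[OF assms(1-3)]) blast
  then show ?thesis using shortest_path_end_in[OF \<sigma>(1), of S] assms(2) S False by auto
qed

text \<open>A shortest path to \<open>u'\<close> has only \<open>u'\<close> in common with
  \<open>Y\<close>, yet has to contain the gate \<open>u\<close>.\<close>

lemma nearest_unique:
  assumes "x \<in> X" "u \<in> Y" "dist x u = infdist x Y" "u' \<in> Y" "dist x u' = infdist x Y"
  shows "u = u'"
proof -
  obtain \<sigma> where \<sigma>: "geodesic_arc X \<sigma>" "\<sigma> 0 = x" "\<sigma> 1 = u'" "path_image \<sigma> \<inter> Y = {u'}"
    by (rule geodesic_to_nearest[OF assms(1,4,5)]) blast
  have "u \<in> path_image \<sigma>"
    using \<sigma> geodesic_arc_image[OF \<sigma>(1)] by (intro nearest_in_connected[OF assms(1-3)]) auto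
  then show ?thesis using \<sigma> assms by auto
qed

text \<open>Of two shortest paths one would bypass \<open>y\<close>, a point of the other outside
  \<open>Y\<close>, and thereby make it essential.\<close>

lemma shortest_path_unique:
  assumes "x \<in> X" "y \<in> X" "y' \<in> X" "0 \<le> s" "s \<le> 1"
       "dist x y = s * infdist x Y" "infdist y Y = (1 - s) * infdist x Y"
       "dist x y' = s * infdist x Y" "infdist y' Y = (1 - s) * infdist x Y"
  shows "y = y'"
proof (rule ccontr)
  assume "y \<noteq> y'"
  obtain \<alpha> \<beta> where \<alpha>\<beta>: "geodesic_arc X \<alpha>" "geodesic_arc X \<beta>" "\<alpha> 0 = x" "\<beta> 0 = x" "\<alpha> 1 = \<beta> 1" "\<alpha> 1 \<in> Y"
    "y \<in> path_image \<alpha>" "y \<notin> path_image \<beta>" "y \<notin> Y"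
    by (rule two_shortest_paths[OF compact_X geodesic_X Y_subset Y_closed Y_nonempty assms(1-3) \<open>y \<noteq> y'\<close> assms(4-9)])
      (use nearest_unique[OF assms(1)] in blast)+
  have "essential_at X y"
    using \<alpha>\<beta> geodesic_arc_image[OF \<alpha>\<beta>(2)]
    by (intro essential_at_geodesic[OF compact_X dim_X geodesic_X \<alpha>\<beta>(1,7), of "path_image \<beta>"]) auto
  then show False using inessential \<alpha>\<beta>(9) assms(2) by blast
qed

lemma nearest_on_geodesic:
  assumes c: "geodesic_arc X c" "path_image c \<inter> Y \<noteq> {}" and u: "u \<in> Y" "dist (c 0) u = infdist (c 0) Y"
  obtains t where "t \<in> {0..1}" "c t = u"
proof -
  have "u \<in> path_image c"
    by (rule nearest_in_connected[OF geodesic_arc_image(7)[OF c(1)] u geodesic_arc_image(2,4,1,5)[OF c(1)] c(2)])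
  then show ?thesis using that by (auto simp: path_image_def)
qed

text \<open>\<open>S\<close> prolonged by a shortest path from \<open>x'\<close> to
  \<open>u'\<close> meets \<open>Y\<close> in \<open>u'\<close> only and must contain the gate
  \<open>u\<close> of \<open>x\<close>.\<close>

lemma nearest_eq_on_connected:
  assumes S: "connected S" "compact S" "S \<subseteq> X - Y" "x \<in> S" "x' \<in> S"
    and u: "u \<in> Y" "dist x u = infdist x Y" and u': "u' \<in> Y" "dist x' u' = infdist x' Y"
  shows "u = u'"
proof -
  have X: "x \<in> X" "x' \<in> X" using S by auto
  obtain \<sigma> where \<sigma>: "geodesic_arc X \<sigma>" "\<sigma> 0 = x'" "\<sigma> 1 = u'" "path_image \<sigma> \<inter> Y = {u'}"
    by (rule geodesic_to_nearest[OF X(2) u']) blast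
  have p: "path \<sigma>" by (rule geodesic_arc_path[OF \<sigma>(1)])
  have x': "x' \<in> path_image \<sigma>" using \<sigma>(2) by (auto simp: path_image_def)
  have "u \<in> S \<union> path_image \<sigma>"
  proof (rule nearest_in_connected[OF X(1) u])
    show "connected (S \<union> path_image \<sigma>)"
      using S x' p by (intro connected_Un) (auto simp: connected_path_image)
    show "closed (S \<union> path_image \<sigma>)" using S(2) geodesic_arc_image[OF \<sigma>(1)] by (intro closed_Un) (auto intro: compact_imp_closed)
    show "S \<union> path_image \<sigma> \<subseteq> X" using S(3) \<sigma>(1) by (auto simp: geodesic_arc_def)
  qed (use S \<sigma> in auto)
  then show ?thesis using S(3) \<sigma>(4) u(1) by auto
qed

text \<open>If a geodesic from \<open>x\<close> to \<open>x'\<close> misses \<open>Y\<close>, then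
  \<open>u = u'\<close> and only the 1-Lipschitz distance function counts. Otherwise it passes
  \<open>u\<close> and then \<open>u'\<close>, and its outer legs have lengths
  \<open>infdist x Y\<close> and \<open>infdist x' Y\<close>, whose difference is at most their
  sum.\<close>

lemma dist_nearest_le:
  assumes x: "x \<in> X" "u \<in> Y" "dist x u = infdist x Y" and x': "x' \<in> X" "u' \<in> Y" "dist x' u' = infdist x' Y"
  shows "dist u u' + \<bar>infdist x Y - infdist x' Y\<bar> \<le> dist x x'"
proof -
  obtain c where c: "geodesic_arc X c" "c 0 = x" "c 1 = x'" by (rule geodesic_arc_exists[OF geodesic_X x(1) x'(1)])
  show ?thesis
  proof (cases "path_image c \<inter> Y = {}")
    case True
    have "u = u'"
      using True c geodesic_arc_image[OF c(1)]
      by (intro nearest_eq_on_connected[of "path_image c" x x', OF _ _ _ _ _ x(2,3) x'(2,3)]) auto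
    then show ?thesis
      using infdist_triangle_abs[of x Y x'] by simp
  next
    case False
    obtain t where t: "t \<in> {0..1}" "c t = u"
      using nearest_on_geodesic[OF c(1) False] x c by metis
    have rc: "geodesic_arc X (reversepath c)" "path_image (reversepath c) \<inter> Y \<noteq> {}"
      using geodesic_arc_reversepath[OF c(1)] False by auto
    have rc0: "reversepath c 0 = x'" using c(3) by (simp add: reversepath_def)
    obtain t'' where "t'' \<in> {0..1}" "reversepath c t'' = u'"
      using nearest_on_geodesic[OF rc(1,2)] x' rc0 by metis
    then obtain t' where t': "t' \<in> {0..1}" "c t' = u'"
      by (intro that[of "1 - t''"]) (auto simp: reversepath_def)
    define D where "D = dist x x'"
    have d: "infdist x Y = t * D" "infdist x' Y = (1 - t') * D" "dist u u' = \<bar>t - t'\<bar> * D" "dist x u' = t' * D"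
      using geodesic_arc_dist[OF c(1), of 0 t] geodesic_arc_dist[OF c(1), of 1 t'] geodesic_arc_dist[OF c(1), of t t']
        geodesic_arc_dist[OF c(1), of 0 t'] t t' c x(3) x'(3) by (auto simp: D_def)
    \<comment> \<open>\<open>u\<close> comes no later than \<open>u'\<close> because it is the point
      of \<open>Y\<close> nearest to \<open>x\<close>.\<close>
    have "t * D \<le> t' * D" using infdist_le[OF x'(2), of x] d by simp
    then have "\<bar>t - t'\<bar> * D = t' * D - t * D"
      using zero_le_dist[of x x'] by (cases "D = 0") (auto simp: D_def algebra_simps)
    moreover have "\<bar>t * D - (1 - t') * D\<bar> \<le> t * D + (1 - t') * D"
      using t t' by (intro abs_triangle_ineq4[THEN order_trans]) (auto simp: D_def)
    ultimately show ?thesis using d by (simp add: D_def algebra_simps)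
  qed
qed

text \<open>Summing \<open>dist_nearest_le\<close> over a partition that contains \<open>t0\<close>
  and a time spent in \<open>Y\<close> shows that retracting shortens the loop by at least the
  distance from \<open>p\<close> to \<open>Y\<close>. A loop that misses \<open>Y\<close> altogether
  retracts to a single point.\<close>

lemma hull_subset: "pi1_hull X \<subseteq> Y"
proof
  fix p assume "p \<in> pi1_hull X"
  then obtain g where g: "geodesic_loop X g" "\<not> g constant_on {0..1}" "p \<in> path_image g"
    by (auto simp: pi1_hull_def)
  then have pg: "path g" "path_image g \<subseteq> X" "pathfinish g = pathstart g" "path_length g < \<infinity>"
    and min: "\<And>h. homotopic_loops X g h \<Longrightarrow> path_length g \<le> path_length h"
    by (auto simp: geodesic_loop_def)
  obtain t0 where t0: "t0 \<in> {0..1}" "p = g t0" using g(3) by (auto simp: path_image_def)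
  show "p \<in> Y"
  proof (rule ccontr)
    assume "p \<notin> Y"
    have "\<exists>F. continuous_on ({0..1} \<times> X) F \<and> F ` ({0..1} \<times> X) \<subseteq> X \<and> (\<forall>x\<in>X. F (0::real, x) = x) \<and>
        (\<forall>x\<in>X. F (1, x) \<in> Y \<and> dist x (F (1, x)) = infdist x Y) \<and> (\<forall>s\<in>{0..1}. \<forall>x\<in>Y. F (s, x) = x)"
      by (rule geodesic_retraction[OF compact_X geodesic_X Y_subset Y_closed Y_nonempty])
        (rule shortest_path_unique; assumption)
    then obtain F where "continuous_on ({0..1} \<times> X) F" "F ` ({0..1} \<times> X) \<subseteq> X"
      "\<forall>x\<in>X. F (0::real, x) = x" "\<forall>x\<in>X. F (1, x) \<in> Y \<and> dist x (F (1, x)) = infdist x Y"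
      by blast
    then have F: "continuous_on ({0..1} \<times> X) F" "F ` ({0..1} \<times> X) \<subseteq> X"
      "\<And>x. x \<in> X \<Longrightarrow> F (0::real, x) = x" "\<And>x. x \<in> X \<Longrightarrow> F (1, x) \<in> Y"
      "\<And>x. x \<in> X \<Longrightarrow> dist x (F (1, x)) = infdist x Y" by auto
    define h where "h t = F (1, g t)" for t
    have gX: "g t \<in> X" if "t \<in> {0..1}" for t using pg(2) that by (auto simp: path_image_def)
    have "homotopic_loops X g h"
      unfolding h_def by (rule homotopic_loops_along[OF F(1-3) pg(1-3)])
    then have le: "path_length g \<le> path_length h" by (rule min)
    show False
    proof (cases "path_image g \<inter> Y = {}")
      case True
      have h0: "h t = h 0" if "t \<in> {0..1}" for t
        unfolding h_def using True pg that gX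
        by (intro nearest_eq_on_connected[of "path_image g" "g t" "g 0"] F connected_path_image compact_path_image)
          (auto simp: path_image_def)
      have "dist (h s) (h t) \<le> 0 * dist s t" if "s \<in> {0..1}" "t \<in> {0..1}" for s t
        unfolding h0[OF that(1)] h0[OF that(2)] by simp
      then have "0-lipschitz_on {0..1} h" by (rule lipschitz_onI) (assumption+, rule order_refl)
      then have "path_length h \<le> ennreal 0" by (rule path_length_lipschitz)
      moreover obtain t where "t \<in> {0..1}" "g t \<noteq> g 0" using g(2) unfolding constant_on_def by blast
      then have "0 < path_length g" by (intro path_length_pos[of t 0]) auto
      ultimately show False using le by simp
    next
      case False
      then obtain t1 where t1: "t1 \<in> {0..1}" "g t1 \<in> Y" unfolding path_image_def by blast
      define \<phi> where "\<phi> t = infdist (g t) Y" for t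
      have \<phi>: "\<phi> t1 = 0" "0 < \<phi> t0"
        using t1 t0 \<open>p \<notin> Y\<close> Y_closed Y_nonempty by (auto simp: \<phi>_def intro: infdist_pos_not_in_closed)
      obtain B where B: "path_length g = ennreal B" "0 \<le> B"
        using pg(4) by (cases "path_length g") auto
      have "path_length h \<le> ennreal (B - \<phi> t0)"
      proof (rule path_length_leI)
        fix xs :: "real list" assume xs: "sorted xs" "set xs \<subseteq> {0..1}"
        define ys where "ys = insort t0 (insort t1 xs)"
        have ys: "sorted ys" "set ys \<subseteq> {0..1}" "t0 \<in> set ys" "t1 \<in> set ys"
          using xs t0 t1 by (auto simp: ys_def sorted_insort set_insort_key)
        have "polygon_sum h xs \<le> polygon_sum h ys"
          unfolding ys_def by (rule order_trans[OF polygon_sum_insort polygon_sum_insort])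
        moreover have "dist (\<phi> t0) (\<phi> t1) \<le> polygon_sum \<phi> ys"
          by (rule dist_le_polygon_sum[OF ys(3,4)])
        then have "\<phi> t0 \<le> polygon_sum \<phi> ys" using \<phi> by (simp add: dist_real_def)
        moreover have "polygon_sum h ys + polygon_sum \<phi> ys \<le> polygon_sum g ys"
        proof (rule polygon_sum_mono)
          fix a b assume "a \<in> set ys" "b \<in> set ys"
          then have "g a \<in> X" "g b \<in> X" using ys(2) gX by auto
          then show "dist (h a) (h b) + dist (\<phi> a) (\<phi> b) \<le> dist (g a) (g b)"
            unfolding h_def \<phi>_def dist_real_def by (intro dist_nearest_le F)
        qed
        moreover have "ennreal (polygon_sum g ys) \<le> ennreal B"
          unfolding B(1)[symmetric] by (rule polygon_sum_le_path_length[OF ys(1,2)])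
        then have "polygon_sum g ys \<le> B" using B(2) by (simp add: ennreal_le_iff)
        ultimately show "ennreal (polygon_sum h xs) \<le> ennreal (B - \<phi> t0)"
          by (intro ennreal_leI) linarith
      qed
      then have "ennreal B \<le> ennreal (B - \<phi> t0)" using le B(1) by simp
      \<comment> \<open>\<open>ennreal\<close> maps negative reals to 0, so the comparison yields
        \<open>B = 0\<close>, which a nonconstant loop excludes.\<close>
      then have "B \<le> max 0 (B - \<phi> t0)" by (metis ennreal_le_iff ennreal_max_0 max.cobounded1)
      then have "B = 0" using \<phi>(2) B(2) by linarith
      moreover have "0 < path_length g"
        using g(2) t0 t1 \<open>p \<notin> Y\<close> by (intro path_length_pos[of t0 t1]) auto
      ultimately show False using B(1) by simp
    qed
  qed
qed

end

lemma (in one_dim_geodesic_space) hull_subset_retract: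
  assumes "Y \<subseteq> X" "deformation_retracts_to X Y"
  shows "pi1_hull X \<subseteq> Y"
proof (cases "X = {}")
  case True
  then show ?thesis by (auto simp: pi1_hull_def geodesic_loop_def)
next
  case False
  obtain r where r: "retraction X Y r" using assms(2) by (auto simp: deformation_retracts_to_def)
  then have Y: "Y = r ` X" "continuous_on X r" by (auto simp: retraction)
  interpret inessential_complement X Y
  proof
    show cl: "closed Y" using Y compact_X by (simp add: compact_continuous_image compact_imp_closed)
    show "connected Y" using Y geodesic_space_connected[OF geodesic_X] by (simp add: connected_continuous_image)
    show "\<not> essential_at X z" if "z \<in> X - Y" for z
      using essential_at_in_retract[OF assms(2) cl] that by blast
  qed (use assms Y False in auto)
  show ?thesis by (rule hull_subset)
qed

subsection \<open>Short essential loops\<close>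


text \<open>Here the loop is confined to \<open>A\<close> and the map is arbitrary;
  \<open>essential_at\<close> confines the map and leaves the loop free.\<close>

definition has_essential_loop :: "'a::metric_space set \<Rightarrow> 'a set \<Rightarrow> bool" where
  "has_essential_loop X A \<longleftrightarrow> (\<exists>l f. lip_path X l \<and> path_image l \<subseteq> A \<and> pathfinish l = pathstart l \<and>
     nonvanishing_on X f \<and> deg f l \<noteq> 0)"

lemma has_essential_loop_mono: "\<lbrakk>has_essential_loop X A; A \<subseteq> B\<rbrakk> \<Longrightarrow> has_essential_loop X B"
  unfolding has_essential_loop_def by blast

fun nested_join :: "(nat \<Rightarrow> real \<Rightarrow> 'a::topological_space) \<Rightarrow> 'a \<Rightarrow> nat \<Rightarrow> nat \<Rightarrow> real \<Rightarrow> 'a" where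
  "nested_join Z q n 0 = (\<lambda>_. q)"
| "nested_join Z q n (Suc m) = Z n +++ nested_join Z q (Suc n) m"

text \<open>Each join doubles the Lipschitz constant, but every factor sits one join deeper than its
  predecessor and has half the constant. The bound is therefore independent of the number
  \<open>m\<close> of factors, and an infinite product can be formed as a limit.\<close>

lemma nested_join:
  fixes X :: "'a::metric_space set"
  assumes "q \<in> X" and Z: "\<And>i. ((1/2)^i)-lipschitz_on {0..1} (Z i)" "\<And>i. path_image (Z i) \<subseteq> X"
    "\<And>i. Z i 0 = q" "\<And>i. Z i 1 = q"
  shows "(2 * (1/2)^n)-lipschitz_on {0..1} (nested_join Z q n m) \<and> path_image (nested_join Z q n m) \<subseteq> X \<and>
    pathstart (nested_join Z q n m) = q \<and> pathfinish (nested_join Z q n m) = q \<and>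
    (\<forall>f. nonvanishing_on X f \<longrightarrow> deg f (nested_join Z q n m) = (\<Sum>i<m. deg f (Z (n + i))))"
proof (induction m arbitrary: n)
  case 0
  have "deg f (\<lambda>_::real. q) = 0" if "nonvanishing_on X f" for f
    using that \<open>q \<in> X\<close> by (intro winding_number_constI[of "f q"]) (auto simp: nonvanishing_on_def)
  then show ?case
    using \<open>q \<in> X\<close> by (auto simp: path_image_def pathstart_def pathfinish_def intro!: lipschitz_onI)
next
  case (Suc m)
  let ?N = "nested_join Z q (Suc n) m"
  have IH: "(2 * (1/2)^Suc n)-lipschitz_on {0..1} ?N" "path_image ?N \<subseteq> X" "pathstart ?N = q" "pathfinish ?N = q"
    "\<And>f. nonvanishing_on X f \<Longrightarrow> deg f ?N = (\<Sum>i<m. deg f (Z (Suc n + i)))"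
    using Suc.IH[of "Suc n"] by blast+
  have Zq: "pathstart (Z n) = q" "pathfinish (Z n) = q" using Z by (auto simp: pathstart_def pathfinish_def)
  have "(2 * max ((1/2)^n) (2 * (1/2)^Suc n))-lipschitz_on {0..1} (Z n +++ ?N)"
    using Zq IH(3) by (intro lipschitz_on_joinpaths Z IH) auto
  then have "(2 * (1/2)^n)-lipschitz_on {0..1} (Z n +++ ?N)" by simp
  moreover have "deg f (Z n +++ ?N) = (\<Sum>i<Suc m. deg f (Z (n + i)))" if f: "nonvanishing_on X f" for f
  proof -
    have "path (Z n)" "path ?N" using Z(1)[of n] IH(1) by (auto simp: path_def intro: lipschitz_on_continuous_on)
    then have "deg f (Z n +++ ?N) = deg f (Z n) + deg f ?N"
      using Zq IH Z by (intro deg_join[OF f]) auto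
    then show ?thesis unfolding IH(5)[OF f] sum.lessThan_Suc_shift by simp
  qed
  moreover have "path_image (Z n +++ ?N) \<subseteq> X" by (intro subset_path_image_join Z IH)
  moreover have "pathstart (Z n +++ ?N) = q" "pathfinish (Z n +++ ?N) = q" using Zq IH(4) by simp_all
  ultimately show ?case unfolding nested_join.simps by blast
qed

text \<open>The hypotheses make \<open>N\<close> clopen in \<open>X - {q}\<close>: adding
  \<open>q\<close> is enough to close it.\<close>

lemma connected_subset_of_clopen:
  fixes X :: "'a::t1_space set"
  assumes "connected S" "openin (top_of_set X) N" "closed (N \<union> {q})" "S \<subseteq> X - {q}" "S \<inter> N \<noteq> {}"
  shows "S \<subseteq> N"
proof -
  obtain T where "open T" "N = X \<inter> T" using assms(2) by (auto simp: openin_open)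
  then have "openin (top_of_set S) (S \<inter> N)" using assms(4) by (auto simp: openin_open)
  moreover have "S \<inter> N = S \<inter> (N \<union> {q})" using assms(4) by auto
  then have "closedin (top_of_set S) (S \<inter> N)" using assms(3) by (metis closedin_closed_Int)
  ultimately show ?thesis using assms(1,5) unfolding connected_clopen by blast
qed

context one_dim_geodesic_space
begin

lemma two_geodesics_essential:
  assumes \<alpha>: "geodesic_arc X \<alpha>" and \<beta>: "lip_path X \<beta>" "\<beta> 0 = \<alpha> 0" "\<beta> 1 = \<alpha> 1"
    and z: "z \<in> path_image \<alpha>" "z \<notin> path_image \<beta>" and A: "path_image \<alpha> \<subseteq> A" "path_image \<beta> \<subseteq> A"
  shows "has_essential_loop X A"
proof -
  obtain f where f: "nonvanishing_on X f" "deg f (\<alpha> +++ reversepath \<beta>) \<noteq> 0"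
    by (rule bump_map[OF compact_X dim_X \<alpha> lip_path_imp_path[OF \<beta>(1)] lip_path_image[OF \<beta>(1)] \<beta>(2,3) z zero_less_one]) blast
  have "pathfinish \<alpha> = pathstart (reversepath \<beta>)" "pathfinish (reversepath \<beta>) = pathstart \<alpha>"
    using \<beta>(2,3) by (simp_all add: pathstart_def pathfinish_def reversepath_def)
  moreover have "lip_path X (\<alpha> +++ reversepath \<beta>)"
    by (intro lip_path_join lip_path_reversepath geodesic_arc_lip_path[OF \<alpha>] \<beta>(1) calculation(1))
  moreover have "path_image (\<alpha> +++ reversepath \<beta>) \<subseteq> A"
    using A by (intro subset_path_image_join) auto
  moreover have "pathfinish (\<alpha> +++ reversepath \<beta>) = pathstart (\<alpha> +++ reversepath \<beta>)"
    using calculation(2) by (metis pathfinish_join pathstart_join)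
  ultimately show ?thesis using f unfolding has_essential_loop_def by blast
qed

text \<open>\<open>l'\<close> is attached to \<open>l\<close> by a geodesic traversed out and back,
  whose two contributions cancel.\<close>

lemma loop_sum:
  assumes l: "lip_path X l" "pathfinish l = pathstart l" and l': "lip_path X l'" "pathfinish l' = pathstart l'"
  obtains k where "lip_path X k" "pathfinish k = pathstart k" "\<And>f. nonvanishing_on X f \<Longrightarrow> deg f k = deg f l + deg f l'"
proof -
  have "pathstart l \<in> X" "pathstart l' \<in> X"
    using lip_path_image[OF l(1)] lip_path_image[OF l'(1)] by (auto simp: subset_iff)
  then obtain \<tau> where \<tau>: "geodesic_arc X \<tau>" "\<tau> 0 = pathstart l" "\<tau> 1 = pathstart l'"
    by (rule geodesic_arc_exists[OF geodesic_X])
  have p: "lip_path X \<tau>" "lip_path X (reversepath \<tau>)" using \<tau>(1) by (auto intro: geodesic_arc_lip_path lip_path_reversepath)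
  have \<tau>e: "pathstart \<tau> = pathstart l" "pathfinish \<tau> = pathstart l'" using \<tau> by (auto simp: pathstart_def pathfinish_def)
  define k where "k = l +++ (\<tau> +++ (l' +++ reversepath \<tau>))"
  have lip: "lip_path X (l' +++ reversepath \<tau>)" "lip_path X (\<tau> +++ (l' +++ reversepath \<tau>))" "lip_path X k"
    unfolding k_def using l l' \<tau>e p by (auto intro!: lip_path_join)
  show ?thesis
  proof (rule that[OF lip(3)])
    show "pathfinish k = pathstart k" using l l' \<tau>e by (simp add: k_def)
    fix f assume f: "nonvanishing_on X f"
    have d: "deg f (p +++ q) = deg f p + deg f q"
      if "lip_path X p" "lip_path X q" "pathfinish p = pathstart q" for p q
      using that by (intro deg_join[OF f]) (auto intro: lip_path_imp_path dest: lip_path_image)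
    have "deg f k = deg f l + (deg f \<tau> + (deg f l' + deg f (reversepath \<tau>)))"
      unfolding k_def using l l' \<tau>e p lip(1,2) by (simp add: d)
    also have "deg f (reversepath \<tau>) = - deg f \<tau>"
      using p by (intro deg_reversepath[OF f]) (auto intro: lip_path_imp_path dest: lip_path_image)
    finally show "deg f k = deg f l + deg f l'" by (simp only: add_ac) simp
  qed
qed

text \<open>A geodesic loop with nonzero degree with respect to maps supported in \<open>M\<close> and in \<open>M'\<close>
  has to travel from \<open>M\<close> to \<open>M'\<close>.\<close>

lemma separated_essential_loops_in_hull:
  assumes M: "openin (top_of_set X) M" "closed (M \<union> {q})" "q \<notin> M"
    and M': "openin (top_of_set X) M'" "closed (M' \<union> {q})" "q \<notin> M'" and "M \<inter> M' = {}" and q: "q \<in> X"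
    and ess: "has_essential_loop X (M \<union> {q})" "has_essential_loop X (M' \<union> {q})"
  shows "q \<in> pi1_hull X"
proof -
  have support: "\<exists>f l. nonvanishing_on X f \<and> lip_path X l \<and> pathfinish l = pathstart l \<and> path_image l \<subseteq> M \<union> {q} \<and>
      deg f l \<noteq> 0 \<and> (\<forall>c. path c \<longrightarrow> path_image c \<subseteq> X - M \<longrightarrow> deg f c = 0)"
    if M: "openin (top_of_set X) M" "closed (M \<union> {q})" "q \<notin> M" and ess: "has_essential_loop X (M \<union> {q})" for M
  proof -
    obtain l f where l: "lip_path X l" "path_image l \<subseteq> M \<union> {q}" "pathfinish l = pathstart l" "nonvanishing_on X f" "deg f l \<noteq> 0"
      using ess by (auto simp: has_essential_loop_def)
    \<comment> \<open>Freezing \<open>f\<close> at \<open>f q\<close> outside \<open>M\<close> keeps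
      it continuous because \<open>M\<close> can be left only through \<open>q\<close>. It now has
      degree 0 on every path off \<open>M\<close>.\<close>
    define g where "g x = (if x \<in> M \<union> {q} then f x else f q)" for x
    have MX: "M \<subseteq> X" using M(1) openin_imp_subset by blast
    have "continuous_on ((M \<union> {q}) \<union> (X - M)) g"
      unfolding g_def
    proof (rule continuous_on_cases)
      have "closedin (top_of_set X) (X - M)" using M(1) by (simp add: closedin_diff)
      then show "closed (X - M)" using compact_imp_closed[OF compact_X] closedin_closed_trans by blast
      show "continuous_on (M \<union> {q}) f" using l(4) MX q by (auto simp: nonvanishing_on_def elim: continuous_on_subset)
    qed (use M in auto)
    moreover have "(M \<union> {q}) \<union> (X - M) = X" using MX q by auto
    ultimately have g: "nonvanishing_on X g"
      using l(4) q by (auto simp: nonvanishing_on_def g_def)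
    have "deg g l = deg f l"
    proof (rule winding_number_cong)
      fix t :: real assume "0 \<le> t" "t \<le> 1"
      then have "l t \<in> path_image l" by (simp add: path_image_def)
      then have "l t \<in> M \<union> {q}" using l(2) by blast
      then show "(g \<circ> l) t = (f \<circ> l) t" by (simp add: g_def)
    qed
    moreover have "deg g c = 0" if "path c" "path_image c \<subseteq> X - M" for c
    proof (rule winding_number_constI[of "f q"])
      show "f q \<noteq> 0" using l(4) q by (simp add: nonvanishing_on_def)
      fix t :: real assume "0 \<le> t" "t \<le> 1"
      then have "c t \<in> path_image c" by (simp add: path_image_def)
      then have "c t \<notin> M" using that(2) by blast
      then show "(g \<circ> c) t = f q" by (simp add: g_def)
    qed
    ultimately show ?thesis using g l by metis
  qed
  obtain f l where f: "nonvanishing_on X f" "lip_path X l" "pathfinish l = pathstart l" "path_image l \<subseteq> M \<union> {q}"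
      "deg f l \<noteq> 0" "\<And>c. \<lbrakk>path c; path_image c \<subseteq> X - M\<rbrakk> \<Longrightarrow> deg f c = 0"
    using support[OF M ess(1)] by blast
  obtain f' l' where f': "nonvanishing_on X f'" "lip_path X l'" "pathfinish l' = pathstart l'" "path_image l' \<subseteq> M' \<union> {q}"
      "deg f' l' \<noteq> 0" "\<And>c. \<lbrakk>path c; path_image c \<subseteq> X - M'\<rbrakk> \<Longrightarrow> deg f' c = 0"
    using support[OF M' ess(2)] by blast
  have sub: "M \<subseteq> X" "M' \<subseteq> X" using M(1) M'(1) openin_imp_subset by blast+
  \<comment> \<open>Each loop runs where the other map is constant, so the loop \<open>k\<close>
    composed of both has nonzero degree under \<open>f\<close> and under \<open>f'\<close>.\<close>
  have "deg f l' = 0" "deg f' l = 0"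
    using f(4) f'(4) sub \<open>M \<inter> M' = {}\<close> M(3) M'(3) q
    by (auto intro!: f(6) f'(6) lip_path_imp_path f f')
  moreover obtain k where k: "lip_path X k" "pathfinish k = pathstart k" "\<And>f. nonvanishing_on X f \<Longrightarrow> deg f k = deg f l + deg f l'"
    using loop_sum[OF f(2,3) f'(2,3)] by metis
  moreover obtain g where g: "geodesic_loop X g" "\<And>f. nonvanishing_on X f \<Longrightarrow> deg f g = deg f k"
    using geodesic_loop_exists[OF compact_X geodesic_X k(1,2)] by metis
  ultimately have dg: "deg f g \<noteq> 0" "deg f' g \<noteq> 0" using f f' by auto
  have pg: "path g" "path_image g \<subseteq> X" using g(1) by (auto simp: geodesic_loop_def)
  have "q \<in> path_image g"
  proof (rule ccontr)
    assume "q \<notin> path_image g"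
    have "path_image g \<inter> M \<noteq> {}" "path_image g \<inter> M' \<noteq> {}" using f(6)[OF pg(1)] f'(6)[OF pg(1)] dg pg(2) by blast+
    moreover have "path_image g \<subseteq> X - {q}" using \<open>q \<notin> path_image g\<close> pg(2) by blast
    ultimately have "path_image g \<subseteq> M" "path_image g \<subseteq> M'"
      using connected_subset_of_clopen[OF connected_path_image[OF pg(1)]] M(1,2) M'(1,2) by metis+
    then show False using \<open>M \<inter> M' = {}\<close> path_image_nonempty[of g] by blast
  qed
  moreover have "\<not> g constant_on {0..1}" using nonconstant_if_deg[OF f(1) pg dg(1)] .
  ultimately show ?thesis using g(1) by (auto simp: pi1_hull_def)
qed

text \<open>Cutting an essential loop near \<open>q\<close> into thin triangles with apex \<open>q\<close> gives a short one.\<close>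

lemma short_essential_loop:
  assumes q: "q \<in> X" and "r > 0" and ess: "has_essential_loop X (X \<inter> ball q r)"
  obtains Z f where "(4 * r)-lipschitz_on {0..1} Z" "path_image Z \<subseteq> X \<inter> ball q r" "Z 0 = q" "Z 1 = q"
    "nonvanishing_on X f" "deg f Z \<noteq> 0"
proof -
  obtain l f where l: "lip_path X l" "path_image l \<subseteq> X \<inter> ball q r" "pathfinish l = pathstart l"
    and f: "nonvanishing_on X f" "deg f l \<noteq> 0"
    using ess by (auto simp: has_essential_loop_def)
  obtain L where L: "L-lipschitz_on {0..1} l" using l(1) by (auto simp: lip_path_def)
  have l01: "l 1 = l 0" using l(3) by (simp add: pathfinish_def pathstart_def)
  have lB: "l t \<in> X" "dist q (l t) < r" if "t \<in> {0..1}" for t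
  proof -
    have "l t \<in> path_image l" using that by (simp add: path_image_def)
    then have "l t \<in> X \<inter> ball q r" using l(2) by blast
    then show "l t \<in> X" "dist q (l t) < r" by auto
  qed
  have "\<exists>c. geodesic_arc X c \<and> c 0 = q \<and> c 1 = x \<and> path_image c \<subseteq> ball q r" if "x \<in> X" "dist q x < r" for x
    using geodesic_arc_in_ball[OF geodesic_X q that] by metis
  then obtain \<gamma> where \<gamma>: "\<And>x. \<lbrakk>x \<in> X; dist q x < r\<rbrakk> \<Longrightarrow>
      geodesic_arc X (\<gamma> x) \<and> \<gamma> x 0 = q \<and> \<gamma> x 1 = x \<and> path_image (\<gamma> x) \<subseteq> ball q r" by metis
  \<comment> \<open>So many pieces that each, rescaled to the unit interval, has Lipschitz constant
    at most \<open>r\<close>, like the geodesics \<sigma> to its ends.\<close>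
  obtain N :: nat where N: "N > 0" "L / real N \<le> r"
  proof -
    obtain N :: nat where N: "L / r < real N" using reals_Archimedean2 by blast
    have "0 \<le> L" using L by (rule lipschitz_on_nonneg)
    then have "0 < real N" using N \<open>r > 0\<close> by (meson divide_nonneg_pos le_less_trans)
    moreover have "L < real N * r" using N \<open>r > 0\<close> by (simp add: divide_less_eq)
    ultimately show thesis by (intro that[of N]) (auto simp: divide_le_eq mult.commute)
  qed
  define \<tau> where "\<tau> i = real i / real N" for i
  have \<tau>: "\<tau> i \<in> {0..1}" if "i \<le> N" for i using that N by (simp add: \<tau>_def)
  define \<sigma> where "\<sigma> i = \<gamma> (l (\<tau> i))" for i
  have \<sigma>: "geodesic_arc X (\<sigma> i)" "pathstart (\<sigma> i) = q" "pathfinish (\<sigma> i) = l (\<tau> i)" "path_image (\<sigma> i) \<subseteq> X \<inter> ball q r"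
    "r-lipschitz_on {0..1} (\<sigma> i)" if "i \<le> N" for i
  proof -
    have *: "geodesic_arc X (\<sigma> i) \<and> \<sigma> i 0 = q \<and> \<sigma> i 1 = l (\<tau> i) \<and> path_image (\<sigma> i) \<subseteq> ball q r"
      unfolding \<sigma>_def using \<tau>[OF that] lB by (intro \<gamma>) auto
    then show "geodesic_arc X (\<sigma> i)" "pathstart (\<sigma> i) = q" "pathfinish (\<sigma> i) = l (\<tau> i)" "path_image (\<sigma> i) \<subseteq> X \<inter> ball q r"
      by (auto simp: pathstart_def pathfinish_def dest: geodesic_arc_image(1))
    show "r-lipschitz_on {0..1} (\<sigma> i)"
      by (rule lipschitz_on_le[of "dist (\<sigma> i 0) (\<sigma> i 1)"])
        (use * lB[OF \<tau>[OF that]] in \<open>auto simp: geodesic_arc_def\<close>)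
  qed
  define s where "s i = subarc (\<tau> i) (\<tau> (Suc i)) l" for i
  have s: "pathstart (s i) = l (\<tau> i)" "pathfinish (s i) = l (\<tau> (Suc i))" "path_image (s i) \<subseteq> X \<inter> ball q r"
    "r-lipschitz_on {0..1} (s i)" if "i < N" for i
  proof -
    have \<tau>': "\<tau> i \<in> {0..1}" "\<tau> (Suc i) \<in> {0..1}" using \<tau> that by simp_all
    show "pathstart (s i) = l (\<tau> i)" "pathfinish (s i) = l (\<tau> (Suc i))" by (auto simp: s_def)
    show "path_image (s i) \<subseteq> X \<inter> ball q r" using path_image_subarc_subset[OF \<tau>', of l] l(2) by (auto simp: s_def)
    have "\<tau> (Suc i) - \<tau> i = 1 / real N" by (simp add: \<tau>_def flip: diff_divide_distrib)
    then have "L * \<bar>\<tau> (Suc i) - \<tau> i\<bar> \<le> r" using N by simp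
    then show "r-lipschitz_on {0..1} (s i)"
      unfolding s_def by (rule lipschitz_on_le[OF lipschitz_on_subarc[OF L \<tau>']])
  qed
  \<comment> \<open>The triangle with apex \<open>q\<close> over piece \<open>i\<close>. Two joins
    each double the constant \<open>r\<close>, whence \<open>4 * r\<close>.\<close>
  define Z where "Z i = (\<sigma> i +++ s i) +++ reversepath (\<sigma> (Suc i))" for i
  have lipX: "lip_path X p" if "r-lipschitz_on {0..1} p" "path_image p \<subseteq> X \<inter> ball q r" for p
    using that by (auto simp: lip_path_def)
  have Z: "(4 * r)-lipschitz_on {0..1} (Z i)" "path_image (Z i) \<subseteq> X \<inter> ball q r" "Z i 0 = q" "Z i 1 = q"
    "deg f (Z i) = deg f (\<sigma> i) + deg f (s i) - deg f (\<sigma> (Suc i))" if i: "i < N" for i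
  proof -
    have i': "i \<le> N" "Suc i \<le> N" using i by auto
    note \<sigma>1 = \<sigma>[OF i'(1)] and \<sigma>2 = \<sigma>[OF i'(2)] and si = s[OF i]
    have "(2 * max r r)-lipschitz_on {0..1} (\<sigma> i +++ s i)"
      using \<sigma>1 si by (intro lipschitz_on_joinpaths) auto
    moreover have rev: "r-lipschitz_on {0..1} (reversepath (\<sigma> (Suc i)))"
      using lipschitz_on_subarc[OF \<sigma>2(5), of 1 0] by (simp add: subarc_1_0)
    ultimately have "(2 * max (2 * max r r) r)-lipschitz_on {0..1} (Z i)"
      unfolding Z_def using \<sigma>1 \<sigma>2 si by (intro lipschitz_on_joinpaths) auto
    then show "(4 * r)-lipschitz_on {0..1} (Z i)" using \<open>r > 0\<close> by (simp add: max_def split: if_splits)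
    show "path_image (Z i) \<subseteq> X \<inter> ball q r"
      unfolding Z_def using \<sigma>1 \<sigma>2 si by (intro subset_path_image_join) auto
    have "pathstart (Z i) = q" "pathfinish (Z i) = q" using \<sigma>1 \<sigma>2 by (auto simp: Z_def)
    then show "Z i 0 = q" "Z i 1 = q" by (auto simp: pathstart_def pathfinish_def)
    have p: "path p" "path_image p \<subseteq> X" if "r-lipschitz_on {0..1} p" "path_image p \<subseteq> X \<inter> ball q r" for p
      using lip_path_imp_path[OF lipX[OF that]] that by auto
    have "deg f (Z i) = deg f (\<sigma> i +++ s i) + deg f (reversepath (\<sigma> (Suc i)))"
      unfolding Z_def using \<sigma>1 \<sigma>2 si p
      by (intro deg_join[OF f(1)] path_join_imp subset_path_image_join) auto
    also have "deg f (\<sigma> i +++ s i) = deg f (\<sigma> i) + deg f (s i)"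
      using \<sigma>1 si p by (intro deg_join[OF f(1)]) auto
    also have "deg f (reversepath (\<sigma> (Suc i))) = - deg f (\<sigma> (Suc i))"
      using \<sigma>2 p by (intro deg_reversepath[OF f(1)]) auto
    finally show "deg f (Z i) = deg f (\<sigma> i) + deg f (s i) - deg f (\<sigma> (Suc i))"
      by (simp only: diff_conv_add_uminus)
  qed
  have pl: "path l" "path_image l \<subseteq> X" using lip_path_imp_path[OF l(1)] l(2) by auto
  \<comment> \<open>The degrees of the triangles add up to that of \<open>l\<close>: the sides
    \<sigma> telescope, and the last equals the first because \<open>l\<close> is closed.\<close>
  have "\<exists>i<N. deg f (Z i) \<noteq> 0"
  proof (rule ccontr)
    assume "\<not> (\<exists>i<N. deg f (Z i) \<noteq> 0)"
    then have zero: "deg f (\<sigma> i) + deg f (s i) = deg f (\<sigma> (Suc i))" if "i < N" for i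
      using Z(5)[OF that] that by (metis right_minus_eq)
    have "deg f (\<sigma> 0) + deg f (subarc 0 (\<tau> n) l) = deg f (\<sigma> n)" if "n \<le> N" for n
      using that
    proof (induction n)
      case 0
      have "deg f (subarc 0 0 l) + deg f (subarc 0 0 l) = deg f (subarc 0 0 l)"
        by (rule deg_subarc_combine[OF f(1) pl]) auto
      then have "deg f (subarc 0 0 l) = 0" by (simp only: add_cancel_left_right)
      moreover have "\<tau> 0 = 0" by (simp add: \<tau>_def)
      ultimately show ?case by (simp only: add_0_right)
    next
      case (Suc n)
      have "deg f (subarc 0 (\<tau> n) l) + deg f (s n) = deg f (subarc 0 (\<tau> (Suc n)) l)"
        unfolding s_def using \<tau>[of n] \<tau>[of "Suc n"] Suc.prems by (intro deg_subarc_combine[OF f(1) pl]) auto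
      then have "deg f (\<sigma> 0) + deg f (subarc 0 (\<tau> (Suc n)) l) = (deg f (\<sigma> 0) + deg f (subarc 0 (\<tau> n) l)) + deg f (s n)"
        by (simp only: add.assoc)
      also have "\<dots> = deg f (\<sigma> n) + deg f (s n)"
        using Suc.IH[OF Suc_leD[OF Suc.prems]] by (simp only:)
      also have "\<dots> = deg f (\<sigma> (Suc n))" using Suc.prems by (intro zero) simp
      finally show ?case .
    qed
    from this[of N] have "deg f (\<sigma> 0) + deg f (subarc 0 (\<tau> N) l) = deg f (\<sigma> N)" by blast
    moreover have "\<tau> N = 1" using N by (simp add: \<tau>_def)
    moreover have "\<sigma> N = \<sigma> 0" using \<open>\<tau> N = 1\<close> l01 by (simp add: \<sigma>_def \<tau>_def)
    ultimately have "deg f (\<sigma> 0) + deg f l = deg f (\<sigma> 0)" by (simp only: subarc_0_1)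
    then show False using f(2) by (simp only: add_cancel_left_right)
  qed
  then obtain i where "i < N" "deg f (Z i) \<noteq> 0" by blast
  then show ?thesis using Z[of i] f(1) by (intro that[of "Z i" f]) auto
qed

text \<open>\<open>F\<close> interpolates between \<open>f\<close> near \<open>q\<close> and 1 far
  away, with zeros possible in between; the perturbation \<open>G\<close> removes them.\<close>

lemma localized_map:
  assumes q: "q \<in> X" and "r > 0" and f: "nonvanishing_on X f"
    and Z: "path Z" "path_image Z \<subseteq> X \<inter> ball q r" "pathfinish Z = pathstart Z"
  obtains G where "nonvanishing_on X G" "\<And>x. x \<in> X - ball q (2 * r) \<Longrightarrow> norm (G x - 1) < 1/2" "deg G Z = deg f Z"
proof -
  have cf: "continuous_on X (\<lambda>x. norm (f x))"
    using f by (auto simp: nonvanishing_on_def intro: continuous_on_norm)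
  obtain x0 where x0: "x0 \<in> X" "\<And>x. x \<in> X \<Longrightarrow> norm (f x0) \<le> norm (f x)"
    using continuous_attains_inf[OF compact_X _ cf] q by blast
  \<comment> \<open>The first bound keeps \<open>G\<close> near 1 off the ball, the second keeps it
    close enough to \<open>f\<close> on \<open>Z\<close> not to change the degree.\<close>
  define e where "e = min (1/2) (norm (f x0))"
  have e: "e > 0" "e \<le> 1/2" "\<And>x. x \<in> X \<Longrightarrow> e \<le> norm (f x)"
    using x0 f by (auto simp: e_def nonvanishing_on_def intro: min.coboundedI2)
  define h where "h x = max 0 (min 1 (2 - dist q x / r))" for x
  define F where "F x = 1 + of_real (h x) * (f x - 1)" for x
  have F1: "F x = 1" if "x \<notin> ball q (2 * r)" for x
  proof -
    have "2 \<le> dist q x / r" using that \<open>r > 0\<close> by (simp add: le_divide_eq)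
    then show ?thesis by (simp add: F_def h_def)
  qed
  have Ff: "F x = f x" if "x \<in> ball q r" for x
  proof -
    have "dist q x / r \<le> 1" using that \<open>r > 0\<close> by (simp add: divide_le_eq)
    then show ?thesis by (simp add: F_def h_def)
  qed
  have "continuous_on X F"
    unfolding F_def h_def using f \<open>r > 0\<close> by (auto simp: nonvanishing_on_def intro!: continuous_intros)
  then obtain G where G: "nonvanishing_on X G" "\<And>x. x \<in> X \<Longrightarrow> norm (G x - F x) < e"
    using one_dim_avoids_zero[OF compact_X dim_X _ e(1)] by metis
  show ?thesis
  proof (rule that[OF G(1)])
    show "norm (G x - 1) < 1/2" if "x \<in> X - ball q (2 * r)" for x
      using G(2)[of x] F1[of x] e(2) that by auto
    have ZX: "path_image Z \<subseteq> X" using Z by auto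
    show "deg G Z = deg f Z"
    proof (rule winding_number_nearby_loops_eq)
      show "path (f \<circ> Z)" "path (G \<circ> Z)" using nonvanishing_path(1) f G(1) Z(1) ZX by blast+
      show "pathfinish (f \<circ> Z) = pathstart (f \<circ> Z)" "pathfinish (G \<circ> Z) = pathstart (G \<circ> Z)"
        using Z(3) by (simp_all add: pathfinish_def pathstart_def)
      fix t :: real assume "t \<in> {0..1}"
      then have "Z t \<in> path_image Z" by (simp add: path_image_def)
      then have "Z t \<in> X" "Z t \<in> ball q r" using Z(2) by blast+
      then show "norm ((G \<circ> Z) t - (f \<circ> Z) t) < norm ((f \<circ> Z) t - 0)"
        using G(2)[of "Z t"] e(3)[of "Z t"] Ff[of "Z t"] by simp
    qed
  qed
qed


text \<open>An infinite product of shrinking essential loops based at \<open>q\<close>.  Factors are dropped so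
  that the degree with respect to each of the localized maps stays nonzero.\<close>

lemma local_essential_loops_in_hull:
  assumes q: "q \<in> X" and ess: "\<And>r. r > 0 \<Longrightarrow> has_essential_loop X (X \<inter> ball q r)"
  shows "q \<in> pi1_hull X"
proof -
  define good where "good r Z \<longleftrightarrow> r-lipschitz_on {0..1} Z \<and> path_image Z \<subseteq> X \<inter> ball q r \<and> Z 0 = q \<and> Z 1 = q" for r Z
  define local where "local r G \<longleftrightarrow> nonvanishing_on X G \<and> (\<forall>x\<in>X - ball q r. norm (G x - 1) < 1/2)" for r G
  have step: "\<exists>Z G. good r Z \<and> local r G \<and> deg G Z \<noteq> 0" if "r > 0" for r
  proof -
    \<comment> \<open>A quarter of the radius absorbs the factor 4 of
      \<open>short_essential_loop\<close> and the factor 2 of \<open>localized_map\<close>.\<close>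
    obtain Z f where Z: "(4 * (r/4))-lipschitz_on {0..1} Z" "path_image Z \<subseteq> X \<inter> ball q (r/4)" "Z 0 = q" "Z 1 = q"
      and f: "nonvanishing_on X f" "deg f Z \<noteq> 0"
      using short_essential_loop[OF q, of "r/4"] ess[of "r/4"] \<open>r > 0\<close> by (metis divide_pos_pos zero_less_numeral)
    have "path Z" "pathfinish Z = pathstart Z"
      using Z by (auto simp: path_def pathfinish_def pathstart_def intro: lipschitz_on_continuous_on)
    then obtain G where "nonvanishing_on X G" "\<And>x. x \<in> X - ball q (2 * (r/4)) \<Longrightarrow> norm (G x - 1) < 1/2" "deg G Z = deg f Z"
      using localized_map[OF q _ f(1) _ Z(2)] \<open>r > 0\<close> by (metis divide_pos_pos zero_less_numeral)
    moreover have "X - ball q r \<subseteq> X - ball q (2 * (r/4))" "ball q (r/4) \<subseteq> ball q r" using \<open>r > 0\<close> by auto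
    ultimately have "good r Z \<and> local r G \<and> deg G Z \<noteq> 0" using Z f unfolding good_def local_def by auto
    then show ?thesis by blast
  qed
  have const: "good r (\<lambda>_. q)" if "r > 0" for r
    using that q by (auto simp: good_def path_image_def intro!: lipschitz_onI)
  \<comment> \<open>State of the construction: radius, newest factor, newest map, and the functional
    \<open>D\<close> giving the degrees of the product of all factors so far.\<close>
  define P where "P n S \<longleftrightarrow> (case S of (r, Z, G, D) \<Rightarrow> 0 < r \<and> r \<le> (1/2)^n \<and> good r Z \<and> local r G \<and> D G \<noteq> 0 \<and>
    (n = 0 \<longrightarrow> D = (\<lambda>f. deg f Z)))"
    for n :: nat and S :: "real \<times> (real \<Rightarrow> 'a) \<times> ('a \<Rightarrow> complex) \<times> (('a \<Rightarrow> complex) \<Rightarrow> complex)"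
  \<comment> \<open>The next ball is so small that \<open>G\<close> stays near \<open>G q\<close> on
    it: every later factor then has degree 0 under \<open>G\<close>, and the nonzero value
    \<open>D G\<close> never changes again.\<close>
  define Q where "Q n S S' \<longleftrightarrow> (case S of (r, Z, G, D) \<Rightarrow> case S' of (r', Z', G', D') \<Rightarrow> r' \<le> r \<and>
    (\<forall>x\<in>X \<inter> ball q r'. norm (G x - G q) < norm (G q)) \<and> D' = (\<lambda>f. D f + deg f Z'))"
    for n :: nat and S S' :: "real \<times> (real \<Rightarrow> 'a) \<times> ('a \<Rightarrow> complex) \<times> (('a \<Rightarrow> complex) \<Rightarrow> complex)"
  have "\<exists>S. \<forall>n. P n (S n) \<and> Q n (S n) (S (Suc n))"
  proof (rule dependent_nat_choice)
    obtain Z G where "good 1 Z" "local 1 G" "deg G Z \<noteq> 0" using step[of 1] by auto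
    then show "\<exists>S. P 0 S" by (intro exI[of _ "(1, Z, G, \<lambda>f. deg f Z)"]) (simp add: P_def)
  next
    fix S n assume PS: "P n S"
    obtain r Z G D where S: "S = (r, Z, G, D)" by (cases S)
    have r: "0 < r" "r \<le> (1/2)^n" "nonvanishing_on X G" using PS by (auto simp: P_def S local_def)
    then have "norm (G q) > 0" "continuous_on X G" using q by (auto simp: nonvanishing_on_def)
    then obtain d where d: "d > 0" "\<And>x. \<lbrakk>x \<in> X; dist x q < d\<rbrakk> \<Longrightarrow> dist (G x) (G q) < norm (G q)"
      using q unfolding continuous_on_iff by metis
    define r' where "r' = min d (r/2)"
    have r': "0 < r'" "r' \<le> (1/2)^Suc n" "r' \<le> r" using r d(1) by (auto simp: r'_def min_def)
    have small: "\<forall>x\<in>X \<inter> ball q r'. norm (G x - G q) < norm (G q)"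
      using d(2) by (auto simp: r'_def dist_norm dist_commute)
    obtain Z1 G1 where Z1: "good r' Z1" "local r' G1" "deg G1 Z1 \<noteq> 0" using step[OF r'(1)] by auto
    have qG1: "deg G1 (\<lambda>_. q) = 0"
      using Z1(2) q by (intro winding_number_constI[of "G1 q"]) (auto simp: local_def nonvanishing_on_def)
    \<comment> \<open>The old product might cancel the new factor under \<open>G1\<close>. If its
      degree is already nonzero, the new factor is dropped; if it is 0, the new factor alone
      decides.\<close>
    define Z' where "Z' = (if D G1 = 0 then Z1 else (\<lambda>_. q))"
    have "D G1 + deg G1 Z' \<noteq> 0"
    proof (cases "D G1 = 0")
      case True
      then have "Z' = Z1" by (simp add: Z'_def)
      then show ?thesis using Z1(3) True by (simp only: add_0_left not_False_eq_True)
    next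
      case False
      then have "Z' = (\<lambda>_. q)" by (simp add: Z'_def)
      then show ?thesis using False qG1 by (simp only: add_0_right not_False_eq_True)
    qed
    moreover have "good r' Z'" using Z1 const[OF r'(1)] by (simp add: Z'_def)
    ultimately show "\<exists>S'. P (Suc n) S' \<and> Q n S S'"
      using r' small Z1(2) by (intro exI[of _ "(r', Z', G1, \<lambda>f. D f + deg f Z')"]) (simp add: P_def Q_def S)
  qed
  then obtain S where S: "\<And>n. P n (S n)" "\<And>n. Q n (S n) (S (Suc n))" by blast
  define r where "r n = fst (S n)" for n
  define Z where "Z n = fst (snd (S n))" for n
  define G where "G n = fst (snd (snd (S n)))" for n
  define D where "D n = snd (snd (snd (S n)))" for n
  have eq: "S n = (r n, Z n, G n, D n)" for n by (simp add: r_def Z_def G_def D_def)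
  have r: "0 < r n" "r n \<le> (1/2)^n" and good: "good (r n) (Z n)" and loc: "local (r n) (G n)" and DG: "D n (G n) \<noteq> 0" for n
    using S(1)[of n] by (simp_all add: P_def eq)
  have D0: "D 0 = (\<lambda>f. deg f (Z 0))" using S(1)[of 0] by (simp add: P_def eq)
  have rS: "r (Suc n) \<le> r n" and near: "\<forall>x\<in>X \<inter> ball q (r (Suc n)). norm (G n x - G n q) < norm (G n q)"
    and DS: "D (Suc n) = (\<lambda>f. D n f + deg f (Z (Suc n)))" for n
    using S(2)[of n] by (simp_all add: Q_def eq)
  have Dsum: "D n f = (\<Sum>i<Suc n. deg f (Z i))" for n f
  proof (induction n)
    case 0
    have "(\<Sum>i<Suc 0. deg f (Z i)) = deg f (Z 0)" by simp
    then show ?case by (simp only: D0)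
  next
    case (Suc n)
    show ?case by (simp only: DS Suc.IH sum.lessThan_Suc)
  qed
  have later: "deg (G n) (Z i) = 0" if "n < i" for n i
  proof -
    have "r i \<le> r (Suc n)" by (rule lift_Suc_antimono_le[of r, OF rS]) (use that in simp)
    then have "ball q (r i) \<subseteq> ball q (r (Suc n))" by (rule subset_ball)
    moreover have "path_image (Z i) \<subseteq> X \<inter> ball q (r i)" using good[of i] by (simp only: good_def)
    ultimately have im: "path_image (Z i) \<subseteq> X \<inter> ball q (r (Suc n))" by blast
    show ?thesis
    proof (rule deg_loop_small[of _ X _ "G n q"])
      show "path (Z i)" "pathfinish (Z i) = pathstart (Z i)"
        using good[of i] lipschitz_on_continuous_on[of "r i" "{0..1}" "Z i"]
        unfolding good_def path_def pathfinish_def pathstart_def by simp_all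
      show "nonvanishing_on X (G n)" using loc by (simp add: local_def)
    qed (use im near[of n] in auto)
  qed
  define c where "c k = nested_join Z q 0 (Suc k)" for k
  have "((1/2)^i)-lipschitz_on {0..1} (Z i)" for i
    using good[of i] lipschitz_on_le[OF _ r(2)[of i]] unfolding good_def by blast
  moreover have "path_image (Z i) \<subseteq> X" "Z i 0 = q" "Z i 1 = q" for i
    using good[of i] unfolding good_def by blast+
  ultimately have "((1/2)^i)-lipschitz_on {0..1} (Z i)" "path_image (Z i) \<subseteq> X" "Z i 0 = q" "Z i 1 = q" for i
    by blast+
  note nj = nested_join[where Z = Z and n = 0, OF q this]
  have c: "2-lipschitz_on {0..1} (c k)" "path_image (c k) \<subseteq> X" "pathfinish (c k) = pathstart (c k)"
    "\<And>f. nonvanishing_on X f \<Longrightarrow> deg f (c k) = (\<Sum>i<Suc k. deg f (Z i))" for k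
    using nj[of "Suc k"] unfolding c_def by simp_all
  obtain \<rho> c' where c': "2-lipschitz_on {0..1} c'" "path_image c' \<subseteq> X" "pathfinish c' = pathstart c'" "strict_mono \<rho>"
    and ev: "\<And>f. nonvanishing_on X f \<Longrightarrow> \<forall>\<^sub>F k in sequentially. deg f (c (\<rho> k)) = deg f c'"
    by (rule limit_loop[where c = c and L = "\<lambda>_. 2" and \<Lambda> = 2, OF compact_X c(1-3) tendsto_const]) blast
  have degG: "deg (G n) c' \<noteq> 0" for n
  proof -
    have Gn: "nonvanishing_on X (G n)" using loc by (simp add: local_def)
    obtain k where k: "k \<ge> n" "deg (G n) (c (\<rho> k)) = deg (G n) c'"
      using eventually_conj[OF eventually_ge_at_top[of n] ev[OF Gn]] by (auto dest: eventually_happens)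
    have "n \<le> \<rho> k" using k(1) seq_suble[OF c'(4), of k] by simp
    then have "(\<Sum>i<Suc n. deg (G n) (Z i)) = (\<Sum>i<Suc (\<rho> k). deg (G n) (Z i))"
      by (intro sum.mono_neutral_left) (auto intro!: later)
    then have "deg (G n) (c (\<rho> k)) = D n (G n)" unfolding c(4)[OF Gn] Dsum by simp
    then show ?thesis using k(2) DG[of n] by simp
  qed
  have "essential_at X q"
    unfolding essential_at_def
  proof (intro exI[of _ c'] conjI allI impI)
    show "lip_path X c'" using c' by (auto simp: lip_path_def)
    show "pathfinish c' = pathstart c'" by (rule c')
    fix s :: real assume "s > 0"
    then obtain n where "(1/2)^n < s" using real_arch_pow_inv[of s "1/2"] by auto
    then have "r n < s" using r(2)[of n] by simp
    then have "ball q (r n) \<subseteq> ball q s" by auto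
    then show "\<exists>f. nonvanishing_on X f \<and> (\<forall>x\<in>X - ball q s. norm (f x - 1) < 1/2) \<and> deg f c' \<noteq> 0"
      using loc[of n] degG[of n] unfolding local_def by blast
  qed
  then show ?thesis by (rule essential_at_in_hull[OF compact_X geodesic_X])
qed

end

subsection \<open>Branches at a point\<close>


text \<open>\<open>t1\<close> is the last visit of \<beta> to \<open>q\<close> and \<open>t2\<close>
  the first later time at distance \<rho>. The piece in between is \<gamma>, and the rest of
  \<beta>, which never returns to \<open>q\<close>, is \<open>S\<close>.\<close>

lemma initial_excursion:
  fixes X :: "'a::metric_space set"
  assumes \<beta>: "lip_path X \<beta>" "\<beta> 0 = q" and \<rho>: "0 < \<rho>" "\<rho> \<le> dist q (\<beta> 1)"
  obtains \<gamma> S where "lip_path X \<gamma>" "\<gamma> 0 = q" "dist q (\<gamma> 1) = \<rho>" "path_image \<gamma> \<subseteq> path_image \<beta>"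
    "path_image \<gamma> \<subseteq> cball q \<rho>" "connected S" "S \<subseteq> X - {q}" "\<gamma> 1 \<in> S" "\<beta> 1 \<in> S"
proof -
  define \<phi> where "\<phi> t = dist q (\<beta> t)" for t
  have c\<beta>: "continuous_on {0..1} \<beta>" using lip_path_imp_path[OF \<beta>(1)] by (simp add: path_def)
  then have c\<phi>: "continuous_on {0..1} \<phi>" unfolding \<phi>_def by (intro continuous_intros)
  have "closed ({0..1} \<inter> \<phi> -` {0})"
    by (rule continuous_closed_preimage[OF c\<phi>]) auto
  then have "compact ({0..1} \<inter> ({0..1} \<inter> \<phi> -` {0}))" by (intro compact_Int_closed) auto
  moreover have "0 \<in> {0..1} \<inter> \<phi> -` {0}" using \<beta>(2) by (simp add: \<phi>_def)
  ultimately obtain t1 where "t1 \<in> {0..1} \<inter> \<phi> -` {0}" "\<forall>t\<in>{0..1} \<inter> \<phi> -` {0}. t \<le> t1"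
    using compact_attains_sup[of "{0..1} \<inter> \<phi> -` {0}"] by (metis Int_assoc Int_absorb empty_iff)
  then have t1: "t1 \<in> {0..1}" "\<phi> t1 = 0" and last: "\<And>t. \<lbrakk>t \<in> {0..1}; \<phi> t = 0\<rbrakk> \<Longrightarrow> t \<le> t1" by auto
  have sub1: "{t1..1} \<subseteq> {0..1}" using t1 by auto
  have "closed ({t1..1} \<inter> \<phi> -` {\<rho>})"
    by (rule continuous_closed_preimage[OF continuous_on_subset[OF c\<phi> sub1]]) auto
  then have "compact ({t1..1} \<inter> ({t1..1} \<inter> \<phi> -` {\<rho>}))" by (intro compact_Int_closed) auto
  then have "compact ({t1..1} \<inter> \<phi> -` {\<rho>})" by (simp add: Int_assoc[symmetric])
  moreover have hit: "\<exists>s. t1 \<le> s \<and> s \<le> t \<and> \<phi> s = \<rho>" if "t \<in> {t1..1}" "\<rho> \<le> \<phi> t" for t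
    using IVT'[of \<phi> t1 \<rho> t] t1 \<rho> that continuous_on_subset[OF c\<phi>, of "{t1..t}"] by auto
  have "{t1..1} \<inter> \<phi> -` {\<rho>} \<noteq> {}" using hit[of 1] t1 \<rho> by (auto simp: \<phi>_def)
  ultimately obtain t2 where "t2 \<in> {t1..1} \<inter> \<phi> -` {\<rho>}" "\<forall>t\<in>{t1..1} \<inter> \<phi> -` {\<rho>}. t2 \<le> t"
    using compact_attains_inf[of "{t1..1} \<inter> \<phi> -` {\<rho>}"] by blast
  then have t2: "t2 \<in> {t1..1}" "\<phi> t2 = \<rho>" and first: "\<And>t. \<lbrakk>t \<in> {t1..1}; \<phi> t = \<rho>\<rbrakk> \<Longrightarrow> t2 \<le> t" by auto
  have below: "\<phi> t \<le> \<rho>" if t: "t \<in> {t1..t2}" for t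
  proof (rule ccontr)
    assume "\<not> \<phi> t \<le> \<rho>"
    then obtain s where "t1 \<le> s" "s \<le> t" "\<phi> s = \<rho>" using hit[of t] t t2 by auto
    moreover have "t2 \<le> s" using first[of s] calculation t t2 by auto
    ultimately have "s = t" using t by auto
    then show False using \<open>\<phi> s = \<rho>\<close> \<open>\<not> \<phi> t \<le> \<rho>\<close> by simp
  qed
  have t2': "t2 \<in> {0..1}" using t1 t2 by auto
  have "t1 \<noteq> t2" using t1 t2 \<rho> by auto
  have img: "path_image (subarc t1 t2 \<beta>) \<subseteq> \<beta> ` {t1..t2}"
  proof -
    have "(t2 - t1) * t + t1 \<in> {t1..t2}" if "t \<in> {0..1}" for t
      using that t2 mult_left_le[of t "t2 - t1"] by auto
    then show ?thesis by (auto simp: path_image_def subarc_def)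
  qed
  show ?thesis
  proof (rule that[of "subarc t1 t2 \<beta>" "\<beta> ` {t2..1}"])
    show "lip_path X (subarc t1 t2 \<beta>)" using \<beta>(1) t1(1) t2' by (rule lip_path_subarc)
    show "subarc t1 t2 \<beta> 0 = q" using t1 by (simp add: subarc_def \<phi>_def)
    show "dist q (subarc t1 t2 \<beta> 1) = \<rho>" using t2 by (simp add: subarc_def \<phi>_def)
    show "path_image (subarc t1 t2 \<beta>) \<subseteq> path_image \<beta>" by (rule path_image_subarc_subset[OF t1(1) t2'])
    show "path_image (subarc t1 t2 \<beta>) \<subseteq> cball q \<rho>" using img below by (auto simp: \<phi>_def)
    show "connected (\<beta> ` {t2..1})"
      by (intro connected_continuous_image continuous_on_subset[OF c\<beta>]) (use t2' in auto)
    have "\<phi> t \<noteq> 0" if "t \<in> {t2..1}" for t using last[of t] that t1 t2 \<open>t1 \<noteq> t2\<close> by auto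
    then have "\<beta> t \<noteq> q" if "t \<in> {t2..1}" for t using that by (auto simp: \<phi>_def)
    moreover have "\<beta> t \<in> X" if "t \<in> {t2..1}" for t
      using lip_path_image[OF \<beta>(1)] that t2' by (auto simp: path_image_def)
    ultimately show "\<beta> ` {t2..1} \<subseteq> X - {q}" by blast
    show "subarc t1 t2 \<beta> 1 \<in> \<beta> ` {t2..1}" "\<beta> 1 \<in> \<beta> ` {t2..1}" using t2 by (auto simp: subarc_def)
  qed
qed

context one_dim_geodesic_space
begin

abbreviation branch :: "'a \<Rightarrow> 'a \<Rightarrow> 'a set" where
  "branch p x \<equiv> connected_component_set (X - {p}) x"

text \<open>All components of \<open>X - {p}\<close> are open, and the complement of
  \<open>branch p x \<union> {p}\<close> is a union of such components.\<close>

lemma branch: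
  assumes "p \<in> X" "x \<in> X" "x \<noteq> p"
  shows "openin (top_of_set X) (branch p x)" "closed (branch p x \<union> {p})" "p \<notin> branch p x"
    "x \<in> branch p x" "branch p x \<subseteq> X"
proof -
  have op: "openin (top_of_set X) (X - {p})" using assms by (intro openin_diff) auto
  show opc: "openin (top_of_set X) (branch p x)"
    by (rule openin_connected_component_geodesic[OF geodesic_X op])
  have sub: "branch p y \<subseteq> X - {p}" for y by (rule connected_component_subset)
  then show "p \<notin> branch p x" "branch p x \<subseteq> X" by blast+
  show "x \<in> branch p x" using assms by (simp add: connected_component_refl)
  have "X - (branch p x \<union> {p}) = \<Union> (branch p ` (X - (branch p x \<union> {p})))"
  proof
    show "X - (branch p x \<union> {p}) \<subseteq> \<Union> (branch p ` (X - (branch p x \<union> {p})))"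
      by (auto intro: connected_component_refl)
    show "\<Union> (branch p ` (X - (branch p x \<union> {p}))) \<subseteq> X - (branch p x \<union> {p})"
    proof
      fix z assume "z \<in> \<Union> (branch p ` (X - (branch p x \<union> {p})))"
      then obtain y where "y \<notin> branch p x \<union> {p}" and z: "z \<in> branch p y" by blast
      moreover have "z \<in> X - {p}" using z sub by blast
      moreover have "z \<notin> branch p x"
      proof
        assume "z \<in> branch p x"
        then have "connected_component (X - {p}) x y"
          using z by (metis connected_component_sym connected_component_trans mem_Collect_eq)
        then show False using \<open>y \<notin> branch p x \<union> {p}\<close> by simp
      qed
      ultimately show "z \<in> X - (branch p x \<union> {p})" by blast
    qed
  qed
  moreover have "openin (top_of_set X) (\<Union> (branch p ` (X - (branch p x \<union> {p}))))"
    using openin_connected_component_geodesic[OF geodesic_X op] by blast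
  ultimately have "openin (top_of_set X) (X - (branch p x \<union> {p}))" by metis
  then have "closedin (top_of_set X) (branch p x \<union> {p})"
    using sub assms(1) by (subst closedin_def) auto
  then show "closed (branch p x \<union> {p})"
    using compact_imp_closed[OF compact_X] closedin_closed_trans by blast
qed

lemma branch_maximal:
  assumes "connected S" "S \<subseteq> X - {p}" "x \<in> S"
  shows "S \<subseteq> branch p x"
  using connected_component_maximal[OF assms(3,1,2)] .

lemma branch_eq: "y \<in> branch p x \<Longrightarrow> branch p y = branch p x"
  using connected_component_eq by fastforce

text \<open>A geodesic reaches its end only at parameter 1, so every earlier point is connected to
  the start off \<open>p\<close>.\<close>

lemma geodesic_to_cut_point:
  assumes \<alpha>: "geodesic_arc X \<alpha>" "\<alpha> 1 = p" and "\<alpha> 0 \<noteq> p"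
  shows "path_image \<alpha> \<subseteq> branch p (\<alpha> 0) \<union> {p}"
proof
  fix v assume "v \<in> path_image \<alpha>"
  then obtain t where t: "t \<in> {0..1}" "v = \<alpha> t" by (auto simp: path_image_def)
  show "v \<in> branch p (\<alpha> 0) \<union> {p}"
  proof (cases "v = p")
    case False
    have arc: "geodesic_arc X (subarc 0 t \<alpha>)" using t by (intro geodesic_arc_subarc[OF \<alpha>(1)]) auto
    have "subarc 0 t \<alpha> u \<noteq> p" if u: "u \<in> {0..1}" for u
    proof
      assume "subarc 0 t \<alpha> u = p"
      then have "\<alpha> (t * u) = \<alpha> 1" using \<alpha>(2) by (simp add: subarc_def)
      moreover have "t * u \<in> {0..1}" using t u by (auto simp: mult_le_one)
      ultimately have "\<bar>t * u - 1\<bar> * dist (\<alpha> 0) (\<alpha> 1) = 0"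
        using geodesic_arc_dist[OF \<alpha>(1), of "t * u" 1] by simp
      then have "t * u = 1" using assms(3) \<alpha>(2) by simp
      moreover have "t * u \<le> t" using t u by (simp add: mult_left_le)
      ultimately have "t = 1" using t by simp
      then show False using False t \<alpha>(2) by simp
    qed
    then have "p \<notin> path_image (subarc 0 t \<alpha>)" unfolding path_image_def by blast
    then have "path_image (subarc 0 t \<alpha>) \<subseteq> X - {p}"
      using geodesic_arc_image(1)[OF arc] by blast
    moreover have "\<alpha> 0 \<in> path_image (subarc 0 t \<alpha>)" "v \<in> path_image (subarc 0 t \<alpha>)"
      using geodesic_arc_image(5,6)[OF arc] t(2) by (auto simp: subarc_def)
    ultimately show ?thesis using branch_maximal[OF geodesic_arc_image(2)[OF arc]] by blast
  qed simp
qed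

text \<open>From outside, \<open>K\<close> is approached through the single point \<open>p\<close>.
  The hypotheses \<open>near\<close> and \<open>uniq\<close> supply the uniqueness that
  \<open>geodesic_retraction\<close> asks for.\<close>

lemma retract_onto_cut_point_side:
  assumes K: "K \<subseteq> X" "closed K" "p \<in> K"
    and near: "\<And>x u. \<lbrakk>x \<in> X - K; u \<in> K; dist x u = infdist x K\<rbrakk> \<Longrightarrow> u = p"
    and uniq: "\<And>x y \<alpha> \<beta>. \<lbrakk>x \<in> X - K; geodesic_arc X \<alpha>; geodesic_arc X \<beta>; \<alpha> 0 = x; \<beta> 0 = x; \<alpha> 1 = p; \<beta> 1 = p;
      y \<in> path_image \<alpha>; y \<notin> path_image \<beta>\<rbrakk> \<Longrightarrow> False"
  shows "deformation_retracts_to X K"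
proof -
  have K0: "K \<noteq> {}" using K by auto
  have nearest: "u = u'" if "x \<in> X" "u \<in> K" "u' \<in> K" "dist x u = infdist x K" "dist x u' = infdist x K" for x u u'
  proof (cases "x \<in> K")
    case True
    then show ?thesis using that by simp
  next
    case False
    then show ?thesis using near[of x u] near[of x u'] that by blast
  qed
  have unique: "y = y'" if h: "x \<in> X" "y \<in> X" "y' \<in> X" "0 \<le> s" "s \<le> 1"
       "dist x y = s * infdist x K" "infdist y K = (1 - s) * infdist x K"
       "dist x y' = s * infdist x K" "infdist y' K = (1 - s) * infdist x K" for x s y y'
  proof (rule ccontr)
    assume "y \<noteq> y'"
    obtain \<alpha> \<beta> where \<alpha>\<beta>: "geodesic_arc X \<alpha>" "geodesic_arc X \<beta>" "\<alpha> 0 = x" "\<beta> 0 = x" "\<alpha> 1 = \<beta> 1" "\<alpha> 1 \<in> K"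
      "dist x (\<alpha> 1) = infdist x K" "y \<in> path_image \<alpha>" "y \<notin> path_image \<beta>" "0 < infdist x K"
      by (rule two_shortest_paths[OF compact_X geodesic_X K(1,2) K0 h(1-3) \<open>y \<noteq> y'\<close> h(4-9)])
        (use nearest[OF h(1)] in blast)+
    then have "x \<in> X - K" using h(1) by auto
    moreover have "\<alpha> 1 = p" using near[OF calculation] \<alpha>\<beta> by blast
    ultimately show False using uniq[of x \<alpha> \<beta> y] \<alpha>\<beta> by metis
  qed
  have "\<exists>F. continuous_on ({0..1} \<times> X) F \<and> F ` ({0..1} \<times> X) \<subseteq> X \<and> (\<forall>x\<in>X. F (0::real, x) = x) \<and>
      (\<forall>x\<in>X. F (1, x) \<in> K \<and> dist x (F (1, x)) = infdist x K) \<and> (\<forall>s\<in>{0..1}. \<forall>x\<in>K. F (s, x) = x)"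
    by (rule geodesic_retraction[OF compact_X geodesic_X K(1,2) K0]) (rule unique; assumption)
  then obtain F where F: "continuous_on ({0..1} \<times> X) F" "F ` ({0..1} \<times> X) \<subseteq> X" "\<forall>x\<in>X. F (0::real, x) = x"
    "\<forall>x\<in>X. F (1, x) \<in> K" "\<forall>s\<in>{0..1}. \<forall>x\<in>K. F (s, x) = x" by blast
  show ?thesis by (rule deformation_retracts_toI[OF K(1) F(1,2)]) (use F in blast)+
qed

text \<open>A geodesic leaving the branch has to pass \<open>p\<close>, so \<open>p\<close> is the
  only nearest point of the complement.\<close>

lemma retract_off_branch:
  assumes p: "p \<in> X" "x0 \<in> X" "x0 \<noteq> p"
    and uniq: "\<And>x y \<alpha> \<beta>. \<lbrakk>x \<in> branch p x0; geodesic_arc X \<alpha>; geodesic_arc X \<beta>; \<alpha> 0 = x; \<beta> 0 = x; \<alpha> 1 = p; \<beta> 1 = p;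
      y \<in> path_image \<alpha>; y \<notin> path_image \<beta>\<rbrakk> \<Longrightarrow> False"
  shows "deformation_retracts_to X (X - branch p x0)"
proof (rule retract_onto_cut_point_side)
  show "X - branch p x0 \<subseteq> X" by blast
  have "closedin (top_of_set X) (X - branch p x0)"
    using branch(1)[OF p] by (simp add: closedin_diff)
  then show "closed (X - branch p x0)"
    using compact_imp_closed[OF compact_X] closedin_closed_trans by blast
  show pK: "p \<in> X - branch p x0" using branch(3)[OF p] p(1) by simp
  fix x
  assume "x \<in> X - (X - branch p x0)"
  then have x: "x \<in> branch p x0" "x \<in> X" by auto
  then have "x \<noteq> p" using branch(3)[OF p] by blast
  show "u = p" if u: "u \<in> X - branch p x0" "dist x u = infdist x (X - branch p x0)" for u
  proof -
    obtain c where c: "geodesic_arc X c" "c 0 = x" "c 1 = u" using geodesic_arc_exists[OF geodesic_X x(2), of u] u(1) by blast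
    have "p \<in> path_image c"
    proof (rule ccontr)
      assume "p \<notin> path_image c"
      then have "path_image c \<subseteq> branch p x"
        using geodesic_arc_image[OF c(1)] c by (intro branch_maximal) auto
      then have "u \<in> branch p x0" using branch_eq[OF x(1)] geodesic_arc_image(6)[OF c(1)] c(3) by auto
      then show False using u(1) by blast
    qed
    then obtain t where t: "t \<in> {0..1}" "c t = p" by (auto simp: path_image_def)
    have "dist x u \<le> dist x p" unfolding u(2) by (rule infdist_le[OF pK])
    moreover have "dist x p = t * dist x u" "dist p u = (1 - t) * dist x u"
      using geodesic_arc_dist[OF c(1), of 0 t] geodesic_arc_dist[OF c(1), of t 1] t c by auto
    moreover have "(1 - t) * dist x u = dist x u - t * dist x u" by (simp add: left_diff_distrib)
    ultimately have "dist p u \<le> 0" by linarith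
    then show ?thesis by simp
  qed
qed (use uniq in blast)

text \<open>Non-contractibility of \<open>X\<close> enters through this lemma. If no branch at
  \<open>q\<close> carries an essential loop, geodesics to \<open>q\<close> are unique and
  \<open>X\<close> contracts along them.\<close>

lemma contractible_if_no_essential_branch:
  assumes q: "q \<in> X" and no: "\<And>x. \<lbrakk>x \<in> X; x \<noteq> q\<rbrakk> \<Longrightarrow> \<not> has_essential_loop X (branch q x \<union> {q})"
  shows "contractible X"
proof -
  have "deformation_retracts_to X {q}"
  proof (rule retract_onto_cut_point_side)
    fix x y \<alpha> \<beta>
    assume x: "x \<in> X - {q}" and \<alpha>\<beta>: "geodesic_arc X \<alpha>" "geodesic_arc X \<beta>" "\<alpha> 0 = x" "\<beta> 0 = x" "\<alpha> 1 = q" "\<beta> 1 = q"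
      "y \<in> path_image \<alpha>" "y \<notin> path_image \<beta>"
    have "has_essential_loop X (branch q x \<union> {q})"
      using geodesic_to_cut_point[of \<alpha> q] geodesic_to_cut_point[of \<beta> q] x \<alpha>\<beta>
      by (intro two_geodesics_essential[OF \<alpha>\<beta>(1) geodesic_arc_lip_path[OF \<alpha>\<beta>(2)] _ _ \<alpha>\<beta>(7,8)]) auto
    then show False using no x by auto
  qed (use q in auto)
  then obtain r where r: "retraction X {q} r" "homotopic_with_canon (\<lambda>h. \<forall>y\<in>{q}. h y = y) X X id r"
    unfolding deformation_retracts_to_def by blast
  have rq: "r x = q" if "x \<in> X" for x using r(1) that by (auto simp: retraction_def)
  have "homotopic_with_canon (\<lambda>_. True) X X id r"
    by (rule homotopic_with_mono[OF r(2)]) auto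
  then have "homotopic_with_canon (\<lambda>_. True) X X (\<lambda>x. x) (\<lambda>_. q)"
    by (rule homotopic_with_eq) (auto simp: rq)
  then show ?thesis unfolding contractible_def id_def by blast
qed

subsection \<open>Retracting away from a point outside the hull\<close>

text \<open>Either some point \<open>p\<close> near \<open>q\<close> cuts off a branch at \<open>q\<close> that meets \<open>branch q y0\<close> only near \<open>q\<close>,
  or geodesics from \<open>q\<close> leave in two directions whose ends can be joined without returning to \<open>q\<close>.\<close>

lemma small_branch_exists:
  assumes q: "q \<in> X" "q \<notin> pi1_hull X" and "R > 0" and no: "\<not> has_essential_loop X (X \<inter> ball q R)"
    and y0: "y0 \<in> X" "R \<le> dist q y0"
  obtains p where "p \<in> branch q y0" "p \<in> X \<inter> ball q R" "branch p q \<inter> branch q y0 \<subseteq> ball q R"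
proof (rule ccontr)
  assume "\<not> thesis"
  have "y0 \<noteq> q" using y0 \<open>R > 0\<close> by auto
  note br = branch[OF q(1) y0(1) this]
  have qM: "S \<subseteq> branch q y0" if "connected S" "S \<subseteq> X - {q}" "S \<inter> branch q y0 \<noteq> {}" for S
    using connected_subset_of_clopen[OF that(1) br(1,2) that(2,3)] .
  define d0 where "d0 = dist q y0"
  have d0: "R \<le> d0" "0 < d0" using y0 \<open>R > 0\<close> by (auto simp: d0_def)
  define \<rho> where "\<rho> = R / 2"
  have \<rho>: "0 < \<rho>" "\<rho> < R" using \<open>R > 0\<close> by (auto simp: \<rho>_def)
  obtain c where c: "geodesic_arc X c" "c 0 = q" "c 1 = y0" by (rule geodesic_arc_exists[OF geodesic_X q(1) y0(1)])
  have cd: "dist q (c t) = t * d0" if "t \<in> {0..1}" for t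
    using geodesic_arc_dist[OF c(1), of 0 t] that c by (simp add: d0_def)
  have cM: "c t \<in> branch q y0" if "t \<in> {0<..1}" for t
  proof -
    have rc: "reversepath c 0 = y0" "reversepath c 1 = q" using c by (simp_all add: reversepath_def)
    have "path_image (reversepath c) \<subseteq> branch q (reversepath c 0) \<union> {q}"
      using rc \<open>y0 \<noteq> q\<close> by (intro geodesic_to_cut_point geodesic_arc_reversepath[OF c(1)]) auto
    then have "path_image c \<subseteq> branch q y0 \<union> {q}" using rc by simp
    moreover have "c t \<in> path_image c" using that by (auto simp: path_image_def)
    moreover have "dist q (c t) \<noteq> 0" using cd[of t] that d0 by auto
    ultimately show ?thesis by auto
  qed
  \<comment> \<open>The ball contains no essential loop and so behaves like a tree: a geodesic lies
    on every Lipschitz path in the ball that joins its ends.\<close>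
  have subset: "path_image \<alpha> \<subseteq> path_image \<beta>"
    if "geodesic_arc X \<alpha>" "lip_path X \<beta>" "\<beta> 0 = \<alpha> 0" "\<beta> 1 = \<alpha> 1" "path_image \<alpha> \<subseteq> ball q R" "path_image \<beta> \<subseteq> ball q R" for \<alpha> \<beta>
  proof
    fix z assume z: "z \<in> path_image \<alpha>"
    show "z \<in> path_image \<beta>"
    proof (rule ccontr)
      assume "z \<notin> path_image \<beta>"
      then have "has_essential_loop X (X \<inter> ball q R)"
        using that z geodesic_arc_image(1)[OF that(1)] lip_path_image[OF that(2)]
        by (intro two_geodesics_essential[OF that(1-4) z]) auto
      then show False using no by blast
    qed
  qed
  \<comment> \<open>The points \<open>p n\<close> approach \<open>q\<close> along \<open>c\<close>
    at distance \<open>R / (n + 2)\<close>; the summand 2 keeps even the first strictly inside the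
    ball.\<close>
  define s where "s n = R / (d0 * real (n + 2))" for n
  have sn: "s n \<in> {0<..1}" "s n * d0 = R / real (n + 2)" "R / real (n + 2) < R" for n
  proof -
    show "s n * d0 = R / real (n + 2)" using d0 by (simp add: s_def)
    show "R / real (n + 2) < R" using \<open>R > 0\<close> by (simp add: divide_less_eq)
    have "R \<le> d0 * real (n + 2)" using d0 mult_left_mono[of 1 "real (n + 2)" d0] by linarith
    then show "s n \<in> {0<..1}" using d0 \<open>R > 0\<close> by (simp add: s_def)
  qed
  define p where "p n = c (s n)" for n
  have dp: "dist q (p n) = R / real (n + 2)" for n using cd[of "s n"] sn[of n] by (simp add: p_def)
  have p: "p n \<in> branch q y0" "p n \<in> X \<inter> ball q R" "p n \<noteq> q" for n
  proof -
    show "p n \<in> branch q y0" using cM sn by (simp add: p_def)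
    then show "p n \<in> X \<inter> ball q R" using br(5) dp[of n] sn(3)[of n] by auto
    show "p n \<noteq> q" using dp[of n] \<open>R > 0\<close> by auto
  qed
  \<comment> \<open>As \<open>p n\<close> is not as desired, \<open>q\<close> can be joined to a far
    point of \<open>branch q y0\<close> around \<open>p n\<close>. The excursion \<gamma> keeps a
    part of that path within radius \<rho>.\<close>
  have "\<exists>y \<gamma>. y \<in> branch q y0 \<and> dist q y = \<rho> \<and> lip_path X \<gamma> \<and> \<gamma> 0 = q \<and> \<gamma> 1 = y \<and>
      path_image \<gamma> \<subseteq> cball q \<rho> \<and> p n \<notin> path_image \<gamma>" for n
  proof -
    have "\<not> branch (p n) q \<inter> branch q y0 \<subseteq> ball q R" using \<open>\<not> thesis\<close> that p by blast
    then obtain w where w: "w \<in> branch (p n) q" "w \<in> branch q y0" "w \<notin> ball q R" by blast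
    have "openin (top_of_set X) (X - {p n})" using p(2)[of n] by (intro openin_diff) auto
    moreover have "connected_component (X - {p n}) q w" using w(1) by simp
    ultimately obtain \<beta> where \<beta>: "lip_path (X - {p n}) \<beta>" "\<beta> 0 = q" "\<beta> 1 = w"
      by (rule lip_path_in_component[OF geodesic_X])
    have \<beta>X: "lip_path X \<beta>" using \<beta>(1) by (auto simp: lip_path_def)
    have "\<rho> \<le> dist q (\<beta> 1)" using w(3) \<beta>(3) \<rho>(2) by auto
    then obtain \<gamma> S where \<gamma>: "lip_path X \<gamma>" "\<gamma> 0 = q" "dist q (\<gamma> 1) = \<rho>" "path_image \<gamma> \<subseteq> path_image \<beta>"
      "path_image \<gamma> \<subseteq> cball q \<rho>" and S: "connected S" "S \<subseteq> X - {q}" "\<gamma> 1 \<in> S" "\<beta> 1 \<in> S"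
      by (rule initial_excursion[OF \<beta>X \<beta>(2) \<rho>(1)])
    have "\<gamma> 1 \<in> branch q y0" using qM[OF S(1,2)] S(3,4) w(2) \<beta>(3) by blast
    moreover have "p n \<notin> path_image \<gamma>" using \<gamma>(4) lip_path_image[OF \<beta>(1)] by blast
    ultimately show ?thesis using \<gamma> by blast
  qed
  then obtain y \<gamma> where y: "\<And>n. y n \<in> branch q y0" "\<And>n. dist q (y n) = \<rho>"
    and \<gamma>: "\<And>n. lip_path X (\<gamma> n)" "\<And>n. \<gamma> n 0 = q" "\<And>n. \<gamma> n 1 = y n" "\<And>n. path_image (\<gamma> n) \<subseteq> cball q \<rho>"
      "\<And>n. p n \<notin> path_image (\<gamma> n)" by metis
  have "\<forall>n. y n \<in> X" using y(1) br(5) by blast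
  then obtain y' k where y': "y' \<in> X" "strict_mono k" "(y \<circ> k) \<longlonglongrightarrow> y'"
    using compact_X unfolding compact_eq_seq_compact_metric seq_compact_def by metis
  have "(\<lambda>n. dist q ((y \<circ> k) n)) \<longlonglongrightarrow> dist q y'" using y'(3) by (intro tendsto_intros)
  then have dy': "dist q y' = \<rho>" using y(2) by (simp add: o_def LIMSEQ_const_iff)
  obtain N where N: "\<And>n. n \<ge> N \<Longrightarrow> dist (y (k n)) y' < \<rho> / 2"
    using metric_LIMSEQ_D[OF y'(3), of "\<rho> / 2"] \<rho> by auto
  \<comment> \<open>The short connections from \<open>y (k n)\<close> to the limit \<open>y'\<close>
    stay away from \<open>q\<close>, hence also from the points \<open>p (k n)\<close> close to
    \<open>q\<close>.\<close>
  have conn: "\<exists>e. geodesic_arc X e \<and> e 0 = y (k n) \<and> e 1 = y' \<and> path_image e \<subseteq> ball q R - cball q (\<rho>/2)" if n: "n \<ge> N" for n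
  proof -
    have "y (k n) \<in> X" using y(1) br(5) by blast
    obtain e where e: "geodesic_arc X e" "e 0 = y (k n)" "e 1 = y'" "path_image e \<subseteq> ball (y (k n)) (\<rho> / 2)"
      by (rule geodesic_arc_in_ball[OF geodesic_X \<open>y (k n) \<in> X\<close> y'(1) N[OF n]])
    have "ball (y (k n)) (\<rho> / 2) \<subseteq> ball q R - cball q (\<rho>/2)"
    proof
      fix z assume z: "z \<in> ball (y (k n)) (\<rho> / 2)"
      have "dist q z \<le> dist q (y (k n)) + dist (y (k n)) z" "dist q (y (k n)) \<le> dist q z + dist z (y (k n))"
        by (rule dist_triangle)+
      then have "dist q z < R" "\<rho> / 2 < dist q z"
        using z y(2)[of "k n"] \<open>R > 0\<close> by (auto simp: dist_commute \<rho>_def)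
      then show "z \<in> ball q R - cball q (\<rho>/2)" by simp
    qed
    then show ?thesis using e by blast
  qed
  have "y' \<in> branch q y0"
  proof -
    obtain e where e: "geodesic_arc X e" "e 0 = y (k N)" "e 1 = y'" "path_image e \<subseteq> ball q R - cball q (\<rho>/2)"
      using conn[of N] by blast
    have "path_image e \<subseteq> branch q y0"
    proof (rule qM)
      show "connected (path_image e)" by (rule geodesic_arc_image(2)[OF e(1)])
      have "q \<in> cball q (\<rho>/2)" using \<rho>(1) by simp
      then show "path_image e \<subseteq> X - {q}" using geodesic_arc_image(1)[OF e(1)] e(4) by blast
      show "path_image e \<inter> branch q y0 \<noteq> {}" using geodesic_arc_image(5)[OF e(1)] e(2) y(1) by fastforce
    qed
    then show ?thesis using geodesic_arc_image(6)[OF e(1)] e(3) by blast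
  qed
  obtain \<alpha> where \<alpha>: "geodesic_arc X \<alpha>" "\<alpha> 0 = q" "\<alpha> 1 = y'" by (rule geodesic_arc_exists[OF geodesic_X q(1) y'(1)])
  have \<alpha>d: "dist q (\<alpha> t) = t * \<rho>" if "t \<in> {0..1}" for t
    using geodesic_arc_dist[OF \<alpha>(1), of 0 t] that \<alpha> dy' by simp
  have \<alpha>B: "path_image \<alpha> \<subseteq> ball q R"
  proof
    fix z assume "z \<in> path_image \<alpha>"
    then obtain t where t: "t \<in> {0..1}" "z = \<alpha> t" by (auto simp: path_image_def)
    have "t * \<rho> \<le> 1 * \<rho>" using t \<rho> by (intro mult_right_mono) auto
    then have "dist q z < R" unfolding t(2) using \<alpha>d[OF t(1)] \<rho> by linarith
    then show "z \<in> ball q R" by simp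
  qed
  \<comment> \<open>By treelikeness \<alpha> lies on the path \<open>\<gamma> (k n)\<close> followed
    by \<open>e\<close>, and both avoid \<open>p (k n)\<close>.\<close>
  have p\<alpha>: "p (k n) \<notin> path_image \<alpha>" if n: "n \<ge> N" "dist q (p (k n)) \<le> \<rho> / 2" for n
  proof -
    obtain e where e: "geodesic_arc X e" "e 0 = y (k n)" "e 1 = y'" "path_image e \<subseteq> ball q R - cball q (\<rho>/2)"
      using conn[OF n(1)] by blast
    have "path_image \<alpha> \<subseteq> path_image (\<gamma> (k n) +++ e)"
    proof (rule subset[OF \<alpha>(1) _ _ _ \<alpha>B])
      have ends: "pathfinish (\<gamma> (k n)) = pathstart e" using \<gamma>(3) e(2) by (simp add: pathfinish_def pathstart_def)
      then show "lip_path X (\<gamma> (k n) +++ e)" by (intro lip_path_join \<gamma> geodesic_arc_lip_path[OF e(1)])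
      show "(\<gamma> (k n) +++ e) 0 = \<alpha> 0" "(\<gamma> (k n) +++ e) 1 = \<alpha> 1"
        using \<gamma>(2) e(3) \<alpha> by (auto simp: joinpaths_def)
      have "cball q \<rho> \<subseteq> ball q R" using \<rho> by auto
      then show "path_image (\<gamma> (k n) +++ e) \<subseteq> ball q R"
        using \<gamma>(4)[of "k n"] e(4) by (intro subset_path_image_join) blast+
    qed
    also have "\<dots> \<subseteq> path_image (\<gamma> (k n)) \<union> path_image e" by (rule path_image_join_subset)
    finally have "path_image \<alpha> \<subseteq> path_image (\<gamma> (k n)) \<union> path_image e" .
    moreover have "p (k n) \<notin> path_image e" using e(4) n(2) by auto
    ultimately show ?thesis using \<gamma>(5)[of "k n"] by blast
  qed
  have "connected_component (X - {q}) y0 y'" using \<open>y' \<in> branch q y0\<close> by simp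
  moreover have "openin (top_of_set X) (X - {q})" using q by (intro openin_diff) auto
  ultimately obtain \<beta> where \<beta>: "lip_path (X - {q}) \<beta>" "\<beta> 0 = y0" "\<beta> 1 = y'"
    using lip_path_in_component[OF geodesic_X] by metis
  have \<beta>X: "lip_path X \<beta>" "q \<notin> path_image \<beta>" using \<beta>(1) by (auto simp: lip_path_def)
  have "closed (path_image \<beta>)" using lip_path_imp_path[OF \<beta>(1)] by (simp add: closed_path_image)
  then obtain \<eta> where \<eta>: "\<eta> > 0" "ball q \<eta> \<subseteq> - path_image \<beta>"
    using \<beta>X(2) open_Compl[of "path_image \<beta>"] by (meson ComplI open_contains_ball)
  \<comment> \<open>Another path from \<open>q\<close> to \<open>y'\<close>: out along
    \<open>c\<close>, then on to \<open>y'\<close> without touching \<open>q\<close>. Near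
    \<open>q\<close> it consists of \<open>c\<close> alone.\<close>
  define \<delta> where "\<delta> = c +++ \<beta>"
  have ends: "pathfinish c = pathstart \<beta>" using c(3) \<beta>(2) by (simp add: pathfinish_def pathstart_def)
  have \<delta>: "lip_path X \<delta>" "\<delta> 0 = \<alpha> 0" "\<delta> 1 = \<alpha> 1" "path_image \<delta> = path_image c \<union> path_image \<beta>"
  proof -
    show "lip_path X \<delta>" unfolding \<delta>_def by (intro lip_path_join geodesic_arc_lip_path[OF c(1)] \<beta>X(1) ends)
    show "\<delta> 0 = \<alpha> 0" "\<delta> 1 = \<alpha> 1" using c(2) \<beta>(3) \<alpha> by (auto simp: \<delta>_def joinpaths_def)
    show "path_image \<delta> = path_image c \<union> path_image \<beta>" unfolding \<delta>_def by (rule path_image_join[OF ends])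
  qed
  \<comment> \<open>If \<alpha> met \<open>c\<close> again, the part of \<open>c\<close> before the
    meeting point would lie on \<alpha> by treelikeness, including points \<open>p (k n)\<close>
    close to \<open>q\<close>.\<close>
  have \<alpha>c: "\<alpha> t \<notin> path_image c" if t: "t \<in> {0<..1}" for t
  proof
    assume "\<alpha> t \<in> path_image c"
    then obtain u where u: "u \<in> {0..1}" "c u = \<alpha> t" by (auto simp: path_image_def)
    have ud: "u * d0 = t * \<rho>" using cd[OF u(1)] \<alpha>d[of t] t u(2) by simp
    have "t * \<rho> > 0" using t \<rho> by simp
    define \<epsilon> where "\<epsilon> = min (\<rho> / 2) (t * \<rho>)"
    have "\<epsilon> > 0" using \<rho> \<open>t * \<rho> > 0\<close> by (simp add: \<epsilon>_def)
    obtain n0 :: nat where "R / \<epsilon> < real n0" using reals_Archimedean2 by blast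
    define n where "n = max n0 N"
    have "R / \<epsilon> < real (k n + 2)" using \<open>R / \<epsilon> < real n0\<close> seq_suble[OF y'(2), of n] by (simp add: n_def)
    then have small: "R / real (k n + 2) < \<epsilon>" using \<open>\<epsilon> > 0\<close> by (simp add: divide_less_eq mult.commute)
    have "s (k n) * d0 \<le> u * d0" using small sn(2)[of "k n"] ud by (simp add: \<epsilon>_def)
    then have su: "s (k n) \<le> u" using d0 by simp
    have arcs: "geodesic_arc X (subarc 0 u c)" "geodesic_arc X (subarc 0 t \<alpha>)"
      using u t by (auto intro!: geodesic_arc_subarc c(1) \<alpha>(1))
    have "path_image (subarc 0 u c) \<subseteq> path_image (subarc 0 t \<alpha>)"
    proof (rule subset[OF arcs(1) geodesic_arc_lip_path[OF arcs(2)]])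
      show "subarc 0 t \<alpha> 0 = subarc 0 u c 0" "subarc 0 t \<alpha> 1 = subarc 0 u c 1"
        using c \<alpha> u by (auto simp: subarc_def)
      show "path_image (subarc 0 t \<alpha>) \<subseteq> ball q R"
        using path_image_subarc_subset[of 0 t \<alpha>] t \<alpha>B by fastforce
      show "path_image (subarc 0 u c) \<subseteq> ball q R"
      proof
        fix z assume "z \<in> path_image (subarc 0 u c)"
        then obtain v where v: "v \<in> {0..1}" "z = c (u * v)" by (auto simp: path_image_def subarc_def)
        have "u * v \<in> {0..1}" using u v by (auto simp: mult_le_one)
        then have "dist q z = v * (u * d0)" using cd[of "u * v"] v by simp
        also have "\<dots> \<le> t * \<rho>" unfolding ud using v \<open>t * \<rho> > 0\<close> by (intro mult_left_le_one_le) auto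
        also have "\<dots> \<le> \<rho>" using t \<rho> by (intro mult_left_le_one_le) auto
        finally show "z \<in> ball q R" using \<rho> by simp
      qed
    qed
    moreover have "p (k n) \<in> path_image (subarc 0 u c)"
    proof -
      have "u > 0" using su sn(1)[of "k n"] by auto
      then have "subarc 0 u c (s (k n) / u) = p (k n)" "s (k n) / u \<in> {0..1}"
        using su sn(1)[of "k n"] by (auto simp: subarc_def p_def)
      then show ?thesis unfolding path_image_def by force
    qed
    moreover have "path_image (subarc 0 t \<alpha>) \<subseteq> path_image \<alpha>" using t by (intro path_image_subarc_subset) auto
    ultimately have "p (k n) \<in> path_image \<alpha>" by blast
    moreover have "dist q (p (k n)) \<le> \<rho> / 2" using dp[of "k n"] small by (simp add: \<epsilon>_def)
    ultimately show False using p\<alpha>[of n] by (simp add: n_def)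
  qed
  have "essential_at X q"
    unfolding essential_at_def
  proof (intro exI[of _ "\<alpha> +++ reversepath \<delta>"] conjI allI impI)
    have e1: "pathfinish \<alpha> = pathstart (reversepath \<delta>)" "pathfinish (reversepath \<delta>) = pathstart \<alpha>"
      using \<delta>(2,3) by (simp_all add: pathstart_def pathfinish_def reversepath_def)
    show "lip_path X (\<alpha> +++ reversepath \<delta>)"
      by (intro lip_path_join lip_path_reversepath geodesic_arc_lip_path[OF \<alpha>(1)] \<delta>(1) e1)
    show "pathfinish (\<alpha> +++ reversepath \<delta>) = pathstart (\<alpha> +++ reversepath \<delta>)"
      using e1(2) by (metis pathfinish_join pathstart_join)
    fix r :: real assume "r > 0"
    \<comment> \<open>\<open>\<alpha> t\<close> is so close to \<open>q\<close> that it misses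
      \<beta> and that a bump of radius \<open>r/2\<close> around it is supported in
      \<open>ball q r\<close>.\<close>
    define t where "t = min 1 (min (\<eta> / (2 * \<rho>)) (r / (2 * \<rho>)))"
    have t: "t \<in> {0<..1}" using \<eta> \<open>r > 0\<close> \<rho> by (auto simp: t_def)
    have "t * \<rho> \<le> \<eta> / (2 * \<rho>) * \<rho>" "t * \<rho> \<le> r / (2 * \<rho>) * \<rho>"
      using \<rho> by (intro mult_right_mono; simp add: t_def)+
    then have tr: "t * \<rho> < \<eta>" "t * \<rho> \<le> r / 2" using \<rho> \<eta>(1) by (auto simp: field_simps)
    have d\<alpha>: "dist q (\<alpha> t) = t * \<rho>" using \<alpha>d t by simp
    have "\<alpha> t \<in> path_image \<alpha>" using t by (auto simp: path_image_def)
    moreover have "\<alpha> t \<in> ball q \<eta>" using tr(1) d\<alpha> by simp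
    then have "\<alpha> t \<notin> path_image \<beta>" using \<eta>(2) by blast
    then have "\<alpha> t \<notin> path_image \<delta>" using \<alpha>c[OF t] \<delta>(4) by blast
    ultimately obtain f where f: "nonvanishing_on X f" "\<And>x. x \<in> X - ball (\<alpha> t) (r/2) \<Longrightarrow> norm (f x - 1) < 1/2"
      "deg f (\<alpha> +++ reversepath \<delta>) \<noteq> 0"
      using bump_map[OF compact_X dim_X \<alpha>(1) lip_path_imp_path[OF \<delta>(1)] lip_path_image[OF \<delta>(1)] \<delta>(2,3), of "\<alpha> t" "r/2"]
        \<open>r > 0\<close> by (metis half_gt_zero)
    have "ball (\<alpha> t) (r/2) \<subseteq> ball q r"
    proof
      fix z assume "z \<in> ball (\<alpha> t) (r/2)"
      then show "z \<in> ball q r" using dist_triangle[of q z "\<alpha> t"] d\<alpha> tr(2) by simp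
    qed
    then have "norm (f x - 1) < 1/2" if "x \<in> X - ball q r" for x using f(2)[of x] that by blast
    then show "\<exists>f. nonvanishing_on X f \<and> (\<forall>x\<in>X - ball q r. norm (f x - 1) < 1/2) \<and> deg f (\<alpha> +++ reversepath \<delta>) \<noteq> 0"
      using f(1,3) by blast
  qed
  then show False using essential_at_in_hull[OF compact_X geodesic_X] q(2) by blast
qed


text \<open>At \<open>q\<close> only \<open>branch q x0\<close> carries essential loops, and small
  loops are inessential. \<open>branch p q\<close> consists of \<open>q\<close>, a part of
  \<open>branch q x0\<close> inside the ball, and points of other branches at \<open>q\<close>. So
  distinct geodesics from one of its points to \<open>p\<close> are impossible, and
  \<open>retract_off_branch\<close> removes it together with \<open>q\<close>.\<close>

lemma retract_avoiding:
  assumes nc: "\<not> contractible X" and q: "q \<in> X" "q \<notin> pi1_hull X"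
  shows "\<exists>Y\<subseteq>X. deformation_retracts_to X Y \<and> q \<notin> Y"
proof -
  obtain R where R: "R > 0" "\<not> has_essential_loop X (X \<inter> ball q R)"
    using local_essential_loops_in_hull[OF q(1)] q(2) by blast
  have notlocal: "\<not> has_essential_loop X A" if "A \<subseteq> X \<inter> ball q R" for A
    using has_essential_loop_mono[OF _ that] R(2) by blast
  obtain x0 where x0: "x0 \<in> X" "x0 \<noteq> q" "has_essential_loop X (branch q x0 \<union> {q})"
    using contractible_if_no_essential_branch[OF q(1)] nc by blast
  note br0 = branch[OF q(1) x0(1,2)]
  have other: "\<not> has_essential_loop X (branch q x \<union> {q})" if x: "x \<in> X" "x \<noteq> q" "x \<notin> branch q x0" for x
  proof
    assume "has_essential_loop X (branch q x \<union> {q})"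
    moreover note br = branch[OF q(1) x(1,2)]
    have "branch q x0 \<inter> branch q x = {}"
    proof (rule ccontr)
      assume "branch q x0 \<inter> branch q x \<noteq> {}"
      then have "branch q x0 = branch q x" using branch_eq by blast
      then show False using br(4) x(3) by simp
    qed
    ultimately show False
      using separated_essential_loops_in_hull[OF br0(1-3) br(1-3) _ q(1) x0(3)] q(2) by blast
  qed
  have "\<not> branch q x0 \<union> {q} \<subseteq> X \<inter> ball q R" using notlocal x0(3) by blast
  moreover have "q \<in> X \<inter> ball q R" using q(1) R(1) by simp
  ultimately obtain y0 where y0: "y0 \<in> branch q x0" "y0 \<notin> ball q R" using br0(5) by blast
  then have y0': "y0 \<in> X" "R \<le> dist q y0" "y0 \<noteq> q" using br0(3,5) by auto
  have y0x0: "branch q y0 = branch q x0" by (rule branch_eq[OF y0(1)])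
  obtain p where p: "p \<in> branch q x0" "p \<in> X \<inter> ball q R" "branch p q \<inter> branch q x0 \<subseteq> ball q R"
    using small_branch_exists[OF q R y0'(1,2)] unfolding y0x0 by blast
  have pq: "p \<in> X" "p \<noteq> q" using p br0(3) by auto
  note brp = branch[OF pq(1) q(1) pq(2)[symmetric]]
  have near: "A \<subseteq> X \<inter> ball q R" if "A \<subseteq> branch p q \<union> {p}" "A \<subseteq> branch q x0 \<union> {q}" for A
  proof -
    have "A \<subseteq> (branch p q \<inter> branch q x0) \<union> {p, q}" using that by blast
    moreover have "branch p q \<inter> branch q x0 \<subseteq> X" using br0(5) by blast
    ultimately show ?thesis using p(2,3) q(1) R(1) by fastforce
  qed
  have "deformation_retracts_to X (X - branch p q)"
  proof (rule retract_off_branch[OF pq(1) q(1) pq(2)[symmetric]])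
    fix x y \<alpha> \<beta>
    assume x: "x \<in> branch p q"
      and \<alpha>: "geodesic_arc X \<alpha>" "\<alpha> 0 = x" "\<alpha> 1 = p" and \<beta>: "geodesic_arc X \<beta>" "\<beta> 0 = x" "\<beta> 1 = p"
      and y: "y \<in> path_image \<alpha>" "y \<notin> path_image \<beta>"
    have "x \<noteq> p" using x brp(3) by blast
    have "x \<in> X" using x brp(5) by blast
    have im: "path_image \<alpha> \<subseteq> branch p q \<union> {p}" "path_image \<beta> \<subseteq> branch p q \<union> {p}"
      using geodesic_to_cut_point[OF \<alpha>(1,3)] geodesic_to_cut_point[OF \<beta>(1,3)] \<alpha>(2) \<beta>(2) \<open>x \<noteq> p\<close> branch_eq[OF x] by auto
    have ess: "has_essential_loop X A"
      if "geodesic_arc X \<alpha>'" "geodesic_arc X \<beta>'" "\<alpha>' 0 = \<beta>' 0" "\<alpha>' 1 = \<beta>' 1" "y \<in> path_image \<alpha>'" "y \<notin> path_image \<beta>'"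
        "path_image \<alpha>' \<subseteq> A" "path_image \<beta>' \<subseteq> A" for \<alpha>' \<beta>' A
      using that by (intro two_geodesics_essential[OF that(1) geodesic_arc_lip_path[OF that(2)] _ _ that(5,6)]) auto
    \<comment> \<open>If only one of two geodesics with common ends passes \<open>q\<close>, the
      other shows that \<open>q\<close> is essential, hence in the hull.\<close>
    have not_one: False
      if "geodesic_arc X \<alpha>'" "geodesic_arc X \<beta>'" "\<alpha>' 0 = \<beta>' 0" "\<alpha>' 1 = \<beta>' 1" "q \<in> path_image \<alpha>'" "q \<notin> path_image \<beta>'"
      for \<alpha>' \<beta>'
    proof -
      have "essential_at X q"
        using that geodesic_arc_image[OF that(2)]
        by (intro essential_at_geodesic[OF compact_X dim_X geodesic_X that(1,5), of "path_image \<beta>'"]) auto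
      then show False using essential_at_in_hull[OF compact_X geodesic_X] q(2) by blast
    qed
    consider "q \<notin> path_image \<alpha>" "q \<notin> path_image \<beta>" | "q \<in> path_image \<alpha>" "q \<in> path_image \<beta>"
      using not_one[OF \<alpha>(1) \<beta>(1)] not_one[OF \<beta>(1) \<alpha>(1)] \<alpha> \<beta> by metis
    then show False
    proof cases
      case 1
      have "S \<subseteq> branch q x0" if "connected S" "S \<subseteq> X - {q}" "p \<in> S" for S
        using connected_subset_of_clopen[OF that(1) br0(1,2) that(2)] p(1) that(3) by blast
      then have sub: "path_image \<alpha> \<subseteq> branch q x0" "path_image \<beta> \<subseteq> branch q x0"
        using 1 geodesic_arc_image[OF \<alpha>(1)] geodesic_arc_image[OF \<beta>(1)] \<alpha>(3) \<beta>(3) by auto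
      have "has_essential_loop X (path_image \<alpha> \<union> path_image \<beta>)"
        using \<alpha> \<beta> y by (intro ess[of \<alpha> \<beta>]) auto
      moreover have "path_image \<alpha> \<union> path_image \<beta> \<subseteq> X \<inter> ball q R"
        using sub im by (intro near) auto
      ultimately show False using notlocal by blast
    next
      case 2
      define d where "d = dist x p"
      have "d > 0" using \<open>x \<noteq> p\<close> by (simp add: d_def)
      have \<alpha>d: "dist x (\<alpha> t) = t * d" and \<beta>d: "dist x (\<beta> t) = t * d" if "t \<in> {0..1}" for t
        using geodesic_arc_dist[OF \<alpha>(1), of 0 t] geodesic_arc_dist[OF \<beta>(1), of 0 t] that \<alpha> \<beta> by (auto simp: d_def)
      obtain t where t: "t \<in> {0..1}" "\<alpha> t = q" using 2(1) by (auto simp: path_image_def)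
      obtain t' where t': "t' \<in> {0..1}" "\<beta> t' = q" using 2(2) by (auto simp: path_image_def)
      \<comment> \<open>Both geodesics reach \<open>q\<close> at the same parameter. Cutting there
        gives two pairs of arcs, and \<open>y\<close> tells the members of one pair apart.\<close>
      have "t * d = t' * d" using \<alpha>d[OF t(1)] \<beta>d[OF t'(1)] t t' by simp
      then have \<beta>t: "\<beta> t = q" using t' \<open>d > 0\<close> by simp
      obtain s where s: "s \<in> {0..1}" "\<alpha> s = y" using y(1) by (auto simp: path_image_def)
      have "s \<noteq> t" using s(2) t(2) 2(2) y(2) by metis
      have notin: "y \<notin> path_image (subarc u v \<beta>)" if "u \<in> {0..1}" "v \<in> {0..1}" for u v
        using path_image_subarc_subset[OF that, of \<beta>] y(2) by blast
      have subim: "path_image (subarc u v \<alpha>) \<union> path_image (subarc u v \<beta>) \<subseteq> branch p q \<union> {p}"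
        if "u \<in> {0..1}" "v \<in> {0..1}" for u v
        using path_image_subarc_subset[OF that, of \<alpha>] path_image_subarc_subset[OF that, of \<beta>] im by blast
      have yin: "y \<in> path_image (subarc u v \<alpha>)" if "u \<le> s" "s \<le> v" "u < v" for u v
      proof -
        have "y = subarc u v \<alpha> ((s - u) / (v - u))" using that s by (simp add: subarc_def)
        moreover have "(s - u) / (v - u) \<in> {0..1}" using that by simp
        ultimately show ?thesis unfolding path_image_def by blast
      qed
      show False
      proof (cases "s < t")
        case True
        define \<alpha>' where "\<alpha>' = subarc 0 t \<alpha>"
        define \<beta>' where "\<beta>' = subarc 0 t \<beta>"
        have arcs: "geodesic_arc X \<alpha>'" "geodesic_arc X \<beta>'"
          using t by (auto simp: \<alpha>'_def \<beta>'_def intro!: geodesic_arc_subarc \<alpha>(1) \<beta>(1))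
        have ends: "\<alpha>' 0 = x" "\<beta>' 0 = x" "\<alpha>' 1 = q" "\<beta>' 1 = q"
          using \<alpha> \<beta> t \<beta>t by (auto simp: \<alpha>'_def \<beta>'_def subarc_def)
        have yy: "y \<in> path_image \<alpha>'" "y \<notin> path_image \<beta>'"
          using yin[of 0 t] notin[of 0 t] s t True by (auto simp: \<alpha>'_def \<beta>'_def)
        have "x \<noteq> q" using \<alpha>d[OF t(1)] t True s \<open>d > 0\<close> by auto
        then have imq: "path_image \<alpha>' \<subseteq> branch q x \<union> {q}" "path_image \<beta>' \<subseteq> branch q x \<union> {q}"
          using geodesic_to_cut_point[OF arcs(1) ends(3)] geodesic_to_cut_point[OF arcs(2) ends(4)] ends by auto
        \<comment> \<open>The pair from \<open>x\<close> to \<open>q\<close> lies in the ball if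
          \<open>x\<close> belongs to \<open>branch q x0\<close>, and otherwise in a branch at
          \<open>q\<close> that \<open>other\<close> excludes.\<close>
        show False
        proof (cases "x \<in> branch q x0")
          case True
          have "path_image \<alpha>' \<union> path_image \<beta>' \<subseteq> branch p q \<union> {p}"
            unfolding \<alpha>'_def \<beta>'_def by (rule subim) (use t in auto)
          then have "path_image \<alpha>' \<union> path_image \<beta>' \<subseteq> X \<inter> ball q R"
            using near[of "path_image \<alpha>' \<union> path_image \<beta>'"] imq unfolding branch_eq[OF True] by blast
          then show False
            using notlocal ess[OF arcs _ _ yy Un_upper1 Un_upper2] ends by metis
        next
          case False
          have "has_essential_loop X (branch q x \<union> {q})"
            by (rule ess[OF arcs _ _ yy imq]) (simp_all add: ends)
          then show False using other \<open>x \<in> X\<close> \<open>x \<noteq> q\<close> False by blast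
        qed
      next
        case False
        then have "t < s" using \<open>s \<noteq> t\<close> by simp
        \<comment> \<open>Traversed backwards, from \<open>p\<close> to \<open>q\<close>, so that
          \<open>geodesic_to_cut_point\<close> applies with end \<open>q\<close>.\<close>
        define \<alpha>' where "\<alpha>' = subarc 1 t \<alpha>"
        define \<beta>' where "\<beta>' = subarc 1 t \<beta>"
        have arcs: "geodesic_arc X \<alpha>'" "geodesic_arc X \<beta>'"
          using t by (auto simp: \<alpha>'_def \<beta>'_def intro!: geodesic_arc_subarc \<alpha>(1) \<beta>(1))
        have ends: "\<alpha>' 0 = p" "\<beta>' 0 = p" "\<alpha>' 1 = q" "\<beta>' 1 = q"
          using \<alpha> \<beta> t \<beta>t by (auto simp: \<alpha>'_def \<beta>'_def subarc_def)
        have "y = \<alpha>' ((s - 1) / (t - 1))" "(s - 1) / (t - 1) \<in> {0..1}"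
          using s t \<open>t < s\<close> by (auto simp: \<alpha>'_def subarc_def divide_simps)
        then have yy: "y \<in> path_image \<alpha>'" "y \<notin> path_image \<beta>'"
          using notin[of 1 t] t by (auto simp: \<beta>'_def path_image_def)
        have imq: "path_image \<alpha>' \<union> path_image \<beta>' \<subseteq> branch q x0 \<union> {q}"
          using geodesic_to_cut_point[OF arcs(1) ends(3)] geodesic_to_cut_point[OF arcs(2) ends(4)] ends pq(2) branch_eq[OF p(1)] by auto
        have "path_image \<alpha>' \<union> path_image \<beta>' \<subseteq> branch p q \<union> {p}"
          unfolding \<alpha>'_def \<beta>'_def by (rule subim) (use t in auto)
        then have "path_image \<alpha>' \<union> path_image \<beta>' \<subseteq> X \<inter> ball q R" using imq by (rule near)
        then show False
          using notlocal ess[OF arcs _ _ yy Un_upper1 Un_upper2] ends by metis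
      qed
    qed
  qed
  moreover have "q \<notin> X - branch p q" using brp(4) by blast
  ultimately show ?thesis by blast
qed

end

theorem corollary3p12:
  fixes X X\<^sub>0 :: "'a::metric_space set"
  assumes "compact X"
    and "has_covering_dim (top_of_set X) 1"
    and "geodesic_space X"
    and "\<not> contractible X"
    and "X\<^sub>0 \<subseteq> X"
    and "deformation_retracts_to X X\<^sub>0"
    and "\<And>Y. Y \<subseteq> X \<Longrightarrow> deformation_retracts_to X Y \<Longrightarrow> X\<^sub>0 \<subseteq> Y"
  shows "X\<^sub>0 = pi1_hull X"
proof -
  interpret one_dim_geodesic_space X
    by unfold_locales (use assms in \<open>auto simp: has_covering_dim_def\<close>)
  show ?thesis
  proof
    show "pi1_hull X \<subseteq> X\<^sub>0" by (rule hull_subset_retract[OF assms(5,6)])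
    show "X\<^sub>0 \<subseteq> pi1_hull X"
    proof
      fix q assume "q \<in> X\<^sub>0"
      then show "q \<in> pi1_hull X" using retract_avoiding[OF assms(4), of q] assms(5,7) by blast
    qed
  qed
qed

end
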